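(* Let $(R,\mathfrak m,k)$ be a noetherian local ring with a Koszul filtration $\mathcal F$. Then: (i) for every ideal $I\in\mathcal F$, $R/I$ is a Koszul $R$-module; (ii) $R$ is a Koszul ring; (iii) $R/I$ is a Koszul ring for every $I\in\mathcal F$.
   Context: Rings are commutative noetherian. Koszul filtration: let $(R,\mathfrak m,k)$ be a local ring and $\mathcal F$ a collection of ideals of $R$. $\mathcal F$ is a Koszul filtration of $R$ if all of the following hold: (F1) $(0),\mathfrak m\in\mathcal F$; (F2) for every $I\in\mathcal F$ and all $s\ge 1$, $I\cap\mathfrak m^{s+1}=\mathfrak m^sI$; (F3) for every ideal $I\ne(0)$ of $\mathcal F$ there exist a finite filtration $(0)=I_0\subset I_1\subset\cdots\subset I_n=I$ and elements $x_j\in\mathfrak m$ such that for each $j=1,\dots,n$: $I_j\in\mathcal F$, $I_j=I_{j-1}+(x_j)$ and $I_{j-1}:x_j\in\mathcal F$. Linearity defect: for a finitely generated $R$-module $M$ with minimal free resolution $F$, filter $F$ by the subcomplexes $\mathcal G^nF$ with $(\mathcal G^nF)_i=\mathfrak m^{n-i}F_i$ (where $\mathfrak m^j=R$ for $j\le 0$), with differential induced by that of $F$. The associated graded complex of this filtration is the linear part $\operatorname{lin}^R F$. The linearity defect is $\operatorname{ld}_R M=\sup\{i: H_i(\operatorname{lin}^R F)\ne 0\}\in\{0,1,\dots\}\cup\{\infty\}$ for $M\neq 0$, and $\operatorname{ld}_R 0=0$. $M$ is a Koszul module over $R$ if $\operatorname{ld}_R M=0$. A local ring is a Koszul ring if its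 residue field is a Koszul module over it. *)

theory Defs
  imports "HOL-Algebra.Algebra" "HOL-Library.Extended_Nat"
begin

section \<open>Local rings and Koszul filtrations\<close>

definition noetherian_local_ring :: "('a, 'b) ring_scheme \<Rightarrow> bool" where
  "noetherian_local_ring R \<longleftrightarrow>
     cring R \<and> noetherian_ring R \<and> (\<exists>!\<mm>. maximalideal \<mm> R)"

definition max_ideal :: "('a, 'b) ring_scheme \<Rightarrow> 'a set" where
  "max_ideal R = (THE \<mm>. maximalideal \<mm> R)"

definition ideal_power :: "('a, 'b) ring_scheme \<Rightarrow> 'a set \<Rightarrow> nat \<Rightarrow> 'a set" where
  "ideal_power R I n = I [^]\<^bsub>ideals_set R\<^esub> n"

definition colon_ideal :: "('a, 'b) ring_scheme \<Rightarrow> 'a set \<Rightarrow> 'a \<Rightarrow> 'a set" where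
  "colon_ideal R I x = {a \<in> carrier R. a \<otimes>\<^bsub>R\<^esub> x \<in> I}"

text \<open>The inclusions in the chain are not required to be strict. Strictness is automatic:
  by the last clause every member of \<open>\<F>\<close> lies in the maximal ideal, whereas the colon ideal
  of a non-strict step would be the unit ideal.\<close>

definition koszul_filtration :: "('a, 'b) ring_scheme \<Rightarrow> 'a set set \<Rightarrow> bool" where
  "koszul_filtration R \<F> \<longleftrightarrow>
     (\<forall>I\<in>\<F>. ideal I R) \<and>
     {\<zero>\<^bsub>R\<^esub>} \<in> \<F> \<and> max_ideal R \<in> \<F> \<and>
     (\<forall>I\<in>\<F>. \<forall>s\<ge>1. I \<inter> ideal_power R (max_ideal R) (s + 1)
                    = ideal_power R (max_ideal R) s \<cdot>\<^bsub>R\<^esub> I) \<and>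
     (\<forall>I\<in>\<F>. I \<noteq> {\<zero>\<^bsub>R\<^esub>} \<longrightarrow>
        (\<exists>(n::nat) J x. J 0 = {\<zero>\<^bsub>R\<^esub>} \<and> J n = I \<and>
           (\<forall>j\<in>{1..n}. J (j - 1) \<subseteq> J j \<and> x j \<in> max_ideal R \<and> J j \<in> \<F> \<and>
              J j = J (j - 1) <+>\<^bsub>R\<^esub> PIdl\<^bsub>R\<^esub> (x j) \<and>
              colon_ideal R (J (j - 1)) (x j) \<in> \<F>)))"


section \<open>Modules\<close>

definition module_hom ::
  "('a, 'b) ring_scheme \<Rightarrow> ('a, 'm, 'c) module_scheme \<Rightarrow> ('a, 'n, 'd) module_scheme \<Rightarrow> ('m \<Rightarrow> 'n) set"
  where
  "module_hom R M N =
     {f \<in> carrier M \<rightarrow> carrier N.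
        (\<forall>x\<in>carrier M. \<forall>y\<in>carrier M. f (x \<oplus>\<^bsub>M\<^esub> y) = f x \<oplus>\<^bsub>N\<^esub> f y) \<and>
        (\<forall>a\<in>carrier R. \<forall>x\<in>carrier M. f (a \<odot>\<^bsub>M\<^esub> x) = a \<odot>\<^bsub>N\<^esub> f x)}"

text \<open>The submodule \<open>I M\<close>.\<close>

definition ideal_smult :: "'a set \<Rightarrow> ('a, 'm, 'c) module_scheme \<Rightarrow> 'm set" where
  "ideal_smult I M = generate (add_monoid M) {a \<odot>\<^bsub>M\<^esub> x | a x. a \<in> I \<and> x \<in> carrier M}"

definition fin_gen_module :: "('a, 'b) ring_scheme \<Rightarrow> ('a, 'm, 'c) module_scheme \<Rightarrow> bool" where
  "fin_gen_module R M \<longleftrightarrow> module R M \<and>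
     (\<exists>A. finite A \<and> A \<subseteq> carrier M \<and>
        carrier M = generate (add_monoid M) {a \<odot>\<^bsub>M\<^esub> x | a x. a \<in> carrier R \<and> x \<in> A})"

text \<open>\<open>R/I\<close> as an \<open>R\<close>-module, by restriction of scalars along \<open>R \<rightarrow> R/I\<close>.\<close>

definition quot_module :: "('a, 'b) ring_scheme \<Rightarrow> 'a set \<Rightarrow> ('a, 'a set) module" where
  "quot_module R I =
     \<lparr>carrier = carrier (R Quot I), monoid.mult = monoid.mult (R Quot I), one = one (R Quot I),
      ring.zero = ring.zero (R Quot I), add = add (R Quot I),
      smult = (\<lambda>r C. (I +>\<^bsub>R\<^esub> r) \<otimes>\<^bsub>R Quot I\<^esub> C)\<rparr>"

text \<open>The free module \<open>R\<^sup>n\<close>. The fields \<open>mult\<close> and \<open>one\<close> are only there because module records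
  extend ring records.\<close>

definition free_module :: "('a, 'b) ring_scheme \<Rightarrow> nat \<Rightarrow> ('a, nat \<Rightarrow> 'a) module" where
  "free_module R n =
     \<lparr>carrier = {..<n} \<rightarrow>\<^sub>E carrier R,
      monoid.mult = (\<lambda>x y. \<lambda>i\<in>{..<n}. x i \<otimes>\<^bsub>R\<^esub> y i), one = (\<lambda>i\<in>{..<n}. \<one>\<^bsub>R\<^esub>),
      ring.zero = (\<lambda>i\<in>{..<n}. \<zero>\<^bsub>R\<^esub>), add = (\<lambda>x y. \<lambda>i\<in>{..<n}. x i \<oplus>\<^bsub>R\<^esub> y i),
      smult = (\<lambda>a x. \<lambda>i\<in>{..<n}. a \<otimes>\<^bsub>R\<^esub> x i)\<rparr>"


section \<open>Minimal free resolutions\<close>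

text \<open>A complex of finitely generated free modules
  \<open>\<dots> \<rightarrow> F\<^sub>2 \<rightarrow> F\<^sub>1 \<rightarrow> F\<^sub>0 \<rightarrow> 0\<close> with \<open>F\<^sub>i = R\<close> to the power \<open>cx_rank i\<close>;
  \<open>cx_diff i\<close> is the differential from degree \<open>i + 1\<close> to degree \<open>i\<close>.\<close>

record 'a free_complex =
  cx_rank :: "nat \<Rightarrow> nat"
  cx_diff :: "nat \<Rightarrow> (nat \<Rightarrow> 'a) \<Rightarrow> (nat \<Rightarrow> 'a)"

definition cx_module :: "('a, 'b) ring_scheme \<Rightarrow> 'a free_complex \<Rightarrow> nat \<Rightarrow> ('a, nat \<Rightarrow> 'a) module"
  where "cx_module R F i = free_module R (cx_rank F i)"

definition minimal_free_resolution ::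
  "('a, 'b) ring_scheme \<Rightarrow> ('a, 'm, 'c) module_scheme \<Rightarrow> 'a free_complex \<Rightarrow> ((nat \<Rightarrow> 'a) \<Rightarrow> 'm) \<Rightarrow> bool"
  where
  "minimal_free_resolution R M F \<epsilon> \<longleftrightarrow>
     (\<forall>i. cx_diff F i \<in> module_hom R (cx_module R F (Suc i)) (cx_module R F i)) \<and>
     \<epsilon> \<in> module_hom R (cx_module R F 0) M \<and>
     \<epsilon> ` carrier (cx_module R F 0) = carrier M \<and>
     a_kernel (cx_module R F 0) M \<epsilon> = cx_diff F 0 ` carrier (cx_module R F 1) \<and>
     (\<forall>i. a_kernel (cx_module R F (Suc i)) (cx_module R F i) (cx_diff F i)
          = cx_diff F (Suc i) ` carrier (cx_module R F (Suc (Suc i)))) \<and>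
     (\<forall>i. cx_diff F i ` carrier (cx_module R F (Suc i))
          \<subseteq> ideal_smult (max_ideal R) (cx_module R F i))"


section \<open>The linear part and the linearity defect\<close>

text \<open>\<open>filt R F n i\<close> is the degree \<open>i\<close> component of the \<open>n\<close>-th filtration subcomplex. Truncated
  subtraction on \<^typ>\<open>nat\<close> gives the convention that nonpositive powers of the maximal ideal are
  the unit ideal. Negative \<open>n\<close> can be left out: their filtration quotients are zero.\<close>

definition filt :: "('a, 'b) ring_scheme \<Rightarrow> 'a free_complex \<Rightarrow> nat \<Rightarrow> nat \<Rightarrow> (nat \<Rightarrow> 'a) set" where
  "filt R F n i = ideal_smult (ideal_power R (max_ideal R) (n - i)) (cx_module R F i)"

definition gr_piece ::
  "('a, 'b) ring_scheme \<Rightarrow> 'a free_complex \<Rightarrow> nat \<Rightarrow> nat \<Rightarrow> (nat \<Rightarrow> 'a) set monoid" where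
  "gr_piece R F n i = ((cx_module R F i)\<lparr>carrier := filt R F n i\<rparr>) A_Mod (filt R F (Suc n) i)"

text \<open>The linear part in degree \<open>i\<close>, the direct sum over \<open>n\<close> of the filtration quotients. Only the
  additive group is recorded, which suffices to decide whether homology vanishes.\<close>

definition lin_part ::
  "('a, 'b) ring_scheme \<Rightarrow> 'a free_complex \<Rightarrow> nat \<Rightarrow> (nat \<Rightarrow> (nat \<Rightarrow> 'a) set) monoid" where
  "lin_part R F i = sum_group UNIV (\<lambda>n. gr_piece R F n i)"

text \<open>The induced differential from degree \<open>i + 1\<close> to degree \<open>i\<close>; the \<open>n\<close>-th component of \<open>\<xi>\<close> is a
  coset, and all the cosets in the union are equal.\<close>

definition lin_diff ::
  "('a, 'b) ring_scheme \<Rightarrow> 'a free_complex \<Rightarrow> nat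
     \<Rightarrow> (nat \<Rightarrow> (nat \<Rightarrow> 'a) set) \<Rightarrow> (nat \<Rightarrow> (nat \<Rightarrow> 'a) set)" where
  "lin_diff R F i \<xi> =
     (\<lambda>n. \<Union>y\<in>\<xi> n. filt R F (Suc n) i +>\<^bsub>cx_module R F i\<^esub> cx_diff F i y)"

definition lin_cycles ::
  "('a, 'b) ring_scheme \<Rightarrow> 'a free_complex \<Rightarrow> nat \<Rightarrow> (nat \<Rightarrow> (nat \<Rightarrow> 'a) set) set" where
  "lin_cycles R F i =
     (case i of 0 \<Rightarrow> carrier (lin_part R F 0)
      | Suc j \<Rightarrow> kernel (lin_part R F (Suc j)) (lin_part R F j) (lin_diff R F j))"

definition lin_boundaries ::
  "('a, 'b) ring_scheme \<Rightarrow> 'a free_complex \<Rightarrow> nat \<Rightarrow> (nat \<Rightarrow> (nat \<Rightarrow> 'a) set) set" where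
  "lin_boundaries R F i = lin_diff R F i ` carrier (lin_part R F (Suc i))"

definition lin_homology ::
  "('a, 'b) ring_scheme \<Rightarrow> 'a free_complex \<Rightarrow> nat \<Rightarrow> (nat \<Rightarrow> (nat \<Rightarrow> 'a) set) set monoid" where
  "lin_homology R F i =
     ((lin_part R F i)\<lparr>carrier := lin_cycles R F i\<rparr>) Mod (lin_boundaries R F i)"

text \<open>The minimal free resolution exists for finitely generated modules over noetherian local
  rings and is unique up to isomorphism, so the choice made here is immaterial.\<close>

definition linearity_defect :: "('a, 'b) ring_scheme \<Rightarrow> ('a, 'm, 'c) module_scheme \<Rightarrow> enat" where
  "linearity_defect R M =
     (if carrier M = {\<zero>\<^bsub>M\<^esub>} then 0
      else (let F = (SOME F. \<exists>\<epsilon>. minimal_free_resolution R M F \<epsilon>)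
            in Sup {enat i | i. \<not> trivial_group (lin_homology R F i)}))"

definition koszul_module :: "('a, 'b) ring_scheme \<Rightarrow> ('a, 'm, 'c) module_scheme \<Rightarrow> bool" where
  "koszul_module R M \<longleftrightarrow> fin_gen_module R M \<and> linearity_defect R M = 0"

definition koszul_ring :: "('a, 'b) ring_scheme \<Rightarrow> bool" where
  "koszul_ring R \<longleftrightarrow>
     noetherian_local_ring R \<and> koszul_module R (quot_module R (max_ideal R))"

end

theory Submission
  imports Defs
begin

text \<open>
  Let \<open>F\<close> be a minimal free resolution with differentials \<open>d\<^sub>i\<close>. Its linear part is acyclic in
  positive degrees as soon as each \<open>Z = im d\<^sub>i\<close> satisfies \<open>Z \<inter> \<mm>\<^sup>s\<^sup>+\<^sup>1 F\<^sub>i = \<mm>\<^sup>s Z\<close> for all \<open>s\<close>; this is a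
  short diagram chase (\<open>lin_homology_trivial\<close>). For the first syzygy module \<open>I\<close> of \<open>R/I\<close> this condition is
  (F2). For a higher syzygy module of \<open>M\<close> it says that a map \<open>Tor\<^sub>i(\<mm>\<^sup>s\<^sup>+\<^sup>1, M) \<rightarrow> Tor\<^sub>i(\<mm>\<^sup>s, M)\<close> is zero, so it
  depends on \<open>M\<close> alone. Instead of \<open>Tor\<close>, two resolutions are compared one degree at a time
  (\<open>retract_kernel\<close>). The predicate \<open>linear_syz R n b Z\<close> imposes the condition on the first \<open>n\<close> syzygy modules
  of \<open>R\<^sup>b/Z\<close>.

  For \<open>R/I\<close> with \<open>I\<close> in the filtration the proof is by induction on \<open>n\<close>. Beyond (F2) this concerns the
  syzygies of the module \<open>I\<close>. The chain given by (F3) yields exact sequences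
  \<open>0 \<rightarrow> I\<^sub>j\<^sub>-\<^sub>1 \<rightarrow> I\<^sub>j \<rightarrow> R/(I\<^sub>j\<^sub>-\<^sub>1 : x\<^sub>j) \<rightarrow> 0\<close>, in which the left term is known by induction along the chain and the
  right one by induction on \<open>n\<close>. Linearity is inherited by extensions (\<open>linear_syz_extension\<close>), because
  covers of the outer terms combine to a cover of the middle one. The case \<open>I = \<mm>\<close> says that \<open>R\<close> is a Koszul ring.

  For \<open>S = R/I\<close> the residue field is resolved over \<open>S\<close>, and every syzygy module is written as the reduction of
  a submodule \<open>B\<close> with \<open>I\<^sup>b \<subseteq> B \<subseteq> \<mm>R\<^sup>b\<close>, starting from \<open>B = \<mm>\<close>. Both \<open>B\<close> and \<open>I\<^sup>b\<close> are linear over \<open>R\<close>, hence so is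
  \<open>B/I\<^sup>b\<close>, the syzygy module of \<open>R\<^sup>b/B\<close> over \<open>S\<close> (\<open>linear_syz_quotient\<close>). This is what is needed to
  continue with the next syzygy module over \<open>S\<close> (\<open>linear_syz_image\<close>).

  Extensions and quotients use minimal covers: a homomorphism into \<open>\<mm>R\<^sup>b\<close> raises the \<open>\<mm>\<close>-adic order by one,
  so lifts along it keep track of orders exactly.
\<close>

section \<open>Modules and their homomorphisms\<close>

lemma (in abelian_group) diff_add_cancel:
  "x \<in> carrier G \<Longrightarrow> y \<in> carrier G \<Longrightarrow> (x \<ominus> y) \<oplus> y = x"
  by (simp add: a_minus_def a_assoc l_neg)

lemma (in abelian_group) diff_zero: "x \<in> carrier G \<Longrightarrow> x \<ominus> \<zero> = x"
  using diff_add_cancel[of x \<zero>] by simp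

lemma (in abelian_group) add_diff_cancel3:
  assumes "x \<in> carrier G" "y \<in> carrier G" "z \<in> carrier G"
  shows "y \<oplus> (z \<oplus> (x \<ominus> (y \<oplus> z))) = x"
proof -
  have "y \<oplus> (z \<oplus> (x \<ominus> (y \<oplus> z))) = x \<oplus> ((y \<oplus> z) \<oplus> \<ominus> (y \<oplus> z))"
    using assms by (simp add: a_minus_def a_ac)
  also have "\<dots> = x" using assms by (simp add: r_neg del: minus_add)
  finally show ?thesis .
qed

lemma (in abelian_group) add_diff_diff:
  assumes "x \<in> carrier G" "y \<in> carrier G" "z \<in> carrier G"
  shows "(x \<oplus> y) \<ominus> (y \<ominus> z) = x \<oplus> z"
proof -
  have "(x \<oplus> y) \<ominus> (y \<ominus> z) = x \<oplus> z \<oplus> (y \<oplus> \<ominus> y)"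
    using assms by (simp add: a_minus_def a_ac minus_add)
  then show ?thesis using assms by (simp add: r_neg)
qed

lemma module_homI:
  assumes "\<And>x. x \<in> carrier M \<Longrightarrow> f x \<in> carrier N"
    and "\<And>x y. x \<in> carrier M \<Longrightarrow> y \<in> carrier M \<Longrightarrow> f (x \<oplus>\<^bsub>M\<^esub> y) = f x \<oplus>\<^bsub>N\<^esub> f y"
    and "\<And>a x. a \<in> carrier R \<Longrightarrow> x \<in> carrier M \<Longrightarrow> f (a \<odot>\<^bsub>M\<^esub> x) = a \<odot>\<^bsub>N\<^esub> f x"
  shows "f \<in> module_hom R M N"
  using assms by (auto simp: module_hom_def)

lemma module_hom_closed: "f \<in> module_hom R M N \<Longrightarrow> x \<in> carrier M \<Longrightarrow> f x \<in> carrier N"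
  by (auto simp: module_hom_def)

lemma module_hom_add:
  "f \<in> module_hom R M N \<Longrightarrow> x \<in> carrier M \<Longrightarrow> y \<in> carrier M \<Longrightarrow> f (x \<oplus>\<^bsub>M\<^esub> y) = f x \<oplus>\<^bsub>N\<^esub> f y"
  by (auto simp: module_hom_def)

lemma module_hom_smult:
  "f \<in> module_hom R M N \<Longrightarrow> a \<in> carrier R \<Longrightarrow> x \<in> carrier M \<Longrightarrow> f (a \<odot>\<^bsub>M\<^esub> x) = a \<odot>\<^bsub>N\<^esub> f x"
  by (auto simp: module_hom_def)

lemma module_hom_zero:
  assumes "module R M" "module R N" "f \<in> module_hom R M N"
  shows "f \<zero>\<^bsub>M\<^esub> = \<zero>\<^bsub>N\<^esub>"
proof -
  interpret M: module R M by fact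
  interpret N: module R N by fact
  have "f \<zero>\<^bsub>M\<^esub> = f (\<zero>\<^bsub>R\<^esub> \<odot>\<^bsub>M\<^esub> \<zero>\<^bsub>M\<^esub>)" by simp
  also have "\<dots> = \<zero>\<^bsub>R\<^esub> \<odot>\<^bsub>N\<^esub> f \<zero>\<^bsub>M\<^esub>" by (rule module_hom_smult[OF assms(3)]) auto
  also have "\<dots> = \<zero>\<^bsub>N\<^esub>" using module_hom_closed[OF assms(3)] by simp
  finally show ?thesis .
qed

lemma module_hom_uminus:
  assumes "module R M" "module R N" "f \<in> module_hom R M N" "x \<in> carrier M"
  shows "f (\<ominus>\<^bsub>M\<^esub> x) = \<ominus>\<^bsub>N\<^esub> f x"
proof -
  interpret M: module R M by fact
  interpret N: module R N by fact
  have "f (\<ominus>\<^bsub>M\<^esub> x) \<oplus>\<^bsub>N\<^esub> f x = f (\<ominus>\<^bsub>M\<^esub> x \<oplus>\<^bsub>M\<^esub> x)"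
    using assms by (simp add: module_hom_add)
  also have "\<dots> = \<zero>\<^bsub>N\<^esub>"
    using assms by (simp add: M.M.l_neg module_hom_zero)
  finally show ?thesis
    using assms by (metis M.M.a_inv_closed N.M.minus_equality module_hom_closed)
qed

lemma module_hom_minus:
  assumes "module R M" "module R N" "f \<in> module_hom R M N" "x \<in> carrier M" "y \<in> carrier M"
  shows "f (x \<ominus>\<^bsub>M\<^esub> y) = f x \<ominus>\<^bsub>N\<^esub> f y"
proof -
  interpret M: module R M by fact
  interpret N: module R N by fact
  show ?thesis
    using assms by (simp add: a_minus_def module_hom_add module_hom_uminus)
qed

lemma module_hom_comp:
  "f \<in> module_hom R M N \<Longrightarrow> g \<in> module_hom R N P \<Longrightarrow> (\<lambda>x. g (f x)) \<in> module_hom R M P"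
  by (auto simp: module_hom_def Pi_iff)

lemma module_hom_id: "(\<lambda>x. x) \<in> module_hom R M M"
  by (auto simp: module_hom_def)

lemma module_hom_const_zero: "module R N \<Longrightarrow> (\<lambda>x. \<zero>\<^bsub>N\<^esub>) \<in> module_hom R M N"
  by (rule module_homI) (auto simp: module.smult_r_null module_def abelian_group_def
      abelian_monoid.zero_closed abelian_monoid.l_zero)

lemma module_hom_plus:
  assumes "module R N" "f \<in> module_hom R M N" "g \<in> module_hom R M N"
  shows "(\<lambda>x. f x \<oplus>\<^bsub>N\<^esub> g x) \<in> module_hom R M N"
proof -
  interpret N: module R N by fact
  show ?thesis
    using assms(2,3)
    by (intro module_homI)
      (auto simp: module_hom_add module_hom_smult module_hom_closed N.smult_r_distr N.M.a_ac)
qed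

lemma module_hom_diff:
  assumes "module R N" "f \<in> module_hom R M N" "g \<in> module_hom R M N"
  shows "(\<lambda>x. f x \<ominus>\<^bsub>N\<^esub> g x) \<in> module_hom R M N"
proof -
  interpret N: module R N by fact
  show ?thesis
    using assms(2,3)
    by (intro module_homI)
      (auto simp: a_minus_def module_hom_add module_hom_smult module_hom_closed N.smult_r_distr
        N.M.a_ac N.smult_r_minus N.M.minus_add)
qed

lemma (in module) submodule_zero_mem: "submodule H R M \<Longrightarrow> \<zero>\<^bsub>M\<^esub> \<in> H"
  by (metis submodule.axioms(1) subgroup.one_closed monoid.simps(2))

lemma (in module) submodule_minus_mem:
  "submodule H R M \<Longrightarrow> x \<in> H \<Longrightarrow> y \<in> H \<Longrightarrow> x \<ominus>\<^bsub>M\<^esub> y \<in> H"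
  by (simp add: a_minus_def submoduleE)

lemma (in module) submodule_zero: "submodule {\<zero>\<^bsub>M\<^esub>} R M"
  by (rule submoduleI) auto

lemma module_hom_image_submodule:
  assumes "module R M" "module R N" "f \<in> module_hom R M N" "submodule H R M"
  shows "submodule (f ` H) R N"
proof -
  interpret M: module R M by fact
  interpret N: module R N by fact
  note H = M.submoduleE[OF assms(4)]
  note f = module_hom_add[OF assms(3)] module_hom_smult[OF assms(3)] module_hom_closed[OF assms(3)]
    module_hom_uminus[OF assms(1-3)]
  show ?thesis
  proof (rule N.submoduleI)
    show "\<zero>\<^bsub>N\<^esub> \<in> f ` H"
      using module_hom_zero[OF assms(1-3)] M.submodule_zero_mem[OF assms(4)] by force
    show "a \<odot>\<^bsub>N\<^esub> x \<in> f ` H" if "a \<in> carrier R" "x \<in> f ` H" for a x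
      using that f(2) H(1,4) by (force simp: image_iff)
    show "x \<oplus>\<^bsub>N\<^esub> y \<in> f ` H" if xy: "x \<in> f ` H" "y \<in> f ` H" for x y
    proof -
      obtain u v where "u \<in> H" "v \<in> H" "x = f u" "y = f v" using xy by blast
      then show ?thesis using f(1)[of u v] H(1,5) by (metis imageI subsetD)
    qed
    show "\<ominus>\<^bsub>N\<^esub> x \<in> f ` H" if xH: "x \<in> f ` H" for x
    proof -
      obtain u where "u \<in> H" "x = f u" using xH by blast
      then show ?thesis using f(4)[of u] H(1,3) by (metis imageI subsetD)
    qed
  qed (use f(3) H(1) in blast)
qed

lemma mem_a_kernel: "x \<in> a_kernel M N f \<longleftrightarrow> x \<in> carrier M \<and> f x = \<zero>\<^bsub>N\<^esub>"
  by (simp add: a_kernel_def')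

lemma a_kernelI: "x \<in> carrier M \<Longrightarrow> f x = \<zero>\<^bsub>N\<^esub> \<Longrightarrow> x \<in> a_kernel M N f"
  by (simp add: mem_a_kernel)

lemma a_kernelD: "x \<in> a_kernel M N f \<Longrightarrow> x \<in> carrier M" "x \<in> a_kernel M N f \<Longrightarrow> f x = \<zero>\<^bsub>N\<^esub>"
  by (simp_all add: mem_a_kernel)

lemma module_hom_vimage_submodule:
  assumes "module R M" "module R N" "f \<in> module_hom R M N" "submodule H R N"
  shows "submodule {x \<in> carrier M. f x \<in> H} R M"
proof -
  interpret M: module R M by fact
  interpret N: module R N by fact
  note H = N.submoduleE[OF assms(4)]
  show ?thesis
    using H assms(3) module_hom_zero[OF assms(1-3)] N.submodule_zero_mem[OF assms(4)]
    by (intro M.submoduleI)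
      (auto simp: module_hom_add module_hom_smult module_hom_uminus[OF assms(1-3)])
qed

lemma a_kernel_submodule:
  assumes "module R M" "module R N" "f \<in> module_hom R M N"
  shows "submodule (a_kernel M N f) R M"
proof -
  interpret N: module R N by fact
  show ?thesis
    using module_hom_vimage_submodule[OF assms N.submodule_zero] by (simp add: a_kernel_def')
qed

section \<open>Free modules\<close>

abbreviation vecs :: "nat \<Rightarrow> 'a set \<Rightarrow> (nat \<Rightarrow> 'a) set" where
  "vecs n J \<equiv> {..<n} \<rightarrow>\<^sub>E J"

lemma free_module_simps [simp]:
  "carrier (free_module R n) = vecs n (carrier R)"
  "\<zero>\<^bsub>free_module R n\<^esub> = (\<lambda>i\<in>{..<n}. \<zero>\<^bsub>R\<^esub>)"
  "x \<oplus>\<^bsub>free_module R n\<^esub> y = (\<lambda>i\<in>{..<n}. x i \<oplus>\<^bsub>R\<^esub> y i)"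
  "a \<odot>\<^bsub>free_module R n\<^esub> x = (\<lambda>i\<in>{..<n}. a \<otimes>\<^bsub>R\<^esub> x i)"
  by (simp_all add: free_module_def)

lemma vec_eqI:
  "x \<in> vecs n A \<Longrightarrow> y \<in> vecs n B \<Longrightarrow> (\<And>i. i < n \<Longrightarrow> x i = y i) \<Longrightarrow> x = y"
  by (rule PiE_ext) auto

text \<open>Direct sum decompositions \<open>R\<^sup>p\<^sup>+\<^sup>q = R\<^sup>p \<oplus> R\<^sup>q\<close> are written out in coordinates, so that the sum is again
  a module of the form \<open>free_module R n\<close>. Extensions of modules use them, and so do inductions on the
  rank, with \<open>q = 1\<close>.\<close>

definition app :: "nat \<Rightarrow> nat \<Rightarrow> (nat \<Rightarrow> 'a) \<Rightarrow> (nat \<Rightarrow> 'a) \<Rightarrow> (nat \<Rightarrow> 'a)" where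
  "app p q u v = (\<lambda>i\<in>{..<p + q}. if i < p then u i else v (i - p))"

definition lo :: "nat \<Rightarrow> (nat \<Rightarrow> 'a) \<Rightarrow> (nat \<Rightarrow> 'a)" where
  "lo p v = (\<lambda>i\<in>{..<p}. v i)"

definition hi :: "nat \<Rightarrow> nat \<Rightarrow> (nat \<Rightarrow> 'a) \<Rightarrow> (nat \<Rightarrow> 'a)" where
  "hi p q v = (\<lambda>i\<in>{..<q}. v (p + i))"

lemma app_mem [simp]: "u \<in> vecs p J \<Longrightarrow> v \<in> vecs q J \<Longrightarrow> app p q u v \<in> vecs (p + q) J"
  by (auto simp: app_def PiE_iff)

lemma lo_mem [simp]: "v \<in> vecs (p + q) J \<Longrightarrow> lo p v \<in> vecs p J"
  by (auto simp: lo_def PiE_iff)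

lemma hi_mem [simp]: "v \<in> vecs (p + q) J \<Longrightarrow> hi p q v \<in> vecs q J"
  by (auto simp: hi_def PiE_iff)

lemma app_lo_hi [simp]: "v \<in> vecs (p + q) J \<Longrightarrow> app p q (lo p v) (hi p q v) = v"
  by (rule ext) (auto simp: app_def lo_def hi_def PiE_iff extensional_def)

lemma lo_app [simp]: "u \<in> vecs p J \<Longrightarrow> lo p (app p q u v) = u"
  by (rule ext) (auto simp: app_def lo_def PiE_iff extensional_def)

lemma hi_app [simp]: "v \<in> vecs q J \<Longrightarrow> hi p q (app p q u v) = v"
  by (rule ext) (auto simp: app_def hi_def PiE_iff extensional_def)

text \<open>The ring occurs as its free module of rank one, whose submodules correspond to ideals through \<open>single\<close>.\<close>

definition single :: "'a \<Rightarrow> (nat \<Rightarrow> 'a)" where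
  "single a = (\<lambda>i\<in>{..<1}. a)"

lemma single_mem [simp]: "single a \<in> vecs 1 J \<longleftrightarrow> a \<in> J" "single a \<in> {..<Suc 0} \<rightarrow>\<^sub>E J \<longleftrightarrow> a \<in> J"
  "single a \<in> {0} \<rightarrow>\<^sub>E J \<longleftrightarrow> a \<in> J"
  by (auto simp: single_def PiE_iff extensional_def)

lemma single_nth [simp]: "single a 0 = a"
  by (simp add: single_def)

lemma single_eta: "v \<in> vecs 1 J \<Longrightarrow> single (v 0) = v"
  by (rule vec_eqI[where A = J and B = J and n = 1]) (auto simp: PiE_iff single_def)

context cring
begin

lemma free_module_module: "module R (free_module R n)"
proof (rule moduleI)
  show "cring R" by (rule is_cring)
  show "abelian_group (free_module R n)"
  proof (rule abelian_groupI)
    fix x assume x: "x \<in> carrier (free_module R n)"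
    show "\<exists>y\<in>carrier (free_module R n). y \<oplus>\<^bsub>free_module R n\<^esub> x = \<zero>\<^bsub>free_module R n\<^esub>"
      using x by (intro bexI[of _ "\<lambda>i\<in>{..<n}. \<ominus> x i"]) (auto simp: PiE_iff l_neg intro!: restrict_ext)
    show "\<zero>\<^bsub>free_module R n\<^esub> \<oplus>\<^bsub>free_module R n\<^esub> x = x"
      using x by (intro vec_eqI[where n = n and A = "carrier R" and B = "carrier R"]) (auto simp: PiE_iff)
  qed (auto simp: PiE_iff a_ac intro!: restrict_ext)
  show "\<one> \<odot>\<^bsub>free_module R n\<^esub> x = x" if "x \<in> carrier (free_module R n)" for x
    using that by (intro vec_eqI[where n = n and A = "carrier R" and B = "carrier R"]) (auto simp: PiE_iff)
qed (auto simp: PiE_iff l_distr r_distr m_assoc intro!: restrict_ext)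

lemma free_module_uminus:
  assumes "x \<in> vecs n (carrier R)"
  shows "\<ominus>\<^bsub>free_module R n\<^esub> x = (\<lambda>i\<in>{..<n}. \<ominus> x i)"
proof -
  interpret M: module R "free_module R n" by (rule free_module_module)
  show ?thesis
    using assms by (intro M.minus_equality) (auto simp: PiE_iff l_neg intro!: restrict_ext)
qed

lemma free_module_minus:
  assumes "x \<in> vecs n (carrier R)" "y \<in> vecs n (carrier R)"
  shows "x \<ominus>\<^bsub>free_module R n\<^esub> y = (\<lambda>i\<in>{..<n}. x i \<ominus> y i)"
  unfolding a_minus_def free_module_uminus[OF assms(2)] by (auto intro!: restrict_ext)

lemma vec_ideal_submodule:
  assumes "ideal J R"
  shows "submodule (vecs n J) R (free_module R n)"
proof -
  interpret M: module R "free_module R n" by (rule free_module_module)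
  interpret J: ideal J R by fact
  have [simp]: "a \<in> J \<Longrightarrow> a \<in> carrier R" for a by (rule J.Icarr)
  have sub: "(vecs n J) \<subseteq> vecs n (carrier R)" by (rule PiE_mono) (auto dest: J.Icarr)
  show ?thesis
    apply (rule M.submoduleI)
    using sub apply simp
    apply (simp add: PiE_iff)
    subgoal for a using sub by (subst free_module_uminus) (auto simp: PiE_iff)
    apply (auto simp: PiE_iff J.I_l_closed)
    done
qed

lemma vec_ideal_carrier: "ideal J R \<Longrightarrow> x \<in> vecs n J \<Longrightarrow> x \<in> vecs n (carrier R)"
  by (auto simp: PiE_iff dest: ideal.Icarr)

lemma hom_app_left: "(\<lambda>u. app p q u \<zero>\<^bsub>free_module R q\<^esub>) \<in> module_hom R (free_module R p) (free_module R (p + q))"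
  by (rule module_homI) (auto simp: app_def PiE_iff intro!: restrict_ext)

lemma hom_app_right: "app p q \<zero>\<^bsub>free_module R p\<^esub> \<in> module_hom R (free_module R q) (free_module R (p + q))"
  by (rule module_homI) (auto simp: app_def PiE_iff intro!: restrict_ext)

lemma hom_lo: "lo p \<in> module_hom R (free_module R (p + q)) (free_module R p)"
  by (rule module_homI) (auto simp: lo_def PiE_iff intro!: restrict_ext)

lemma hom_hi: "hi p q \<in> module_hom R (free_module R (p + q)) (free_module R q)"
  by (rule module_homI) (auto simp: hi_def PiE_iff intro!: restrict_ext)

lemma app_zero_zero: "app p q \<zero>\<^bsub>free_module R p\<^esub> \<zero>\<^bsub>free_module R q\<^esub> = \<zero>\<^bsub>free_module R (p + q)\<^esub>"
  by (auto simp: app_def intro!: restrict_ext)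

lemma app_split:
  "u \<in> vecs p (carrier R) \<Longrightarrow> v \<in> vecs q (carrier R) \<Longrightarrow>
   app p q u v = app p q u \<zero>\<^bsub>free_module R q\<^esub> \<oplus>\<^bsub>free_module R (p + q)\<^esub> app p q \<zero>\<^bsub>free_module R p\<^esub> v"
  by (auto simp: app_def PiE_iff intro!: restrict_ext)

text \<open>Covers of two submodules join to a cover of their sum; this is how covers of extensions are built.\<close>

definition join ::
  "('a, 'm, 'c) module_scheme \<Rightarrow> nat \<Rightarrow> nat \<Rightarrow> ((nat \<Rightarrow> 'a) \<Rightarrow> 'm) \<Rightarrow> ((nat \<Rightarrow> 'a) \<Rightarrow> 'm) \<Rightarrow> (nat \<Rightarrow> 'a) \<Rightarrow> 'm"
  where "join N p q f g v = f (lo p v) \<oplus>\<^bsub>N\<^esub> g (hi p q v)"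

lemma hom_join:
  assumes "module R N" "f \<in> module_hom R (free_module R p) N" "g \<in> module_hom R (free_module R q) N"
  shows "join N p q f g \<in> module_hom R (free_module R (p + q)) N"
  unfolding join_def
  by (rule module_hom_plus[OF assms(1) module_hom_comp[OF hom_lo assms(2)] module_hom_comp[OF hom_hi assms(3)]])

lemma join_app:
  assumes "u \<in> vecs p J" "v \<in> vecs q J'"
  shows "join N p q f g (app p q u v) = f u \<oplus>\<^bsub>N\<^esub> g v"
  using assms by (simp add: join_def)

lemma hom_single:
  assumes "module R N" "x \<in> carrier N"
  shows "(\<lambda>v. v 0 \<odot>\<^bsub>N\<^esub> x) \<in> module_hom R (free_module R 1) N"
proof -
  interpret N: module R N by fact
  show ?thesis
    using assms(2) by (intro module_homI) (auto simp: PiE_iff N.smult_l_distr N.smult_assoc1)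
qed

lemma hom_from_single:
  assumes "f \<in> module_hom R (free_module R 1) N" "v \<in> vecs 1 (carrier R)"
  shows "f v = v 0 \<odot>\<^bsub>N\<^esub> f (single \<one>)"
proof -
  have v0: "v 0 \<in> carrier R" using assms(2) by auto
  have "v 0 \<odot>\<^bsub>free_module R 1\<^esub> single \<one> = v"
    using v0 by (rule_tac trans[OF _ single_eta[OF assms(2)]]) (auto simp: single_def intro!: restrict_ext)
  then show ?thesis
    using module_hom_smult[OF assms(1), of "v 0" "single \<one>"] v0 by simp
qed

lemma hom_from_app:
  assumes "f \<in> module_hom R (free_module R (p + q)) N"
    and "u \<in> vecs p (carrier R)" "v \<in> vecs q (carrier R)"
  shows "f (app p q u v) = f (app p q u \<zero>\<^bsub>free_module R q\<^esub>) \<oplus>\<^bsub>N\<^esub> f (app p q \<zero>\<^bsub>free_module R p\<^esub> v)"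
proof -
  have "app p q u \<zero>\<^bsub>free_module R q\<^esub> \<in> carrier (free_module R (p + q))"
    "app p q \<zero>\<^bsub>free_module R p\<^esub> v \<in> carrier (free_module R (p + q))"
    using module_hom_closed[OF hom_app_left, of u p q] module_hom_closed[OF hom_app_right, of v q p] assms(2,3)
    by auto
  then show ?thesis
    unfolding app_split[OF assms(2,3)] by (rule module_hom_add[OF assms(1)])
qed

text \<open>Free modules are projective, by induction on the rank: a basis vector is lifted by choice of a preimage. The
  submodule \<open>Z\<close> records where the lift takes its values.\<close>

lemma lift_hom:
  assumes M: "module R M" and N: "module R N"
    and f: "f \<in> module_hom R (free_module R c) M"
    and g: "g \<in> module_hom R N M" and Z: "submodule Z R N"
    and sub: "f ` carrier (free_module R c) \<subseteq> g ` Z"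
  obtains h where "h \<in> module_hom R (free_module R c) N" "h ` carrier (free_module R c) \<subseteq> Z"
    "\<And>x. x \<in> vecs c (carrier R) \<Longrightarrow> g (h x) = f x"
proof -
  interpret M: module R M by fact
  interpret N: module R N by fact
  have "\<exists>h \<in> module_hom R (free_module R c) N. h ` carrier (free_module R c) \<subseteq> Z \<and>
      (\<forall>x \<in> vecs c (carrier R). g (h x) = f x)"
    using f sub
  proof (induction c arbitrary: f)
    case 0
    have *: "x = \<zero>\<^bsub>free_module R 0\<^esub>" if "x \<in> vecs 0 (carrier R)" for x
      using that by auto
    have "f \<zero>\<^bsub>free_module R 0\<^esub> = \<zero>\<^bsub>M\<^esub>" by (rule module_hom_zero[OF free_module_module M 0(1)])
    then show ?case
      using module_hom_zero[OF N M g] N.submodule_zero_mem[OF Z] *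
      by (intro bexI[OF _ module_hom_const_zero[OF N]]) auto
  next
    case (Suc c)
    have f: "f \<in> module_hom R (free_module R (c + 1)) M" using Suc.prems(1) by simp
    let ?l = "\<lambda>u. app c 1 u \<zero>\<^bsub>free_module R 1\<^esub>"
    let ?r = "app c 1 \<zero>\<^bsub>free_module R c\<^esub>"
    have fl: "(\<lambda>u. f (?l u)) \<in> module_hom R (free_module R c) M"
      by (rule module_hom_comp[OF hom_app_left f])
    have fr: "(\<lambda>u. f (?r u)) \<in> module_hom R (free_module R 1) M"
      by (rule module_hom_comp[OF hom_app_right f])
    have sub: "f x \<in> g ` Z" if "x \<in> carrier (free_module R (c + 1))" for x
      using Suc.prems(2) that by auto
    have "(\<lambda>u. f (?l u)) ` carrier (free_module R c) \<subseteq> g ` Z"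
      using sub module_hom_closed[OF hom_app_left[of c 1]] by blast
    from Suc.IH[OF fl this] obtain h where h: "h \<in> module_hom R (free_module R c) N"
      "h ` carrier (free_module R c) \<subseteq> Z" "\<forall>x \<in> vecs c (carrier R). g (h x) = f (?l x)"
      by blast
    have "f (?r (single \<one>)) \<in> g ` Z"
      by (rule sub, rule module_hom_closed[OF hom_app_right]) simp
    then obtain z where z: "z \<in> Z" "g z = f (?r (single \<one>))" by auto
    have zN: "z \<in> carrier N" using z(1) N.submoduleE(1)[OF Z] by auto
    let ?h = "join N c 1 h (\<lambda>v. v 0 \<odot>\<^bsub>N\<^esub> z)"
    have hh: "?h \<in> module_hom R (free_module R (c + 1)) N"
      by (rule hom_join[OF N h(1) hom_single[OF N zN]])
    have val: "?h x \<in> Z \<and> g (?h x) = f x" if x: "x \<in> vecs (c + 1) (carrier R)" for x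
    proof -
      define u where "u = lo c x"
      define v where "v = hi c 1 x"
      have uv: "u \<in> vecs c (carrier R)" "v \<in> vecs 1 (carrier R)" and xuv: "x = app c 1 u v"
        using x by (simp_all add: u_def v_def del: One_nat_def)
      have v0: "v 0 \<in> carrier R" using uv by auto
      have hx: "?h x = h u \<oplus>\<^bsub>N\<^esub> v 0 \<odot>\<^bsub>N\<^esub> z"
        unfolding xuv by (rule join_app[OF uv])
      have hu: "h u \<in> Z" using h(2) uv(1) by auto
      have huN: "h u \<in> carrier N" using hu N.submoduleE(1)[OF Z] by auto
      have "g (?h x) = g (h u) \<oplus>\<^bsub>M\<^esub> v 0 \<odot>\<^bsub>M\<^esub> g z"
        unfolding hx using g huN zN v0 by (simp add: module_hom_add module_hom_smult)
      also have "\<dots> = f (?l u) \<oplus>\<^bsub>M\<^esub> f (?r v)"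
        using h(3) uv(1) hom_from_single[OF fr uv(2)] z(2) by simp
      also have "\<dots> = f x"
        unfolding xuv by (rule hom_from_app[OF f uv, symmetric])
      finally have "g (?h x) = f x" .
      moreover have "?h x \<in> Z"
        unfolding hx using hu z(1) v0 N.submoduleE(4,5)[OF Z] by blast
      ultimately show ?thesis by blast
    qed
    show ?case
      using hh val by (intro bexI[of _ ?h]) auto
  qed
  with that show thesis by blast
qed

text \<open>A vector with entries in \<open>J\<close> is a \<open>J\<close>-linear combination of basis vectors. Every statement below that a
  homomorphism respects \<open>\<mm>\<close>-adic orders comes from this.\<close>

lemma hom_mem_subgroup:
  assumes N: "module R N" and f: "f \<in> module_hom R (free_module R c) N" and W: "subgroup W (add_monoid N)"
    and J: "J \<subseteq> carrier R"
    and mem: "\<And>a x. a \<in> J \<Longrightarrow> x \<in> vecs c (carrier R) \<Longrightarrow> a \<odot>\<^bsub>N\<^esub> f x \<in> W"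
    and w: "w \<in> vecs c J"
  shows "f w \<in> W"
proof -
  interpret N: module R N by fact
  show ?thesis
    using f mem w
  proof (induction c arbitrary: f w)
    case 0
    have "w = \<zero>\<^bsub>free_module R 0\<^esub>" using "0.prems" by auto
    then have "f w = \<zero>\<^bsub>N\<^esub>" by (simp only: module_hom_zero[OF free_module_module N 0(1)])
    then show ?case using subgroup.one_closed[OF W] by simp
  next
    case (Suc c)
    have f: "f \<in> module_hom R (free_module R (c + 1)) N" using Suc.prems(1) by simp
    let ?l = "\<lambda>u. app c 1 u \<zero>\<^bsub>free_module R 1\<^esub>"
    let ?r = "app c 1 \<zero>\<^bsub>free_module R c\<^esub>"
    have l: "?l \<in> module_hom R (free_module R c) (free_module R (c + 1))" by (rule hom_app_left)
    have r: "?r \<in> module_hom R (free_module R 1) (free_module R (c + 1))" by (rule hom_app_right)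
    have fl: "(\<lambda>u. f (?l u)) \<in> module_hom R (free_module R c) N"
      by (rule module_hom_comp[OF hom_app_left f])
    have fr: "(\<lambda>u. f (?r u)) \<in> module_hom R (free_module R 1) N"
      by (rule module_hom_comp[OF hom_app_right f])
    have wJ: "w \<in> vecs (c + 1) J" using Suc.prems(3) by simp
    then have w: "w \<in> vecs (c + 1) (carrier R)" using J by (auto simp: PiE_iff)
    have lw: "f (?l (lo c w)) \<in> W"
    proof (rule Suc.IH[OF fl])
      show "lo c w \<in> vecs c J" using wJ by (rule lo_mem)
      show "a \<odot>\<^bsub>N\<^esub> f (?l x) \<in> W" if "a \<in> J" "x \<in> vecs c (carrier R)" for a x
        using Suc.prems(2)[OF that(1), of "?l x"] module_hom_closed[OF l, of x] that(2) by simp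
    qed
    have hiw: "hi c 1 w \<in> vecs 1 J" using hi_mem[OF wJ] .
    have "f (?r (hi c 1 w)) = hi c 1 w 0 \<odot>\<^bsub>N\<^esub> f (?r (single \<one>))"
      by (rule hom_from_single[OF fr hi_mem[OF w]])
    also have "\<dots> \<in> W"
      using Suc.prems(2)[of "hi c 1 w 0" "?r (single \<one>)"] module_hom_closed[OF r, of "single \<one>"] hiw
      by auto
    finally have rw: "f (?r (hi c 1 w)) \<in> W" .
    have "f w = f (?l (lo c w)) \<oplus>\<^bsub>N\<^esub> f (?r (hi c 1 w))"
      using hom_from_app[OF f lo_mem[OF w] hi_mem[OF w]] app_lo_hi[OF w] by simp
    then show ?case using subgroup.m_closed[OF W lw rw] by simp
  qed
qed

end

declare free_module_simps(2-4) [simp del]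

section \<open>Noetherian local rings\<close>

locale noeth_local = cring R + noetherian_ring R for R (structure) +
  assumes unique_maximal: "\<exists>!\<mm>. maximalideal \<mm> R"

lemma noetherian_local_ring_iff: "noetherian_local_ring R \<longleftrightarrow> noeth_local R"
  by (auto simp: noetherian_local_ring_def noeth_local_def noeth_local_axioms_def)

abbreviation mpow :: "('a, 'b) ring_scheme \<Rightarrow> nat \<Rightarrow> 'a set" where
  "mpow R s \<equiv> ideal_power R (max_ideal R) s"

lemma ideal_power_0 [simp]: "ideal_power R I 0 = carrier R"
  by (simp add: ideal_power_def nat_pow_def ideals_set_def)

lemma ideal_power_Suc: "ideal_power R I (Suc n) = ideal_power R I n \<cdot>\<^bsub>R\<^esub> I"
  by (simp add: ideal_power_def nat_pow_def ideals_set_def)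

context cring
begin

lemma ideal_power_ideal: "ideal I R \<Longrightarrow> ideal (ideal_power R I n) R"
  by (induction n) (auto simp: ideal_power_Suc oneideal ideal_prod_is_ideal)

lemma ideal_power_mult:
  "a \<in> ideal_power R I n \<Longrightarrow> b \<in> I \<Longrightarrow> a \<otimes> b \<in> ideal_power R I (Suc n)"
  by (simp add: ideal_power_Suc ideal_prod.prod)

lemma ideal_power_decseq: "ideal I R \<Longrightarrow> ideal_power R I (Suc n) \<subseteq> ideal_power R I n"
  unfolding ideal_power_Suc using ideal_prod_inter[OF ideal_power_ideal] by blast

lemma ideal_power_one: "ideal I R \<Longrightarrow> ideal_power R I (Suc 0) = I"
proof
  assume I: "ideal I R"
  show "ideal_power R I (Suc 0) \<subseteq> I"
    using ideal_prod_inter[OF oneideal I] by (simp add: ideal_power_Suc)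
  show "I \<subseteq> ideal_power R I (Suc 0)"
  proof
    fix a assume a: "a \<in> I"
    then have "\<one> \<otimes> a \<in> ideal_power R I (Suc 0)"
      by (intro ideal_power_mult) auto
    then show "a \<in> ideal_power R I (Suc 0)" using a ideal.Icarr[OF I] by simp
  qed
qed

end

context noeth_local
begin

abbreviation "Fr n \<equiv> free_module R n"
abbreviation "Hom c b \<equiv> module_hom R (free_module R c) (free_module R b)"
abbreviation "V (n::nat) s \<equiv> vecs n (ideal_power R (max_ideal R) s)"
abbreviation "Ker c b d \<equiv> a_kernel (free_module R c) (free_module R b) d"

lemmas Fr = free_module_module

sublocale Fr: module R "free_module R n" for n
  by (rule free_module_module)

lemma Fr_minus_self [simp]: "x \<in> vecs n (carrier R) \<Longrightarrow> x \<ominus>\<^bsub>Fr n\<^esub> x = \<zero>\<^bsub>Fr n\<^esub>"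
  unfolding a_minus_def by (rule Fr.M.r_neg) simp

lemma max_ideal_maximal: "maximalideal (max_ideal R) R"
  unfolding max_ideal_def by (rule theI'[OF unique_maximal])

lemma max_ideal_eq: "maximalideal I R \<Longrightarrow> I = max_ideal R"
  using unique_maximal max_ideal_maximal by blast

lemma max_ideal_ideal: "ideal (max_ideal R) R"
  using max_ideal_maximal by (rule maximalideal.axioms)

lemma one_notin_max_ideal: "\<one> \<notin> max_ideal R"
  using max_ideal_maximal max_ideal_ideal ideal.one_imp_carrier maximalideal.I_notcarr by metis

lemma mpow_ideal: "ideal (mpow R s) R"
  by (rule ideal_power_ideal[OF max_ideal_ideal])

lemma mpow_carrier: "a \<in> mpow R s \<Longrightarrow> a \<in> carrier R"
  using mpow_ideal ideal.Icarr by fast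

lemma V_submodule: "submodule (V n s) R (Fr n)"
  by (rule vec_ideal_submodule[OF mpow_ideal])

lemma V_carrier: "x \<in> V n s \<Longrightarrow> x \<in> vecs n (carrier R)"
  by (rule vec_ideal_carrier[OF mpow_ideal])

lemma V_1: "V n (Suc 0) = vecs n (max_ideal R)"
  by (simp add: ideal_power_one max_ideal_ideal)

lemma V_Suc_subset: "x \<in> V n (Suc s) \<Longrightarrow> x \<in> V n s"
  using ideal_power_decseq[OF max_ideal_ideal, of s] by (auto simp: PiE_iff)

lemma V_zero [simp]: "\<zero>\<^bsub>Fr n\<^esub> \<in> V n s"
  by (rule Fr.submodule_zero_mem[OF V_submodule])

text \<open>A chain of ideals in a noetherian ring contains its union, so Zorn's lemma gives a maximal ideal above the
  proper ideal generated by a non-unit.\<close>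

lemma mem_max_ideal_if_not_unit:
  assumes a: "a \<in> carrier R" "a \<notin> Units R"
  shows "a \<in> max_ideal R"
proof -
  define A where "A = {I. ideal I R \<and> a \<in> I \<and> \<one> \<notin> I}"
  have "PIdl a \<in> A"
  proof -
    have "\<one> \<notin> PIdl a"
    proof
      assume "\<one> \<in> PIdl a"
      then have "\<exists>b. \<one> = b \<otimes> a \<and> b \<in> carrier R" unfolding cgenideal_def by (rule CollectD)
      then obtain b where b: "\<one> = b \<otimes> a" "b \<in> carrier R" by (elim exE conjE)
      have b': "\<one> = a \<otimes> b" by (rule trans[OF b(1) m_comm[OF b(2) a(1)]])
      have "a \<in> Units R" unfolding Units_def using a(1) b(2) b(1)[symmetric] b'[symmetric] by (intro CollectI conjI bexI)
      then show False using a(2) by simp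
    qed
    then show ?thesis using a by (simp add: A_def cgenideal_ideal cgenideal_self)
  qed
  moreover have "\<Union>C \<in> A" if "C \<noteq> {}" "subset.chain A C" for C
  proof -
    have "subset.chain {I. ideal I R} C"
      using that(2) by (auto simp: subset.chain_def A_def)
    from ideal_chain_is_trivial[OF that(1) this] that(2) show ?thesis
      by (auto simp: subset.chain_def)
  qed
  ultimately obtain M where M: "M \<in> A" "\<And>K. K \<in> A \<Longrightarrow> M \<subseteq> K \<Longrightarrow> K = M"
    using subset_Zorn_nonempty[of A] by blast
  have "maximalideal M R"
  proof (rule maximalidealI)
    show "ideal M R" using M(1) by (simp add: A_def)
    show "carrier R \<noteq> M" using M(1) by (auto simp: A_def)
    fix J assume J: "ideal J R" "M \<subseteq> J" "J \<subseteq> carrier R"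
    show "J = M \<or> J = carrier R"
    proof (cases "\<one> \<in> J")
      case True then show ?thesis using J(1) ideal.one_imp_carrier by blast
    next
      case False
      then have "J \<in> A" using J M(1) by (auto simp: A_def)
      then show ?thesis using M(2) J(2) by blast
    qed
  qed
  then show ?thesis using M(1) max_ideal_eq by (auto simp: A_def)
qed

section \<open>Finite covers of submodules\<close>

lemma Fr_image_submodule: "f \<in> module_hom R (Fr c) N \<Longrightarrow> module R N \<Longrightarrow> submodule (f ` carrier (Fr c)) R N"
  by (rule module_hom_image_submodule[OF Fr _ _ Fr.carrier_is_submodule])

lemma join_image:
  assumes N: "module R N" and f: "f \<in> module_hom R (Fr p) N" and g: "g \<in> module_hom R (Fr q) N"
    and B: "submodule B R N" and fB: "f ` carrier (Fr p) \<subseteq> B" and gB: "g ` carrier (Fr q) \<subseteq> B"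
    and cover: "\<And>y. y \<in> B \<Longrightarrow> \<exists>x \<in> carrier (Fr q). y \<ominus>\<^bsub>N\<^esub> g x \<in> f ` carrier (Fr p)"
  shows "join N p q f g ` carrier (Fr (p + q)) = B"
proof -
  interpret N: module R N by fact
  show ?thesis
  proof (intro equalityI subsetI)
    fix y assume "y \<in> join N p q f g ` carrier (Fr (p + q))"
    then obtain v where v: "v \<in> vecs (p + q) (carrier R)" and y: "y = f (lo p v) \<oplus>\<^bsub>N\<^esub> g (hi p q v)"
      by (auto simp: join_def)
    have "f (lo p v) \<in> B" "g (hi p q v) \<in> B" using fB gB lo_mem[OF v] hi_mem[OF v] by auto
    then show "y \<in> B" unfolding y by (rule N.submoduleE(5)[OF B])
  next
    fix y assume y: "y \<in> B"
    then obtain x u where x: "x \<in> carrier (Fr q)" and u: "u \<in> carrier (Fr p)" and yx: "y \<ominus>\<^bsub>N\<^esub> g x = f u"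
      using cover by blast
    have cl: "y \<in> carrier N" "g x \<in> carrier N" "f u \<in> carrier N"
      using N.submoduleE(1)[OF B] y module_hom_closed[OF g x] module_hom_closed[OF f u] by auto
    have "y = (y \<ominus>\<^bsub>N\<^esub> g x) \<oplus>\<^bsub>N\<^esub> g x"
      using cl by (simp add: a_minus_def N.M.a_assoc N.M.l_neg)
    then have "y = join N p q f g (app p q u x)"
      using u x yx join_app[of u p "carrier R" x q "carrier R" N f g] by simp
    then show "y \<in> join N p q f g ` carrier (Fr (p + q))"
      using u x by auto
  qed
qed

text \<open>The last clause says that the image of \<open>f\<close> is the submodule generated by \<open>A\<close>.\<close>

lemma hom_with_finite_range_gens:
  assumes N: "module R N" and "finite A" and "A \<subseteq> carrier N"
  shows "\<exists>t f. f \<in> module_hom R (Fr t) N \<and> A \<subseteq> f ` carrier (Fr t) \<and>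
           (\<forall>W. submodule W R N \<longrightarrow> A \<subseteq> W \<longrightarrow> f ` carrier (Fr t) \<subseteq> W)"
  using assms(2,3)
proof (induction A rule: finite_induct)
  case empty
  interpret N: module R N by fact
  show ?case
    by (intro exI[of _ 0] exI[of _ "\<lambda>x. \<zero>\<^bsub>N\<^esub>"])
      (auto simp: module_hom_const_zero[OF N] N.submodule_zero_mem)
next
  case (insert a A)
  interpret N: module R N by fact
  from insert obtain t f where f: "f \<in> module_hom R (Fr t) N" "A \<subseteq> f ` carrier (Fr t)"
    "\<And>W. submodule W R N \<Longrightarrow> A \<subseteq> W \<Longrightarrow> f ` carrier (Fr t) \<subseteq> W" by auto
  have a: "a \<in> carrier N" using insert by auto
  let ?g = "\<lambda>v. v 0 \<odot>\<^bsub>N\<^esub> a"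
  let ?h = "join N t 1 f ?g"
  have g: "?g \<in> module_hom R (Fr 1) N" by (rule hom_single[OF N a])
  have h: "?h \<in> module_hom R (Fr (t + 1)) N" by (rule hom_join[OF N f(1) g])
  have val: "?h (app t 1 u v) = f u \<oplus>\<^bsub>N\<^esub> v 0 \<odot>\<^bsub>N\<^esub> a"
    if "u \<in> vecs t (carrier R)" "v \<in> vecs 1 (carrier R)" for u v
    by (rule join_app[OF that])
  have "x \<in> ?h ` carrier (Fr (t + 1))" if x: "x \<in> insert a A" for x
  proof (cases "x = a")
    case True
    have "?h (app t 1 \<zero>\<^bsub>Fr t\<^esub> (single \<one>)) = \<zero>\<^bsub>N\<^esub> \<oplus>\<^bsub>N\<^esub> \<one> \<odot>\<^bsub>N\<^esub> a"
      using val[of "\<zero>\<^bsub>Fr t\<^esub>" "single \<one>"] module_hom_zero[OF Fr N f(1)] Fr.M.zero_closed[of t] by simp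
    then have "a = ?h (app t 1 \<zero>\<^bsub>Fr t\<^esub> (single \<one>))" using a by simp
    moreover have "app t 1 \<zero>\<^bsub>Fr t\<^esub> (single \<one>) \<in> carrier (Fr (t + 1))"
      using Fr.M.zero_closed[of t] by (simp only: free_module_simps(1)) (rule app_mem, auto)
    ultimately show ?thesis using True by blast
  next
    case False
    then obtain u where u: "u \<in> carrier (Fr t)" "x = f u" using x f(2) by auto
    have "?h (app t 1 u \<zero>\<^bsub>Fr 1\<^esub>) = f u \<oplus>\<^bsub>N\<^esub> \<zero> \<odot>\<^bsub>N\<^esub> a"
      using val[of u "\<zero>\<^bsub>Fr 1\<^esub>"] u Fr.M.zero_closed[of 1] by (simp add: free_module_simps(2))
    then have "x = ?h (app t 1 u \<zero>\<^bsub>Fr 1\<^esub>)" using a u module_hom_closed[OF f(1) u(1)] by simp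
    moreover have "app t 1 u \<zero>\<^bsub>Fr 1\<^esub> \<in> carrier (Fr (t + 1))"
      using u Fr.M.zero_closed[of 1] by (simp only: free_module_simps(1)) (rule app_mem, auto)
    ultimately show ?thesis by blast
  qed
  moreover have "?h ` carrier (Fr (t + 1)) \<subseteq> W" if W: "submodule W R N" "insert a A \<subseteq> W" for W
  proof
    fix y assume "y \<in> ?h ` carrier (Fr (t + 1))"
    then obtain v where v: "v \<in> vecs (t + 1) (carrier R)" and y: "y = ?h v" by auto
    have "f (lo t v) \<in> W" using f(3)[OF W(1)] W(2) lo_mem[OF v] by auto
    moreover have "hi t 1 v 0 \<odot>\<^bsub>N\<^esub> a \<in> W"
      using W N.submoduleE(4)[OF W(1)] hi_mem[OF v] by auto
    ultimately show "y \<in> W" unfolding y join_def by (rule N.submoduleE(5)[OF W(1)])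
  qed
  ultimately show ?case using h by blast
qed

lemma ideal_of_submodule:
  assumes W: "submodule W R (Fr 1)"
  shows "ideal {a \<in> carrier R. single a \<in> W} R"
proof -
  note E = Fr.submoduleE[OF W]
  have smult: "a \<odot>\<^bsub>Fr 1\<^esub> single b = single (a \<otimes> b)" for a b
    by (auto simp: free_module_simps single_def intro!: restrict_ext)
  have add: "single a \<oplus>\<^bsub>Fr 1\<^esub> single b = single (a \<oplus> b)" for a b
    by (auto simp: free_module_simps single_def intro!: restrict_ext)
  have minus: "\<ominus>\<^bsub>Fr 1\<^esub> single b = single (\<ominus> b)" if "b \<in> carrier R" for b
    using that by (subst free_module_uminus) (auto simp: single_def intro!: restrict_ext)
  have zero: "\<zero>\<^bsub>Fr 1\<^esub> = single \<zero>"
    by (auto simp: free_module_simps single_def intro!: restrict_ext)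
  show ?thesis
  proof (rule idealI)
    show "ring R" by (rule ring_axioms)
    show "subgroup {a \<in> carrier R. single a \<in> W} (add_monoid R)"
      using E(3,5) Fr.submodule_zero_mem[OF W] zero
      by (intro add.subgroupI) (auto simp flip: add minus a_inv_def)
    show "x \<otimes> a \<in> {a \<in> carrier R. single a \<in> W}"
      if "a \<in> {a \<in> carrier R. single a \<in> W}" "x \<in> carrier R" for a x
      using that E(4) by (auto simp flip: smult)
    then show "a \<otimes> x \<in> {a \<in> carrier R. single a \<in> W}"
      if "a \<in> {a \<in> carrier R. single a \<in> W}" "x \<in> carrier R" for a x
      using that by (metis (no_types, lifting) m_comm mem_Collect_eq)
  qed
qed

lemma ideal_finite_cover:
  assumes J: "ideal J R"
  obtains t f where "f \<in> Hom t 1" "f ` carrier (Fr t) = vecs 1 J"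
proof -
  obtain A where A: "A \<subseteq> carrier R" "finite A" "J = Idl A" using finetely_gen[OF J] by blast
  have "single ` A \<subseteq> carrier (Fr 1)"
    unfolding free_module_simps(1) image_subset_iff single_mem(1) using A(1) by blast
  from hom_with_finite_range_gens[OF Fr finite_imageI[OF A(2)] this] obtain t f where
    f: "f \<in> Hom t 1" "single ` A \<subseteq> f ` carrier (Fr t)"
      "\<And>W. submodule W R (Fr 1) \<Longrightarrow> single ` A \<subseteq> W \<Longrightarrow> f ` carrier (Fr t) \<subseteq> W" by blast
  have "f ` carrier (Fr t) \<subseteq> vecs 1 J"
  proof (rule f(3)[OF vec_ideal_submodule[OF J]])
    show "single ` A \<subseteq> vecs 1 J" 
      unfolding image_subset_iff single_mem(1) using A(3) genideal_self[OF A(1)] by blast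
  qed
  moreover have "v \<in> f ` carrier (Fr t)" if v: "v \<in> vecs 1 J" for v
  proof -
    let ?I = "{a \<in> carrier R. single a \<in> f ` carrier (Fr t)}"
    have "ideal ?I R" by (rule ideal_of_submodule[OF Fr_image_submodule[OF f(1) Fr]])
    moreover have "A \<subseteq> ?I" using A f(2) by blast
    ultimately have "J \<subseteq> ?I" unfolding A(3) by (rule genideal_minimal)
    moreover have "v 0 \<in> J" using v by auto
    ultimately have "single (v 0) \<in> f ` carrier (Fr t)" by blast
    then show ?thesis using single_eta[OF v] by simp
  qed
  ultimately have "f ` carrier (Fr t) = vecs 1 J"
    by (intro subset_antisym subsetI) (blast, assumption)
  then show thesis by (rule that[OF f(1)])
qed

lemma left_submodule:
  assumes "submodule Z R (Fr (p + q))"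
  shows "submodule {u \<in> carrier (Fr p). app p q u \<zero>\<^bsub>Fr q\<^esub> \<in> Z} R (Fr p)"
  by (rule module_hom_vimage_submodule[OF Fr Fr hom_app_left assms])

lemma hi_zero_imp_app:
  assumes y: "y \<in> carrier (Fr (p + q))" and "hi p q y = \<zero>\<^bsub>Fr q\<^esub>"
  shows "y = app p q (lo p y) \<zero>\<^bsub>Fr q\<^esub>"
  using assms app_lo_hi[of y p q "carrier R"] by simp

lemma left_mem_of_hi_eq:
  assumes Z: "submodule Z R (Fr (p + q))" and y: "y \<in> Z" and z: "z \<in> Z" and eq: "hi p q z = hi p q y"
  obtains u where "u \<in> carrier (Fr p)" "app p q u \<zero>\<^bsub>Fr q\<^esub> \<in> Z"
    "y \<ominus>\<^bsub>Fr (p + q)\<^esub> z = app p q u \<zero>\<^bsub>Fr q\<^esub>" "u = lo p (y \<ominus>\<^bsub>Fr (p + q)\<^esub> z)"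
proof -
  let ?z = "y \<ominus>\<^bsub>Fr (p + q)\<^esub> z"
  have c: "y \<in> carrier (Fr (p + q))" "z \<in> carrier (Fr (p + q))" using y z Fr.submoduleE(1)[OF Z] by blast+
  have zZ: "?z \<in> Z" by (rule Fr.submodule_minus_mem[OF Z y z])
  then have zc: "?z \<in> carrier (Fr (p + q))" using Fr.submoduleE(1)[OF Z] by blast
  have "hi p q ?z = hi p q y \<ominus>\<^bsub>Fr q\<^esub> hi p q z"
    by (rule module_hom_minus[OF Fr Fr hom_hi c])
  also have "\<dots> = \<zero>\<^bsub>Fr q\<^esub>"
    using eq module_hom_closed[OF hom_hi c(1)] by simp
  finally have *: "?z = app p q (lo p ?z) \<zero>\<^bsub>Fr q\<^esub>" by (rule hi_zero_imp_app[OF zc])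
  show thesis
    by (rule that[OF module_hom_closed[OF hom_lo zc] _ * refl]) (use * zZ in simp)
qed

text \<open>The horseshoe construction for the exact sequence given by the projection \<open>hi p q\<close> on \<open>Z\<close>.\<close>

lemma extension_cover:
  assumes Z: "submodule Z R (Fr (p + q))"
    and d: "d \<in> Hom c p" "d ` carrier (Fr c) = {u \<in> carrier (Fr p). app p q u \<zero>\<^bsub>Fr q\<^esub> \<in> Z}"
    and f: "f \<in> Hom t q" "f ` carrier (Fr t) = hi p q ` Z"
  obtains h where "h \<in> Hom t (p + q)" "h ` carrier (Fr t) \<subseteq> Z"
    "\<And>x. x \<in> vecs t (carrier R) \<Longrightarrow> hi p q (h x) = f x"
    "join (Fr (p + q)) c t (\<lambda>u. app p q (d u) \<zero>\<^bsub>Fr q\<^esub>) h ` carrier (Fr (c + t)) = Z"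
proof -
  obtain h where h: "h \<in> Hom t (p + q)" "h ` carrier (Fr t) \<subseteq> Z"
    "\<And>x. x \<in> vecs t (carrier R) \<Longrightarrow> hi p q (h x) = f x"
    using lift_hom[OF Fr Fr f(1) hom_hi Z] f(2) by auto
  have l: "(\<lambda>u. app p q (d u) \<zero>\<^bsub>Fr q\<^esub>) \<in> Hom c (p + q)"
    by (rule module_hom_comp[OF d(1) hom_app_left])
  have "join (Fr (p + q)) c t (\<lambda>u. app p q (d u) \<zero>\<^bsub>Fr q\<^esub>) h ` carrier (Fr (c + t)) = Z"
  proof (rule join_image[OF Fr l h(1) Z _ h(2)])
    show "(\<lambda>u. app p q (d u) \<zero>\<^bsub>Fr q\<^esub>) ` carrier (Fr c) \<subseteq> Z" using d(2) by blast
    fix y assume y: "y \<in> Z"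
    obtain x where x: "x \<in> carrier (Fr t)" "f x = hi p q y" using f(2) y by (metis imageE imageI)
    have hx: "h x \<in> Z" using h(2) x by blast
    have "hi p q (h x) = hi p q y" using h(3)[of x] x by simp
    from left_mem_of_hi_eq[OF Z y hx this] obtain u where "u \<in> carrier (Fr p)" "app p q u \<zero>\<^bsub>Fr q\<^esub> \<in> Z"
      "y \<ominus>\<^bsub>Fr (p + q)\<^esub> h x = app p q u \<zero>\<^bsub>Fr q\<^esub>" by blast
    moreover from this have "u \<in> d ` carrier (Fr c)" unfolding d(2) by blast
    ultimately show "\<exists>x\<in>carrier (Fr t). y \<ominus>\<^bsub>Fr (p + q)\<^esub> h x \<in> (\<lambda>u. app p q (d u) \<zero>\<^bsub>Fr q\<^esub>) ` carrier (Fr c)"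
      using x(1) by (intro bexI[of _ x]) auto
  qed
  with h(3) show thesis by (intro that[OF h(1,2)])
qed

text \<open>The last coordinates of \<open>Z\<close> form an ideal, and the vectors with last coordinate zero form a submodule of a
  free module of smaller rank.\<close>

lemma submodule_finite_cover:
  "submodule Z R (Fr b) \<Longrightarrow> \<exists>c. \<exists>d \<in> Hom c b. d ` carrier (Fr c) = Z"
proof (induction b arbitrary: Z)
  case 0
  have *: "carrier (Fr 0) = {\<zero>\<^bsub>Fr 0\<^esub>}" by (auto simp: free_module_simps)
  have "Z = {\<zero>\<^bsub>Fr 0\<^esub>}"
    using Fr.submoduleE(1)[OF 0] Fr.submodule_zero_mem[OF 0] * by blast
  then show ?case using module_hom_id[of R "Fr 0"] * by (intro exI[of _ 0] bexI) auto
next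
  case (Suc b)
  have Z: "submodule Z R (Fr (b + 1))" using Suc.prems by simp
  obtain c d where d: "d \<in> Hom c b" "d ` carrier (Fr c) = {u \<in> carrier (Fr b). app b 1 u \<zero>\<^bsub>Fr 1\<^esub> \<in> Z}"
    using Suc.IH[OF left_submodule[OF Z]] by blast
  have W: "submodule (hi b 1 ` Z) R (Fr 1)"
    by (rule module_hom_image_submodule[OF Fr Fr hom_hi Z])
  define J where "J = {a \<in> carrier R. single a \<in> hi b 1 ` Z}"
  have J: "ideal J R" unfolding J_def by (rule ideal_of_submodule[OF W])
  obtain t f where f: "f \<in> Hom t 1" "f ` carrier (Fr t) = vecs 1 J"
    by (rule ideal_finite_cover[OF J])
  have fW: "f ` carrier (Fr t) = hi b 1 ` Z"
    unfolding f(2)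
  proof (intro equalityI subsetI)
    fix v :: "nat \<Rightarrow> 'a" assume v: "v \<in> vecs 1 J"
    then have "single (v 0) \<in> hi b 1 ` Z" by (auto simp: J_def)
    then show "v \<in> hi b 1 ` Z" using single_eta[OF v] by simp
  next
    fix v :: "nat \<Rightarrow> 'a" assume v: "v \<in> hi b 1 ` Z"
    then have v1: "v \<in> vecs 1 (carrier R)" using Fr.submoduleE(1)[OF W] by auto
    then have "v 0 \<in> J" using v single_eta[OF v1] by (auto simp: J_def)
    then have "single (v 0) \<in> vecs 1 J" by simp
    then show "v \<in> vecs 1 J" using single_eta[OF v1] by simp
  qed
  obtain h where h: "h \<in> Hom t (b + 1)"
    "join (Fr (b + 1)) c t (\<lambda>u. app b 1 (d u) \<zero>\<^bsub>Fr 1\<^esub>) h ` carrier (Fr (c + t)) = Z"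
    by (rule extension_cover[OF Z d f(1) fW])
  then show ?case
    using hom_join[OF Fr module_hom_comp[OF d(1) hom_app_left] h(1)] by auto
qed

end

section \<open>Linear syzygies\<close>

text \<open>If \<open>d\<close> maps \<open>R\<^sup>c\<close> onto \<open>Z\<close>, then \<open>\<mm>\<^sup>s Z\<close> is the image of \<open>\<mm>\<^sup>s R\<^sup>c\<close>. So this is the condition
  \<open>Z \<inter> \<mm>\<^sup>s\<^sup>+\<^sup>1 R\<^sup>b \<subseteq> \<mm>\<^sup>s Z\<close>, in a form that produces a preimage of order \<open>s\<close>.\<close>

definition linear_cover :: "('a, 'b) ring_scheme \<Rightarrow> nat \<Rightarrow> nat \<Rightarrow> ((nat \<Rightarrow> 'a) \<Rightarrow> (nat \<Rightarrow> 'a)) \<Rightarrow> bool" where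
  "linear_cover R c b d \<longleftrightarrow>
     (\<forall>s. d ` carrier (free_module R c) \<inter> (vecs b (mpow R (Suc s))) \<subseteq> d ` (vecs c (mpow R s)))"

text \<open>The condition on the first \<open>n\<close> syzygy modules of \<open>R\<^sup>b/Z\<close>, the first of which is \<open>Z\<close>. The cover is chosen
  existentially; \<open>linear_syz_SucD\<close> shows that every cover will do.\<close>

primrec linear_syz :: "('a, 'b) ring_scheme \<Rightarrow> nat \<Rightarrow> nat \<Rightarrow> (nat \<Rightarrow> 'a) set \<Rightarrow> bool" where
  "linear_syz R 0 b Z \<longleftrightarrow> True"
| "linear_syz R (Suc n) b Z \<longleftrightarrow>
     (\<exists>c. \<exists>d \<in> module_hom R (free_module R c) (free_module R b).
        d ` carrier (free_module R c) = Z \<and> linear_cover R c b d \<and>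
        linear_syz R n c (a_kernel (free_module R c) (free_module R b) d))"

text \<open>One degree of a homotopy between resolutions with cycles \<open>Z\<close> and \<open>Z'\<close>: the maps \<open>P\<close> and \<open>Q\<close> are components
  of comparison maps, \<open>k\<close> is the part of the homotopy that factors through the differential and therefore
  kills cycles, and \<open>e\<close> is the part with values in cycles. As only one degree is recorded, resolutions can be
  compared by induction on the degree, without complexes.\<close>

definition homotopy_retract ::
  "('a, 'b) ring_scheme \<Rightarrow> nat \<Rightarrow> (nat \<Rightarrow> 'a) set \<Rightarrow> nat \<Rightarrow> (nat \<Rightarrow> 'a) set \<Rightarrow> bool" where
  "homotopy_retract R b Z b' Z' \<longleftrightarrow>
     (\<exists>P \<in> module_hom R (free_module R b) (free_module R b').
      \<exists>Q \<in> module_hom R (free_module R b') (free_module R b).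
      \<exists>k \<in> module_hom R (free_module R b') (free_module R b').
      \<exists>e \<in> module_hom R (free_module R b') (free_module R b').
        P ` Z \<subseteq> Z' \<and> Q ` Z' \<subseteq> Z \<and> (\<forall>x\<in>Z'. k x = \<zero>\<^bsub>free_module R b'\<^esub>) \<and>
        (\<forall>x \<in> carrier (free_module R b'). e x \<in> Z' \<and>
           x = P (Q x) \<oplus>\<^bsub>free_module R b'\<^esub> (k x \<oplus>\<^bsub>free_module R b'\<^esub> e x)))"

context noeth_local
begin

lemma linear_coverD:
  assumes "linear_cover R c b d" "x \<in> carrier (Fr c)" "d x \<in> V b (Suc s)"
  obtains w where "w \<in> V c s" "d w = d x"
proof -
  have "d x \<in> d ` V c s" using assms unfolding linear_cover_def by blast
  then show thesis using that by (metis imageE)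
qed

lemma linear_coverI:
  assumes "\<And>s x. x \<in> carrier (Fr c) \<Longrightarrow> d x \<in> V b (Suc s) \<Longrightarrow> \<exists>w \<in> V c s. d w = d x"
  shows "linear_cover R c b d"
  unfolding linear_cover_def
proof (intro allI subsetI)
  fix s y assume "y \<in> d ` carrier (Fr c) \<inter> V b (Suc s)"
  then obtain x where "x \<in> carrier (Fr c)" "y = d x" "d x \<in> V b (Suc s)" by blast
  with assms[of x s] show "y \<in> d ` V c s" by (metis imageI)
qed

lemma Ker_submodule: "d \<in> Hom c b \<Longrightarrow> submodule (Ker c b d) R (Fr c)"
  by (rule a_kernel_submodule[OF Fr Fr])

lemma hom_vec_ideal:
  assumes J: "ideal J R" and f: "f \<in> Hom c b" and w: "w \<in> vecs c J"
  shows "f w \<in> vecs b J"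
proof (rule hom_mem_subgroup[OF Fr f submodule.axioms(1)[OF vec_ideal_submodule[OF J]] _ _ w])
  show "J \<subseteq> carrier R" using ideal.Icarr[OF J] by blast
  fix a x assume a: "a \<in> J" and x: "x \<in> vecs c (carrier R)"
  have "f x \<in> vecs b (carrier R)" using module_hom_closed[OF f] x by simp
  then show "a \<odot>\<^bsub>Fr b\<^esub> f x \<in> vecs b J"
    using ideal.I_r_closed[OF J a] by (auto simp: free_module_simps PiE_iff)
qed

lemmas hom_V = hom_vec_ideal[OF mpow_ideal]

text \<open>The gain in order that makes minimal covers useful.\<close>

lemma hom_V_Suc:
  assumes f: "f \<in> Hom c b" "f ` carrier (Fr c) \<subseteq> V b (Suc 0)" and w: "w \<in> V c s"
  shows "f w \<in> V b (Suc s)"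
proof (rule hom_mem_subgroup[OF Fr f(1) submodule.axioms(1)[OF V_submodule] _ _ w])
  show "mpow R s \<subseteq> carrier R" using mpow_carrier by blast
  fix a x assume a: "a \<in> mpow R s" and x: "x \<in> vecs c (carrier R)"
  have "f x \<in> vecs b (max_ideal R)" using f(2) x unfolding V_1 free_module_simps(1) by blast
  then show "a \<odot>\<^bsub>Fr b\<^esub> f x \<in> V b (Suc s)"
    using ideal_power_mult[OF a] by (auto simp: free_module_simps PiE_iff)
qed

lemma hom_mem_image_V:
  assumes f: "f \<in> Hom c b" and g: "g \<in> Hom c' b"
    and sub: "f ` carrier (Fr c) \<subseteq> g ` carrier (Fr c')" and w: "w \<in> V c s"
  shows "f w \<in> g ` V c' s"
proof (rule hom_mem_subgroup[OF Fr f _ _ _ w])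
  show "subgroup (g ` V c' s) (add_monoid (Fr b))"
    by (rule submodule.axioms(1)[OF module_hom_image_submodule[OF Fr Fr g V_submodule]])
  show "mpow R s \<subseteq> carrier R" using mpow_carrier by blast
  fix a x assume a: "a \<in> mpow R s" and x: "x \<in> vecs c (carrier R)"
  have "f x \<in> g ` carrier (Fr c')" using sub x by auto
  then obtain y where y: "y \<in> carrier (Fr c')" "f x = g y" by blast
  have "a \<odot>\<^bsub>Fr b\<^esub> f x = g (a \<odot>\<^bsub>Fr c'\<^esub> y)"
    using module_hom_smult[OF g mpow_carrier[OF a] y(1)] y(2) by simp
  moreover have "a \<odot>\<^bsub>Fr c'\<^esub> y \<in> V c' s"
    using a y(1) ideal.I_r_closed[OF mpow_ideal] by (auto simp: free_module_simps PiE_iff)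
  ultimately show "a \<odot>\<^bsub>Fr b\<^esub> f x \<in> g ` V c' s" by simp
qed

lemma lift_along:
  assumes M: "module R M" and f: "f \<in> module_hom R (Fr c) M" and g: "g \<in> module_hom R (Fr b) M"
    and sub: "f ` carrier (Fr c) \<subseteq> g ` carrier (Fr b)"
  obtains h where "h \<in> Hom c b" "\<And>x. x \<in> vecs c (carrier R) \<Longrightarrow> g (h x) = f x"
  by (rule lift_hom[OF M Fr f g Fr.carrier_is_submodule sub]) (rule that)

lemma homotopy_retractI:
  assumes "P \<in> Hom b b'" "Q \<in> Hom b' b" "k \<in> Hom b' b'" "e \<in> Hom b' b'"
    and "P ` Z \<subseteq> Z'" "Q ` Z' \<subseteq> Z" "\<And>x. x \<in> Z' \<Longrightarrow> k x = \<zero>\<^bsub>Fr b'\<^esub>"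
    and "\<And>x. x \<in> carrier (Fr b') \<Longrightarrow> e x \<in> Z'"
    and "\<And>x. x \<in> carrier (Fr b') \<Longrightarrow> x = P (Q x) \<oplus>\<^bsub>Fr b'\<^esub> (k x \<oplus>\<^bsub>Fr b'\<^esub> e x)"
  shows "homotopy_retract R b Z b' Z'"
  unfolding homotopy_retract_def
  by (intro bexI[of _ P] bexI[of _ Q] bexI[of _ k] bexI[of _ e] conjI ballI; rule assms; assumption)

text \<open>A cycle \<open>y\<close> in \<open>Z'\<close> of order \<open>s + 1\<close> goes to \<open>Z \<inter> \<mm>\<^sup>s\<^sup>+\<^sup>1 R\<^sup>b \<subseteq> \<mm>\<^sup>s Z\<close> under \<open>Q\<close> and from there into \<open>\<mm>\<^sup>s Z'\<close>
  under \<open>P\<close>. The difference between \<open>y\<close> and the result is \<open>e y\<close>, which lies in \<open>\<mm>\<^sup>s\<^sup>+\<^sup>1 Z'\<close>, since \<open>e\<close> takes its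
  values in \<open>Z'\<close>.\<close>

lemma retract_linear_cover:
  assumes ret: "homotopy_retract R b Z b' Z'"
    and d: "d \<in> Hom c b" "d ` carrier (Fr c) = Z" "linear_cover R c b d"
    and d': "d' \<in> Hom c' b'" "d' ` carrier (Fr c') = Z'"
  shows "linear_cover R c' b' d'"
proof (rule linear_coverI)
  obtain P Q k e where P: "P \<in> Hom b b'" "P ` Z \<subseteq> Z'" and Q: "Q \<in> Hom b' b" "Q ` Z' \<subseteq> Z"
    and k: "k \<in> Hom b' b'" "\<And>x. x \<in> Z' \<Longrightarrow> k x = \<zero>\<^bsub>Fr b'\<^esub>"
    and e: "e \<in> Hom b' b'" "\<And>x. x \<in> carrier (Fr b') \<Longrightarrow> e x \<in> Z'"
    and eq: "\<And>x. x \<in> carrier (Fr b') \<Longrightarrow> x = P (Q x) \<oplus>\<^bsub>Fr b'\<^esub> (k x \<oplus>\<^bsub>Fr b'\<^esub> e x)"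
    using ret unfolding homotopy_retract_def by blast
  fix s x assume x: "x \<in> carrier (Fr c')" and dx: "d' x \<in> V b' (Suc s)"
  let ?y = "d' x"
  have yZ: "?y \<in> Z'" using d'(2) x by blast
  have yc: "?y \<in> carrier (Fr b')" by (rule module_hom_closed[OF d'(1) x])
  have "Q ?y \<in> Z" using Q(2) yZ by blast
  then obtain x1 where x1: "x1 \<in> carrier (Fr c)" "d x1 = Q ?y" unfolding d(2)[symmetric] by (elim imageE) simp
  have "Q ?y \<in> V b (Suc s)" by (rule hom_V[OF Q(1) dx])
  with x1 obtain w where w: "w \<in> V c s" "d w = Q ?y"
    using linear_coverD[OF d(3) x1(1)] by metis
  let ?W = "d' ` V c' s"
  have W: "submodule ?W R (Fr b')" by (rule module_hom_image_submodule[OF Fr Fr d'(1) V_submodule])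
  have "P (d w) \<in> ?W"
  proof (rule hom_mem_image_V[OF module_hom_comp[OF d(1) P(1)] d'(1) _ w(1)])
    show "(\<lambda>x. P (d x)) ` carrier (Fr c) \<subseteq> d' ` carrier (Fr c')" using P(2) d(2) d'(2) by blast
  qed
  moreover have "e ?y \<in> ?W"
  proof (rule hom_mem_image_V[OF e(1) d'(1) _ V_Suc_subset[OF dx]])
    show "e ` carrier (Fr b') \<subseteq> d' ` carrier (Fr c')" using e(2) d'(2) by blast
  qed
  ultimately have "P (d w) \<oplus>\<^bsub>Fr b'\<^esub> (\<zero>\<^bsub>Fr b'\<^esub> \<oplus>\<^bsub>Fr b'\<^esub> e ?y) \<in> ?W"
    by (intro Fr.submoduleE(5)[OF W] Fr.submodule_zero_mem[OF W])
  also have "P (d w) \<oplus>\<^bsub>Fr b'\<^esub> (\<zero>\<^bsub>Fr b'\<^esub> \<oplus>\<^bsub>Fr b'\<^esub> e ?y) = ?y"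
    using eq[OF yc, symmetric] unfolding w(2) k(2)[OF yZ] .
  finally have "?y \<in> ?W" .
  then show "\<exists>w \<in> V c' s. d' w = d' x" by (metis imageE)
qed

text \<open>The inductive step of the comparison theorem. The lift \<open>h\<close> of \<open>e\<close> along \<open>d'\<close> is the next component of the
  homotopy, and \<open>h d'\<close> is the new \<open>k\<close>.\<close>

lemma retract_kernel:
  assumes ret: "homotopy_retract R b Z b' Z'"
    and d: "d \<in> Hom c b" "d ` carrier (Fr c) = Z"
    and d': "d' \<in> Hom c' b'" "d' ` carrier (Fr c') = Z'"
  shows "homotopy_retract R c (Ker c b d) c' (Ker c' b' d')"
proof -
  obtain P Q k e where P: "P \<in> Hom b b'" "P ` Z \<subseteq> Z'" and Q: "Q \<in> Hom b' b" "Q ` Z' \<subseteq> Z"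
    and k: "k \<in> Hom b' b'" "\<And>x. x \<in> Z' \<Longrightarrow> k x = \<zero>\<^bsub>Fr b'\<^esub>"
    and e: "e \<in> Hom b' b'" "\<And>x. x \<in> carrier (Fr b') \<Longrightarrow> e x \<in> Z'"
    and eq: "\<And>x. x \<in> carrier (Fr b') \<Longrightarrow> x = P (Q x) \<oplus>\<^bsub>Fr b'\<^esub> (k x \<oplus>\<^bsub>Fr b'\<^esub> e x)"
    using ret unfolding homotopy_retract_def by blast
  have "(\<lambda>x. P (d x)) ` carrier (Fr c) \<subseteq> d' ` carrier (Fr c')" using P(2) d(2) d'(2) by blast
  then obtain P1 where P1: "P1 \<in> Hom c c'" "\<And>x. x \<in> vecs c (carrier R) \<Longrightarrow> d' (P1 x) = P (d x)"
    by (rule lift_along[OF Fr module_hom_comp[OF d(1) P(1)] d'(1)]) (rule that)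
  have "(\<lambda>x. Q (d' x)) ` carrier (Fr c') \<subseteq> d ` carrier (Fr c)" using Q(2) d(2) d'(2) by blast
  then obtain Q1 where Q1: "Q1 \<in> Hom c' c" "\<And>x. x \<in> vecs c' (carrier R) \<Longrightarrow> d (Q1 x) = Q (d' x)"
    by (rule lift_along[OF Fr module_hom_comp[OF d'(1) Q(1)] d(1)]) (rule that)
  have "e ` carrier (Fr b') \<subseteq> d' ` carrier (Fr c')" using e(2) d'(2) by blast
  then obtain h where h: "h \<in> Hom b' c'" "\<And>x. x \<in> vecs b' (carrier R) \<Longrightarrow> d' (h x) = e x"
    by (rule lift_along[OF Fr e(1) d'(1)]) (rule that)
  define k1 where "k1 x = h (d' x)" for x
  define e1 where "e1 x = x \<ominus>\<^bsub>Fr c'\<^esub> (P1 (Q1 x) \<oplus>\<^bsub>Fr c'\<^esub> k1 x)" for x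
  have k1: "k1 \<in> Hom c' c'" unfolding k1_def by (rule module_hom_comp[OF d'(1) h(1)])
  have PQ: "(\<lambda>x. P1 (Q1 x)) \<in> Hom c' c'" by (rule module_hom_comp[OF Q1(1) P1(1)])
  have e1: "e1 \<in> Hom c' c'" unfolding e1_def
    by (rule module_hom_diff[OF Fr module_hom_id module_hom_plus[OF Fr PQ k1]])
  have sum: "x = P1 (Q1 x) \<oplus>\<^bsub>Fr c'\<^esub> (k1 x \<oplus>\<^bsub>Fr c'\<^esub> e1 x)" if x: "x \<in> carrier (Fr c')" for x
    unfolding e1_def
    by (rule Fr.M.add_diff_cancel3[OF x module_hom_closed[OF PQ x] module_hom_closed[OF k1 x], symmetric])
  have "d' (e1 x) = \<zero>\<^bsub>Fr b'\<^esub>" if x: "x \<in> carrier (Fr c')" for x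
  proof -
    have dx: "d' x \<in> carrier (Fr b')" by (rule module_hom_closed[OF d'(1) x])
    have dxZ: "d' x \<in> Z'" using d'(2) x by blast
    have xc: "x \<in> vecs c' (carrier R)" and dxc: "d' x \<in> vecs b' (carrier R)" using x dx by simp_all
    have Q1x: "Q1 x \<in> vecs c (carrier R)" using module_hom_closed[OF Q1(1) x] by simp
    have "d' (e1 x) = d' x \<ominus>\<^bsub>Fr b'\<^esub> (d' (P1 (Q1 x)) \<oplus>\<^bsub>Fr b'\<^esub> d' (k1 x))"
      unfolding e1_def
      using module_hom_minus[OF Fr Fr d'(1) x, of "P1 (Q1 x) \<oplus>\<^bsub>Fr c'\<^esub> k1 x"]
        module_hom_add[OF d'(1) module_hom_closed[OF PQ x] module_hom_closed[OF k1 x]]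
        Fr.M.a_closed[OF module_hom_closed[OF PQ x] module_hom_closed[OF k1 x]] by simp
    also have "d' (P1 (Q1 x)) = P (Q (d' x))" using P1(2)[OF Q1x] Q1(2)[OF xc] by simp
    also have "d' (k1 x) = k (d' x) \<oplus>\<^bsub>Fr b'\<^esub> e (d' x)"
      unfolding k1_def k(2)[OF dxZ] using h(2)[OF dxc] Fr.M.l_zero[OF module_hom_closed[OF e(1) dx]] by simp
    also have "P (Q (d' x)) \<oplus>\<^bsub>Fr b'\<^esub> (k (d' x) \<oplus>\<^bsub>Fr b'\<^esub> e (d' x)) = d' x"
      by (rule eq[OF dx, symmetric])
    also have "d' x \<ominus>\<^bsub>Fr b'\<^esub> d' x = \<zero>\<^bsub>Fr b'\<^esub>" by (rule Fr_minus_self[OF dxc])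
    finally show ?thesis .
  qed
  then have e1K: "e1 x \<in> Ker c' b' d'" if "x \<in> carrier (Fr c')" for x
    using that module_hom_closed[OF e1 that] by (simp add: mem_a_kernel)
  have P1K: "P1 ` Ker c b d \<subseteq> Ker c' b' d'"
  proof
    fix y assume "y \<in> P1 ` Ker c b d"
    then obtain x where x: "x \<in> carrier (Fr c)" "d x = \<zero>\<^bsub>Fr b\<^esub>" "y = P1 x" by (auto simp: mem_a_kernel)
    then have "d' y = \<zero>\<^bsub>Fr b'\<^esub>" using P1(2)[of x] module_hom_zero[OF Fr Fr P(1)] by simp
    then show "y \<in> Ker c' b' d'" using x module_hom_closed[OF P1(1) x(1)] by (simp add: mem_a_kernel)
  qed
  have Q1K: "Q1 ` Ker c' b' d' \<subseteq> Ker c b d"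
  proof
    fix y assume "y \<in> Q1 ` Ker c' b' d'"
    then obtain x where x: "x \<in> carrier (Fr c')" "d' x = \<zero>\<^bsub>Fr b'\<^esub>" "y = Q1 x" by (auto simp: mem_a_kernel)
    then have "d y = \<zero>\<^bsub>Fr b\<^esub>" using Q1(2)[of x] module_hom_zero[OF Fr Fr Q(1)] by simp
    then show "y \<in> Ker c b d" using x module_hom_closed[OF Q1(1) x(1)] by (simp add: mem_a_kernel)
  qed
  have k1K: "k1 x = \<zero>\<^bsub>Fr c'\<^esub>" if "x \<in> Ker c' b' d'" for x
    using that module_hom_zero[OF Fr Fr h(1)] by (simp add: mem_a_kernel k1_def)
  show ?thesis
    by (rule homotopy_retractI[OF P1(1) Q1(1) k1 e1 P1K Q1K k1K e1K sum])
qed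

lemma retract_refl:
  assumes Z: "submodule Z R (Fr b)"
  shows "homotopy_retract R b Z b Z"
proof -
  have "x = x \<oplus>\<^bsub>Fr b\<^esub> (\<zero>\<^bsub>Fr b\<^esub> \<oplus>\<^bsub>Fr b\<^esub> \<zero>\<^bsub>Fr b\<^esub>)" if "x \<in> carrier (Fr b)" for x
    using Fr.M.r_zero[OF that] Fr.M.r_zero[OF Fr.M.zero_closed[of b]] by simp
  then show ?thesis
    using Fr.submodule_zero_mem[OF Z]
    by (intro homotopy_retractI[OF module_hom_id module_hom_id module_hom_const_zero[OF Fr] module_hom_const_zero[OF Fr]])
      auto
qed

text \<open>The comparison starts with lifts of the identity of \<open>M\<close> and no homotopy.\<close>

lemma retract_of_covers:
  assumes M: "module R M" and \<epsilon>: "\<epsilon> \<in> module_hom R (Fr b) M" "\<epsilon> ` carrier (Fr b) = carrier M"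
    and \<epsilon>': "\<epsilon>' \<in> module_hom R (Fr b') M" "\<epsilon>' ` carrier (Fr b') = carrier M"
  shows "homotopy_retract R b (a_kernel (Fr b) M \<epsilon>) b' (a_kernel (Fr b') M \<epsilon>')"
proof -
  interpret M: module R M by fact
  obtain P where P: "P \<in> Hom b b'" "\<And>x. x \<in> vecs b (carrier R) \<Longrightarrow> \<epsilon>' (P x) = \<epsilon> x"
    by (rule lift_along[OF M \<epsilon>(1) \<epsilon>'(1)]) (simp only: \<epsilon>(2) \<epsilon>'(2), rule that)
  obtain Q where Q: "Q \<in> Hom b' b" "\<And>x. x \<in> vecs b' (carrier R) \<Longrightarrow> \<epsilon> (Q x) = \<epsilon>' x"
    by (rule lift_along[OF M \<epsilon>'(1) \<epsilon>(1)]) (simp only: \<epsilon>(2) \<epsilon>'(2), rule that)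
  define k :: "(nat \<Rightarrow> 'a) \<Rightarrow> (nat \<Rightarrow> 'a)" where "k x = \<zero>\<^bsub>Fr b'\<^esub>" for x
  define e where "e x = x \<ominus>\<^bsub>Fr b'\<^esub> (P (Q x) \<oplus>\<^bsub>Fr b'\<^esub> k x)" for x
  have k: "k \<in> Hom b' b'" unfolding k_def by (rule module_hom_const_zero[OF Fr])
  have PQ: "(\<lambda>x. P (Q x)) \<in> Hom b' b'" by (rule module_hom_comp[OF Q(1) P(1)])
  have e: "e \<in> Hom b' b'" unfolding e_def
    by (rule module_hom_diff[OF Fr module_hom_id module_hom_plus[OF Fr PQ k]])
  have sum: "x = P (Q x) \<oplus>\<^bsub>Fr b'\<^esub> (k x \<oplus>\<^bsub>Fr b'\<^esub> e x)" if x: "x \<in> carrier (Fr b')" for x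
    unfolding e_def
    by (rule Fr.M.add_diff_cancel3[OF x module_hom_closed[OF PQ x] module_hom_closed[OF k x], symmetric])
  have "\<epsilon>' (e x) = \<zero>\<^bsub>M\<^esub>" if x: "x \<in> carrier (Fr b')" for x
  proof -
    have xc: "x \<in> vecs b' (carrier R)" using x by simp
    have Qx: "Q x \<in> vecs b (carrier R)" using module_hom_closed[OF Q(1) x] by simp
    have "e x = x \<ominus>\<^bsub>Fr b'\<^esub> P (Q x)"
      unfolding e_def k_def using Fr.M.r_zero[OF module_hom_closed[OF PQ x]] by simp
    then have "\<epsilon>' (e x) = \<epsilon>' x \<ominus>\<^bsub>M\<^esub> \<epsilon>' (P (Q x))"
      using module_hom_minus[OF Fr M \<epsilon>'(1) x module_hom_closed[OF PQ x]] by simp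
    also have "\<dots> = \<zero>\<^bsub>M\<^esub>"
      using P(2)[OF Qx] Q(2)[OF xc] module_hom_closed[OF \<epsilon>'(1) x] by (simp add: a_minus_def M.M.r_neg)
    finally show ?thesis .
  qed
  then have eK: "e x \<in> a_kernel (Fr b') M \<epsilon>'" if "x \<in> carrier (Fr b')" for x
    using that module_hom_closed[OF e that] by (simp add: mem_a_kernel)
  have "P ` a_kernel (Fr b) M \<epsilon> \<subseteq> a_kernel (Fr b') M \<epsilon>'"
    using P(2) module_hom_closed[OF P(1)] by (auto simp: mem_a_kernel)
  moreover have "Q ` a_kernel (Fr b') M \<epsilon>' \<subseteq> a_kernel (Fr b) M \<epsilon>"
    using Q(2) module_hom_closed[OF Q(1)] by (auto simp: mem_a_kernel)
  ultimately show ?thesis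
    by (rule homotopy_retractI[OF P(1) Q(1) k e _ _ k_def eK sum])
qed

lemma linear_syz_retract:
  "linear_syz R n b Z \<Longrightarrow> homotopy_retract R b Z b' Z' \<Longrightarrow> submodule Z' R (Fr b') \<Longrightarrow> linear_syz R n b' Z'"
proof (induction n arbitrary: b Z b' Z')
  case (Suc n)
  then obtain c d where d: "d \<in> Hom c b" "d ` carrier (Fr c) = Z" "linear_cover R c b d"
    "linear_syz R n c (Ker c b d)" by auto
  obtain c' d' where d': "d' \<in> Hom c' b'" "d' ` carrier (Fr c') = Z'"
    using submodule_finite_cover[OF Suc.prems(3)] by blast
  have "linear_syz R n c' (Ker c' b' d')"
    by (rule Suc.IH[OF d(4) retract_kernel[OF Suc.prems(2) d(1,2) d'] Ker_submodule[OF d'(1)]])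
  moreover have "linear_cover R c' b' d'"
    by (rule retract_linear_cover[OF Suc.prems(2) d(1-3) d'])
  ultimately show ?case using d' by auto
qed simp

text \<open>Independence of the choice of a cover: compare \<open>Z\<close> with itself.\<close>

lemma linear_syz_SucD:
  assumes "linear_syz R (Suc n) b Z" and d: "d \<in> Hom c b" "d ` carrier (Fr c) = Z"
  shows "linear_cover R c b d" "linear_syz R n c (Ker c b d)"
proof -
  obtain c' d' where d': "d' \<in> Hom c' b" "d' ` carrier (Fr c') = Z" "linear_cover R c' b d'"
    "linear_syz R n c' (Ker c' b d')" using assms(1) by auto
  have "submodule Z R (Fr b)" using Fr_image_submodule[OF d(1) Fr] d(2) by simp
  note r = retract_refl[OF this]
  show "linear_cover R c b d" by (rule retract_linear_cover[OF r d'(1-3) d])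
  show "linear_syz R n c (Ker c b d)"
    by (rule linear_syz_retract[OF d'(4) retract_kernel[OF r d'(1,2) d] Ker_submodule[OF d(1)]])
qed

lemma linear_syz_SucI:
  "d \<in> Hom c b \<Longrightarrow> d ` carrier (Fr c) = Z \<Longrightarrow> linear_cover R c b d \<Longrightarrow> linear_syz R n c (Ker c b d) \<Longrightarrow>
   linear_syz R (Suc n) b Z"
  by auto

end

section \<open>Minimal covers\<close>

text \<open>The embedding of a free module as the coordinate hyperplane \<open>x\<^sub>j = 0\<close>.\<close>

definition skip :: "('a, 'b) ring_scheme \<Rightarrow> nat \<Rightarrow> nat \<Rightarrow> (nat \<Rightarrow> 'a) \<Rightarrow> (nat \<Rightarrow> 'a)" where
  "skip R c j v = (\<lambda>i\<in>{..<Suc c}. if i < j then v i else if i = j then \<zero>\<^bsub>R\<^esub> else v (i - 1))"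

context noeth_local
begin

lemma hom_skip: "j < Suc c \<Longrightarrow> skip R c j \<in> Hom c (Suc c)"
  by (rule module_homI) (auto simp: skip_def PiE_iff free_module_simps intro!: restrict_ext)

lemma skip_surj:
  assumes x: "x \<in> vecs (Suc c) (carrier R)" and j: "j < Suc c" "x j = \<zero>"
  obtains v where "v \<in> carrier (Fr c)" "skip R c j v = x"
proof (rule that)
  let ?v = "\<lambda>i\<in>{..<c}. if i < j then x i else x (Suc i)"
  show "?v \<in> carrier (Fr c)" using x by (auto simp: PiE_iff)
  show "skip R c j ?v = x"
    using x j by (intro vec_eqI[of _ "Suc c" "carrier R" _ "carrier R"]) (auto simp: skip_def PiE_iff)
qed

lemma hom_join_Fr: "f \<in> Hom p b \<Longrightarrow> g \<in> Hom q b \<Longrightarrow> join (Fr b) p q f g \<in> Hom (p + q) b"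
  by (rule hom_join[OF Fr])

lemma lo_V: "v \<in> V (p + q) s \<Longrightarrow> lo p v \<in> V p s" by (rule lo_mem)
lemma hi_V: "v \<in> V (p + q) s \<Longrightarrow> hi p q v \<in> V q s" by (rule hi_mem)
lemma app_V: "u \<in> V p s \<Longrightarrow> v \<in> V q s \<Longrightarrow> app p q u v \<in> V (p + q) s" by (rule app_mem)

lemma lo_Fr: "v \<in> carrier (Fr (p + q)) \<Longrightarrow> lo p v \<in> carrier (Fr p)" by simp
lemma hi_Fr: "v \<in> carrier (Fr (p + q)) \<Longrightarrow> hi p q v \<in> carrier (Fr q)" by simp
lemma app_Fr: "u \<in> carrier (Fr p) \<Longrightarrow> v \<in> carrier (Fr q) \<Longrightarrow> app p q u v \<in> carrier (Fr (p + q))"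
  by (simp only: free_module_simps(1) app_mem)
lemma app_lo_hi_Fr: "v \<in> carrier (Fr (p + q)) \<Longrightarrow> app p q (lo p v) (hi p q v) = v" by simp
lemma lo_app_Fr: "u \<in> carrier (Fr p) \<Longrightarrow> lo p (app p q u v) = u" by simp
lemma hi_app_Fr: "v \<in> carrier (Fr q) \<Longrightarrow> hi p q (app p q u v) = v" by simp
lemma join_app_Fr: "u \<in> carrier (Fr p) \<Longrightarrow> v \<in> carrier (Fr q) \<Longrightarrow> join N p q f g (app p q u v) = f u \<oplus>\<^bsub>N\<^esub> g v"
  by (simp add: join_app)

lemma Fr_carrier_V: "x \<in> V n s \<Longrightarrow> x \<in> carrier (Fr n)"
  using V_carrier by simp

lemma sum_zero_imp_uminus:
  assumes "x \<in> carrier (Fr n)" "y \<in> carrier (Fr n)" "x \<oplus>\<^bsub>Fr n\<^esub> y = \<zero>\<^bsub>Fr n\<^esub>"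
  shows "x = \<ominus>\<^bsub>Fr n\<^esub> y"
  using Fr.M.minus_equality[OF assms(3) assms(2,1)] by simp

text \<open>In a relation \<open>z a + w x = 0\<close> with \<open>x\<close> of order one, \<open>z a = - w x\<close> has order two. By assumption it is then
  also \<open>z y\<close> with \<open>y\<close> of order one, and \<open>a - y\<close> is in the kernel of \<open>z\<close>.\<close>

lemma minimal_kernel:
  assumes z: "z \<in> Hom c b" "Ker c b z \<subseteq> V c (Suc 0)"
    and lin: "\<And>x. x \<in> carrier (Fr c) \<Longrightarrow> z x \<in> V b (Suc (Suc 0)) \<Longrightarrow> \<exists>y \<in> V c (Suc 0). z y = z x"
    and w: "w \<in> Hom c' b" "w ` carrier (Fr c') \<subseteq> V b (Suc 0)"
    and hi: "\<And>v. v \<in> Ker (c + c') b (join (Fr b) c c' z w) \<Longrightarrow> hi c c' v \<in> V c' (Suc 0)"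
  shows "Ker (c + c') b (join (Fr b) c c' z w) \<subseteq> V (c + c') (Suc 0)"
proof
  fix v assume v: "v \<in> Ker (c + c') b (join (Fr b) c c' z w)"
  then have vc: "v \<in> carrier (Fr (c + c'))" and v0: "join (Fr b) c c' z w v = \<zero>\<^bsub>Fr b\<^esub>"
    unfolding mem_a_kernel by blast+
  define a x where "a = lo c v" and "x = hi c c' v"
  have ac: "a \<in> carrier (Fr c)" and xc: "x \<in> carrier (Fr c')"
    unfolding a_def x_def by (rule lo_Fr[OF vc], rule hi_Fr[OF vc])
  have xV: "x \<in> V c' (Suc 0)" unfolding x_def by (rule hi[OF v])
  have "z a \<oplus>\<^bsub>Fr b\<^esub> w x = \<zero>\<^bsub>Fr b\<^esub>" using v0 unfolding join_def a_def x_def .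
  then have "z a = \<ominus>\<^bsub>Fr b\<^esub> w x"
    by (rule sum_zero_imp_uminus[OF module_hom_closed[OF z(1) ac] module_hom_closed[OF w(1) xc]])
  then have "z a \<in> V b (Suc (Suc 0))"
    using Fr.submoduleE(3)[OF V_submodule hom_V_Suc[OF w xV]] by metis
  then obtain y where y: "y \<in> V c (Suc 0)" "z y = z a" using lin[OF ac] by blast
  have yc: "y \<in> carrier (Fr c)" by (rule Fr_carrier_V[OF y(1)])
  have "z (a \<ominus>\<^bsub>Fr c\<^esub> y) = \<zero>\<^bsub>Fr b\<^esub>"
    using module_hom_minus[OF Fr Fr z(1) ac yc] y(2) module_hom_closed[OF z(1) ac] by simp
  then have "a \<ominus>\<^bsub>Fr c\<^esub> y \<in> V c (Suc 0)"
    using a_kernelI[OF Fr.M.minus_closed[OF ac yc]] z(2) by blast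
  then have "(a \<ominus>\<^bsub>Fr c\<^esub> y) \<oplus>\<^bsub>Fr c\<^esub> y \<in> V c (Suc 0)" by (rule Fr.submoduleE(5)[OF V_submodule _ y(1)])
  then have "a \<in> V c (Suc 0)" unfolding Fr.M.diff_add_cancel[OF ac yc] .
  then have "app c c' a x \<in> V (c + c') (Suc 0)" using xV by (rule app_V)
  then show "v \<in> V (c + c') (Suc 0)" unfolding a_def x_def app_lo_hi_Fr[OF vc] .
qed

text \<open>A minimal cover of a submodule extends to one of \<open>B\<close>. The number \<open>c'\<close> of additional generators is chosen
  least: a relation with a unit as coefficient at an additional generator would make that generator superfluous.\<close>

lemma minimal_extension:
  assumes z: "z \<in> Hom c b" "z ` carrier (Fr c) \<subseteq> B" "Ker c b z \<subseteq> V c (Suc 0)"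
    and lin: "\<And>x. x \<in> carrier (Fr c) \<Longrightarrow> z x \<in> V b (Suc (Suc 0)) \<Longrightarrow> \<exists>y \<in> V c (Suc 0). z y = z x"
    and B: "submodule B R (Fr b)" "B \<subseteq> V b (Suc 0)"
  obtains c' w where "w \<in> Hom c' b" "w ` carrier (Fr c') \<subseteq> B"
    "join (Fr b) c c' z w ` carrier (Fr (c + c')) = B"
    "Ker (c + c') b (join (Fr b) c c' z w) \<subseteq> V (c + c') (Suc 0)"
proof -
  define P where "P n \<longleftrightarrow> (\<exists>w \<in> Hom n b. w ` carrier (Fr n) \<subseteq> B \<and> join (Fr b) c n z w ` carrier (Fr (c + n)) = B)" for n
  obtain n d where d: "d \<in> Hom n b" "d ` carrier (Fr n) = B" using submodule_finite_cover[OF B(1)] by blast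
  have "join (Fr b) c n z d ` carrier (Fr (c + n)) = B"
  proof (rule join_image[OF Fr z(1) d(1) B(1) z(2)])
    show "d ` carrier (Fr n) \<subseteq> B" unfolding d(2) by (rule subset_refl)
    fix y assume y: "y \<in> B"
    then have yc: "y \<in> carrier (Fr b)" using Fr.submoduleE(1)[OF B(1)] by blast
    from y obtain x where x: "x \<in> carrier (Fr n)" "y = d x" unfolding d(2)[symmetric] by (elim imageE)
    have "y \<ominus>\<^bsub>Fr b\<^esub> d x = z \<zero>\<^bsub>Fr c\<^esub>"
      using yc unfolding x(2)[symmetric] module_hom_zero[OF Fr Fr z(1)] by simp
    then have "y \<ominus>\<^bsub>Fr b\<^esub> d x \<in> z ` carrier (Fr c)" using Fr.M.zero_closed by (rule image_eqI)
    then show "\<exists>x\<in>carrier (Fr n). y \<ominus>\<^bsub>Fr b\<^esub> d x \<in> z ` carrier (Fr c)" by (rule bexI[OF _ x(1)])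
  qed
  then have "P n" unfolding P_def using d by (metis subset_refl)
  define c' where "c' = (LEAST n. P n)"
  have "P c'" unfolding c'_def using \<open>P n\<close> by (rule LeastI)
  then obtain w where w: "w \<in> Hom c' b" "w ` carrier (Fr c') \<subseteq> B"
    "join (Fr b) c c' z w ` carrier (Fr (c + c')) = B" unfolding P_def by blast
  have "hi c c' v \<in> V c' (Suc 0)" if v: "v \<in> Ker (c + c') b (join (Fr b) c c' z w)" for v
  proof (rule ccontr)
    assume not: "hi c c' v \<notin> V c' (Suc 0)"
    define a x where "a = lo c v" and "x = hi c c' v"
    have vc: "v \<in> carrier (Fr (c + c'))" and v0: "join (Fr b) c c' z w v = \<zero>\<^bsub>Fr b\<^esub>"
      using v unfolding mem_a_kernel by blast+
    have ac: "a \<in> carrier (Fr c)" and xc: "x \<in> carrier (Fr c')"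
      unfolding a_def x_def by (rule lo_Fr[OF vc], rule hi_Fr[OF vc])
    have xP: "x \<in> vecs c' (carrier R)" using xc by simp
    obtain j where j: "j < c'" "x j \<notin> max_ideal R"
      using not xP unfolding x_def V_1 by (auto simp: PiE_iff)
    have xj: "x j \<in> Units R" using j xP mem_max_ideal_if_not_unit[of "x j"] by auto
    obtain n where n: "c' = Suc n" using j(1) by (cases c') auto
    have jn: "j < Suc n" using j n by simp
    let ?w = "\<lambda>y. w (skip R n j y)"
    have w': "?w \<in> Hom n b" by (rule module_hom_comp[OF hom_skip[OF jn]]) (use w(1) n in simp)
    have sk: "skip R n j y \<in> carrier (Fr c')" if "y \<in> carrier (Fr n)" for y
      using module_hom_closed[OF hom_skip[OF jn] that] n by simp
    have w'B: "?w ` carrier (Fr n) \<subseteq> B" using w(2) sk by blast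
    have "z a \<oplus>\<^bsub>Fr b\<^esub> w x = \<zero>\<^bsub>Fr b\<^esub>" using v0 unfolding join_def a_def x_def .
    moreover have za: "z a \<in> carrier (Fr b)" and wx: "w x \<in> carrier (Fr b)"
      using module_hom_closed[OF z(1) ac] module_hom_closed[OF w(1) xc] by auto
    ultimately have "w x = \<ominus>\<^bsub>Fr b\<^esub> z a"
      using sum_zero_imp_uminus[OF wx za] Fr.M.a_comm[OF wx za] by simp
    then have wxA: "w x = z (\<ominus>\<^bsub>Fr c\<^esub> a)" using module_hom_uminus[OF Fr Fr z(1) ac] by simp
    have "join (Fr b) c n z ?w ` carrier (Fr (c + n)) = B"
    proof (rule join_image[OF Fr z(1) w' B(1) z(2) w'B])
      fix y assume "y \<in> B"
      then obtain u where u: "u \<in> carrier (Fr (c + c'))" "y = join (Fr b) c c' z w u"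
        unfolding w(3)[symmetric] by (elim imageE)
      define a0 x0 where "a0 = lo c u" and "x0 = hi c c' u"
      have a0: "a0 \<in> carrier (Fr c)" and x0: "x0 \<in> carrier (Fr c')"
        unfolding a0_def x0_def by (rule lo_Fr[OF u(1)], rule hi_Fr[OF u(1)])
      have y: "y = z a0 \<oplus>\<^bsub>Fr b\<^esub> w x0" unfolding u(2) join_def a0_def x0_def ..
      \<comment> \<open>subtracting this multiple of the relation clears the coordinate \<open>j\<close>\<close>
      define t where "t = x0 j \<otimes> inv (x j)"
      have x0j: "x0 j \<in> carrier R" using x0 j(1) by auto
      have xjc: "x j \<in> carrier R" using xj by (rule Units_closed)
      have t: "t \<in> carrier R" unfolding t_def using x0j Units_inv_closed[OF xj] by simp
      have tx: "t \<odot>\<^bsub>Fr c'\<^esub> x \<in> carrier (Fr c')" by (rule Fr.smult_closed[OF t xc])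
      define x1 where "x1 = x0 \<ominus>\<^bsub>Fr c'\<^esub> t \<odot>\<^bsub>Fr c'\<^esub> x"
      have x1: "x1 \<in> carrier (Fr c')" unfolding x1_def by (rule Fr.M.minus_closed[OF x0 tx])
      have "x1 j = x0 j \<ominus> t \<otimes> x j"
        unfolding x1_def using free_module_minus[of x0 c' "t \<odot>\<^bsub>Fr c'\<^esub> x"] x0 tx j(1)
        by (simp add: free_module_simps(4))
      also have "t \<otimes> x j = x0 j" unfolding t_def
        using x0j xjc Units_inv_closed[OF xj] Units_l_inv[OF xj] by (simp add: m_assoc)
      also have "x0 j \<ominus> x0 j = \<zero>" using x0j by simp
      finally have x1j: "x1 j = \<zero>" .
      have x1n: "x1 \<in> vecs (Suc n) (carrier R)" using x1 n by simp
      obtain y1 where y1: "y1 \<in> carrier (Fr n)" "skip R n j y1 = x1"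
        by (rule skip_surj[of x1 n j, OF x1n jn x1j])
      have "w x1 = w x0 \<ominus>\<^bsub>Fr b\<^esub> w (t \<odot>\<^bsub>Fr c'\<^esub> x)"
        unfolding x1_def by (rule module_hom_minus[OF Fr Fr w(1) x0 tx])
      then have "y \<ominus>\<^bsub>Fr b\<^esub> ?w y1 = z a0 \<oplus>\<^bsub>Fr b\<^esub> w (t \<odot>\<^bsub>Fr c'\<^esub> x)"
        unfolding y y1(2)
        using Fr.M.add_diff_diff[OF module_hom_closed[OF z(1) a0] module_hom_closed[OF w(1) x0] module_hom_closed[OF w(1) tx]]
        by simp
      also have "w (t \<odot>\<^bsub>Fr c'\<^esub> x) = t \<odot>\<^bsub>Fr b\<^esub> z (\<ominus>\<^bsub>Fr c\<^esub> a)"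
        unfolding module_hom_smult[OF w(1) t xc] wxA ..
      also have "\<dots> = z (t \<odot>\<^bsub>Fr c\<^esub> (\<ominus>\<^bsub>Fr c\<^esub> a))"
        by (rule module_hom_smult[OF z(1) t Fr.M.a_inv_closed[OF ac], symmetric])
      also have "z a0 \<oplus>\<^bsub>Fr b\<^esub> \<dots> = z (a0 \<oplus>\<^bsub>Fr c\<^esub> t \<odot>\<^bsub>Fr c\<^esub> (\<ominus>\<^bsub>Fr c\<^esub> a))"
        by (rule module_hom_add[OF z(1) a0 Fr.smult_closed[OF t Fr.M.a_inv_closed[OF ac]], symmetric])
      finally have "y \<ominus>\<^bsub>Fr b\<^esub> ?w y1 \<in> z ` carrier (Fr c)"
        by (rule image_eqI[OF _ Fr.M.a_closed[OF a0 Fr.smult_closed[OF t Fr.M.a_inv_closed[OF ac]]]])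
      then show "\<exists>x\<in>carrier (Fr n). y \<ominus>\<^bsub>Fr b\<^esub> ?w x \<in> z ` carrier (Fr c)" by (rule bexI[OF _ y1(1)])
    qed
    with w' w'B have "P n" unfolding P_def by (intro bexI[of _ ?w] conjI)
    moreover have "n < c'" using n by simp
    ultimately show False unfolding c'_def using not_less_Least by blast
  qed
  then have "Ker (c + c') b (join (Fr b) c c' z w) \<subseteq> V (c + c') (Suc 0)"
    using w(2) B(2) by (intro minimal_kernel[OF z(1,3) lin w(1)]) auto
  with w show thesis by (rule that)
qed

lemma minimal_cover:
  assumes B: "submodule B R (Fr b)" "B \<subseteq> V b (Suc 0)"
  obtains c d where "d \<in> Hom c b" "d ` carrier (Fr c) = B" "Ker c b d \<subseteq> V c (Suc 0)"
proof -
  let ?z = "\<lambda>x. \<zero>\<^bsub>Fr b\<^esub>"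
  have z: "?z \<in> Hom 0 b" by (rule module_hom_const_zero[OF Fr])
  have "?z ` carrier (Fr 0) \<subseteq> B" using Fr.submodule_zero_mem[OF B(1)] by blast
  moreover have "Ker 0 b ?z \<subseteq> V 0 (Suc 0)" by (auto simp: mem_a_kernel)
  moreover have "\<exists>y \<in> V 0 (Suc 0). ?z y = ?z x" for x :: "nat \<Rightarrow> 'a"
    by (rule bexI[OF _ V_zero], rule refl)
  ultimately obtain c' w where w: "w \<in> Hom c' b" "w ` carrier (Fr c') \<subseteq> B"
    "join (Fr b) 0 c' ?z w ` carrier (Fr (0 + c')) = B"
    "Ker (0 + c') b (join (Fr b) 0 c' ?z w) \<subseteq> V (0 + c') (Suc 0)"
    by (rule minimal_extension[OF z _ _ _ B]) (rule that)
  then show thesis by (intro that[OF hom_join_Fr[OF z w(1)]])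
qed

end

section \<open>Linear syzygies in short exact sequences\<close>

context noeth_local
begin

lemma app_left_eq_zero_iff:
  assumes u: "u \<in> carrier (Fr p)"
  shows "app p q u \<zero>\<^bsub>Fr q\<^esub> = \<zero>\<^bsub>Fr (p + q)\<^esub> \<longleftrightarrow> u = \<zero>\<^bsub>Fr p\<^esub>"
proof
  assume "app p q u \<zero>\<^bsub>Fr q\<^esub> = \<zero>\<^bsub>Fr (p + q)\<^esub>"
  then have "lo p (app p q u \<zero>\<^bsub>Fr q\<^esub>) = lo p \<zero>\<^bsub>Fr (p + q)\<^esub>" by simp
  then show "u = \<zero>\<^bsub>Fr p\<^esub>" unfolding lo_app_Fr[OF u] module_hom_zero[OF Fr Fr hom_lo] .
qed (simp only: app_zero_zero)

text \<open>The kernel of a joined cover is an extension: it contains the relations among the first generators, and its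
  projection consists of the relations among the second ones modulo the image of the first.\<close>

lemma kernel_join_left:
  assumes z: "z \<in> Hom c b" and w: "w \<in> Hom c' b"
  shows "{a \<in> carrier (Fr c). app c c' a \<zero>\<^bsub>Fr c'\<^esub> \<in> Ker (c + c') b (join (Fr b) c c' z w)} = Ker c b z"
proof -
  have "app c c' a \<zero>\<^bsub>Fr c'\<^esub> \<in> Ker (c + c') b (join (Fr b) c c' z w) \<longleftrightarrow> z a = \<zero>\<^bsub>Fr b\<^esub>"
    if a: "a \<in> carrier (Fr c)" for a
    unfolding mem_a_kernel join_app_Fr[OF a Fr.M.zero_closed] module_hom_zero[OF Fr Fr w]
      Fr.M.r_zero[OF module_hom_closed[OF z a]]
    using app_Fr[OF a Fr.M.zero_closed] by blast
  then show ?thesis unfolding set_eq_iff mem_a_kernel mem_Collect_eq by blast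
qed

lemma kernel_join_hi:
  assumes z: "z \<in> Hom c b" and w: "w \<in> Hom c' b"
  shows "hi c c' ` Ker (c + c') b (join (Fr b) c c' z w) = {x \<in> carrier (Fr c'). w x \<in> z ` carrier (Fr c)}"
proof (intro equalityI subsetI)
  fix x assume "x \<in> hi c c' ` Ker (c + c') b (join (Fr b) c c' z w)"
  then obtain v where v: "v \<in> Ker (c + c') b (join (Fr b) c c' z w)" "x = hi c c' v" by (elim imageE)
  note v' = a_kernelD[OF v(1)]
  have lc: "lo c v \<in> carrier (Fr c)" and xc: "x \<in> carrier (Fr c')"
    unfolding v(2) by (rule lo_Fr[OF v'(1)], rule hi_Fr[OF v'(1)])
  have zc: "z (lo c v) \<in> carrier (Fr b)" and wc: "w x \<in> carrier (Fr b)"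
    by (rule module_hom_closed[OF z lc], rule module_hom_closed[OF w xc])
  have "z (lo c v) \<oplus>\<^bsub>Fr b\<^esub> w x = \<zero>\<^bsub>Fr b\<^esub>" using v'(2) unfolding join_def v(2) .
  then have "w x \<oplus>\<^bsub>Fr b\<^esub> z (lo c v) = \<zero>\<^bsub>Fr b\<^esub>" unfolding Fr.M.a_comm[OF wc zc] .
  then have "w x = \<ominus>\<^bsub>Fr b\<^esub> z (lo c v)" by (rule sum_zero_imp_uminus[OF wc zc])
  also have "\<dots> = z (\<ominus>\<^bsub>Fr c\<^esub> lo c v)" by (rule module_hom_uminus[OF Fr Fr z lc, symmetric])
  finally have "w x \<in> z ` carrier (Fr c)" by (rule image_eqI[OF _ Fr.M.a_inv_closed[OF lc]])
  then show "x \<in> {x \<in> carrier (Fr c'). w x \<in> z ` carrier (Fr c)}" using xc by blast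
next
  fix x assume "x \<in> {x \<in> carrier (Fr c'). w x \<in> z ` carrier (Fr c)}"
  then obtain a where a: "a \<in> carrier (Fr c)" "w x = z a" and xc: "x \<in> carrier (Fr c')" by (elim CollectE conjE imageE)
  have na: "\<ominus>\<^bsub>Fr c\<^esub> a \<in> carrier (Fr c)" by (rule Fr.M.a_inv_closed[OF a(1)])
  have "join (Fr b) c c' z w (app c c' (\<ominus>\<^bsub>Fr c\<^esub> a) x) = \<ominus>\<^bsub>Fr b\<^esub> z a \<oplus>\<^bsub>Fr b\<^esub> z a"
    unfolding join_app_Fr[OF na xc] module_hom_uminus[OF Fr Fr z a(1)] a(2) ..
  also have "\<dots> = \<zero>\<^bsub>Fr b\<^esub>" by (rule Fr.M.l_neg[OF module_hom_closed[OF z a(1)]])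
  finally have "app c c' (\<ominus>\<^bsub>Fr c\<^esub> a) x \<in> Ker (c + c') b (join (Fr b) c c' z w)"
    by (rule a_kernelI[OF app_Fr[OF na xc]])
  then have "hi c c' (app c c' (\<ominus>\<^bsub>Fr c\<^esub> a) x) \<in> hi c c' ` Ker (c + c') b (join (Fr b) c c' z w)" by (rule imageI)
  then show "x \<in> hi c c' ` Ker (c + c') b (join (Fr b) c c' z w)" unfolding hi_app_Fr[OF xc] .
qed

text \<open>Linearity is inherited by extensions: \<open>Z\<close> is an extension of its projection to \<open>R\<^sup>q\<close> by its intersection with
  \<open>R\<^sup>p\<close>, and the kernel of a joined cover is an extension of the same kind. If \<open>y\<close> in \<open>Z\<close> has order \<open>s + 1\<close>, its
  projection has a preimage \<open>b\<close> of order \<open>s\<close> under the cover \<open>f\<close>. The lift \<open>h b\<close> has order \<open>s + 1\<close> again because \<open>Z\<close>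
  lies in \<open>\<mm>R\<^sup>p\<^sup>+\<^sup>q\<close>, so the difference \<open>y - h b\<close> in \<open>R\<^sup>p\<close> has order \<open>s + 1\<close> and can be handled by \<open>z\<close>.\<close>

lemma linear_syz_extension:
  "submodule Z R (Fr (p + q)) \<Longrightarrow> Z \<subseteq> V (p + q) (Suc 0) \<Longrightarrow>
   linear_syz R n p {u \<in> carrier (Fr p). app p q u \<zero>\<^bsub>Fr q\<^esub> \<in> Z} \<Longrightarrow>
   linear_syz R n q (hi p q ` Z) \<Longrightarrow> linear_syz R n (p + q) Z"
proof (induction n arbitrary: p q Z)
  case (Suc n)
  note Z = Suc.prems(1) and ZV = Suc.prems(2)
  let ?A = "{u \<in> carrier (Fr p). app p q u \<zero>\<^bsub>Fr q\<^esub> \<in> Z}"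
  let ?C = "hi p q ` Z"
  have A: "submodule ?A R (Fr p)" by (rule left_submodule[OF Z])
  have C: "submodule ?C R (Fr q)" by (rule module_hom_image_submodule[OF Fr Fr hom_hi Z])
  have "?A \<subseteq> V p (Suc 0)"
  proof
    fix u assume "u \<in> ?A"
    then have u: "u \<in> carrier (Fr p)" "app p q u \<zero>\<^bsub>Fr q\<^esub> \<in> V (p + q) (Suc 0)" using ZV by blast+
    from lo_V[OF u(2)] show "u \<in> V p (Suc 0)" unfolding lo_app_Fr[OF u(1)] .
  qed
  then obtain c z where z: "z \<in> Hom c p" "z ` carrier (Fr c) = ?A" "Ker c p z \<subseteq> V c (Suc 0)"
    by (rule minimal_cover[OF A])
  have "?C \<subseteq> V q (Suc 0)" using ZV hi_V by blast
  then obtain t f where f: "f \<in> Hom t q" "f ` carrier (Fr t) = ?C" "Ker t q f \<subseteq> V t (Suc 0)"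
    by (rule minimal_cover[OF C])
  note zlin = linear_syz_SucD[OF Suc.prems(3) z(1,2)]
  note flin = linear_syz_SucD[OF Suc.prems(4) f(1,2)]
  define L where "L = (\<lambda>u. app p q (z u) \<zero>\<^bsub>Fr q\<^esub>)"
  have L: "L \<in> Hom c (p + q)" unfolding L_def by (rule module_hom_comp[OF z(1) hom_app_left])
  obtain h where h: "h \<in> Hom t (p + q)" "h ` carrier (Fr t) \<subseteq> Z"
    "\<And>x. x \<in> vecs t (carrier R) \<Longrightarrow> hi p q (h x) = f x"
    "join (Fr (p + q)) c t L h ` carrier (Fr (c + t)) = Z"
    by (rule extension_cover[OF Z z(1,2) f(1,2), folded L_def]) (rule that)
  define D where "D = join (Fr (p + q)) c t L h"
  have D: "D \<in> Hom (c + t) (p + q)" unfolding D_def by (rule hom_join_Fr[OF L h(1)])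
  have DZ: "D ` carrier (Fr (c + t)) = Z" unfolding D_def by (rule h(4))
  have Dapp: "D (app c t a b) = L a \<oplus>\<^bsub>Fr (p + q)\<^esub> h b" if "a \<in> carrier (Fr c)" "b \<in> carrier (Fr t)" for a b
    unfolding D_def by (rule join_app_Fr[OF that])
  have Lc: "L a \<in> carrier (Fr (p + q))" if "a \<in> carrier (Fr c)" for a by (rule module_hom_closed[OF L that])
  have hc: "h b \<in> carrier (Fr (p + q))" if "b \<in> carrier (Fr t)" for b by (rule module_hom_closed[OF h(1) that])
  have hiL: "hi p q (L a) = \<zero>\<^bsub>Fr q\<^esub>" for a unfolding L_def by (rule hi_app_Fr[OF Fr.M.zero_closed])
  have hih: "hi p q (h b) = f b" if "b \<in> carrier (Fr t)" for b using h(3) that by simp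
  have hiD: "hi p q (D x) = f (hi c t x)" if x: "x \<in> carrier (Fr (c + t))" for x
  proof -
    have "D x = L (lo c x) \<oplus>\<^bsub>Fr (p + q)\<^esub> h (hi c t x)" unfolding D_def join_def ..
    then have "hi p q (D x) = hi p q (L (lo c x)) \<oplus>\<^bsub>Fr q\<^esub> hi p q (h (hi c t x))"
      using module_hom_add[OF hom_hi Lc[OF lo_Fr[OF x]] hc[OF hi_Fr[OF x]]] by simp
    also have "\<dots> = f (hi c t x)"
      unfolding hiL hih[OF hi_Fr[OF x]] by (rule Fr.M.l_zero[OF module_hom_closed[OF f(1) hi_Fr[OF x]]])
    finally show ?thesis .
  qed
  have Lzero: "L a = \<zero>\<^bsub>Fr (p + q)\<^esub> \<longleftrightarrow> z a = \<zero>\<^bsub>Fr p\<^esub>" if "a \<in> carrier (Fr c)" for a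
    unfolding L_def by (rule app_left_eq_zero_iff[OF module_hom_closed[OF z(1) that]])
  have Dlin: "linear_cover R (c + t) (p + q) D"
  proof (rule linear_coverI)
    fix s x assume x: "x \<in> carrier (Fr (c + t))" and Dx: "D x \<in> V (p + q) (Suc s)"
    have yZ: "D x \<in> Z" unfolding DZ[symmetric] using x by (rule imageI)
    have "f (hi c t x) \<in> V q (Suc s)" using hi_V[OF Dx] unfolding hiD[OF x] .
    from linear_coverD[OF flin(1) hi_Fr[OF x] this] obtain b where b: "b \<in> V t s" "f b = f (hi c t x)" .
    have bc: "b \<in> carrier (Fr t)" by (rule Fr_carrier_V[OF b(1)])
    have hbZ: "h b \<in> Z" using h(2) bc by blast
    have "h ` carrier (Fr t) \<subseteq> V (p + q) (Suc 0)" using h(2) ZV by blast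
    then have hbV: "h b \<in> V (p + q) (Suc s)" by (rule hom_V_Suc[OF h(1) _ b(1)])
    have "hi p q (h b) = hi p q (D x)" unfolding hih[OF bc] hiD[OF x] by (rule b(2))
    from left_mem_of_hi_eq[OF Z yZ hbZ this] obtain u where u: "u \<in> carrier (Fr p)" "app p q u \<zero>\<^bsub>Fr q\<^esub> \<in> Z"
      "D x \<ominus>\<^bsub>Fr (p + q)\<^esub> h b = app p q u \<zero>\<^bsub>Fr q\<^esub>" "u = lo p (D x \<ominus>\<^bsub>Fr (p + q)\<^esub> h b)" .
    have uV: "u \<in> V p (Suc s)" unfolding u(4) by (rule lo_V[OF Fr.submodule_minus_mem[OF V_submodule Dx hbV]])
    have "u \<in> ?A" using u(1,2) by blast
    then obtain a0 where a0: "a0 \<in> carrier (Fr c)" "u = z a0" unfolding z(2)[symmetric] by (elim imageE)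
    have "z a0 \<in> V p (Suc s)" using uV unfolding a0(2) .
    from linear_coverD[OF zlin(1) a0(1) this] obtain a where a: "a \<in> V c s" "z a = z a0" .
    have ac: "a \<in> carrier (Fr c)" by (rule Fr_carrier_V[OF a(1)])
    have "D (app c t a b) = app p q u \<zero>\<^bsub>Fr q\<^esub> \<oplus>\<^bsub>Fr (p + q)\<^esub> h b"
      unfolding Dapp[OF ac bc] a0(2) unfolding L_def a(2) ..
    also have "\<dots> = D x"
      unfolding u(3)[symmetric] by (rule Fr.M.diff_add_cancel[OF module_hom_closed[OF D x] hc[OF bc]])
    finally show "\<exists>w\<in>V (c + t) s. D w = D x" using app_V[OF a(1) b(1)] by blast
  qed
  have KL: "Ker c (p + q) L = Ker c p z"
    using Lzero unfolding set_eq_iff mem_a_kernel by blast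
  have KV: "Ker (c + t) (p + q) D \<subseteq> V (c + t) (Suc 0)"
    unfolding D_def
  proof (rule minimal_kernel[OF L _ _ h(1)])
    show "Ker c (p + q) L \<subseteq> V c (Suc 0)" unfolding KL by (rule z(3))
    show "h ` carrier (Fr t) \<subseteq> V (p + q) (Suc 0)" using h(2) ZV by blast
    show "\<exists>y\<in>V c (Suc 0). L y = L a" if a: "a \<in> carrier (Fr c)" "L a \<in> V (p + q) (Suc (Suc 0))" for a
    proof -
      have "z a \<in> V p (Suc (Suc 0))"
        using lo_V[OF a(2)] unfolding L_def lo_app_Fr[OF module_hom_closed[OF z(1) a(1)]] .
      from linear_coverD[OF zlin(1) a(1) this] obtain y where "y \<in> V c (Suc 0)" "z y = z a" .
      then show ?thesis unfolding L_def by (intro bexI[of _ y]) simp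
    qed
    show "hi c t v \<in> V t (Suc 0)" if v: "v \<in> Ker (c + t) (p + q) (join (Fr (p + q)) c t L h)" for v
    proof -
      note v' = a_kernelD[OF v, folded D_def]
      have "f (hi c t v) = \<zero>\<^bsub>Fr q\<^esub>"
        using hiD[OF v'(1)] unfolding v'(2) module_hom_zero[OF Fr Fr hom_hi] by simp
      then show ?thesis by (rule subsetD[OF f(3) a_kernelI[OF hi_Fr[OF v'(1)]]])
    qed
  qed
  have left: "linear_syz R n c {a \<in> carrier (Fr c). app c t a \<zero>\<^bsub>Fr t\<^esub> \<in> Ker (c + t) (p + q) D}"
    unfolding D_def kernel_join_left[OF L h(1)] KL by (rule zlin(2))
  have "h b \<in> L ` carrier (Fr c) \<longleftrightarrow> f b = \<zero>\<^bsub>Fr q\<^esub>" if b: "b \<in> carrier (Fr t)" for b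
  proof
    assume "h b \<in> L ` carrier (Fr c)"
    then obtain a where "h b = L a" by (elim imageE)
    then show "f b = \<zero>\<^bsub>Fr q\<^esub>" using hiL[of a] hih[OF b] by simp
  next
    assume f0: "f b = \<zero>\<^bsub>Fr q\<^esub>"
    have hbZ: "h b \<in> Z" using h(2) b by blast
    have "hi p q \<zero>\<^bsub>Fr (p + q)\<^esub> = hi p q (h b)" unfolding hih[OF b] f0 by (rule module_hom_zero[OF Fr Fr hom_hi])
    from left_mem_of_hi_eq[OF Z hbZ Fr.submodule_zero_mem[OF Z] this] obtain u where
      u: "u \<in> carrier (Fr p)" "app p q u \<zero>\<^bsub>Fr q\<^esub> \<in> Z"
      "h b \<ominus>\<^bsub>Fr (p + q)\<^esub> \<zero>\<^bsub>Fr (p + q)\<^esub> = app p q u \<zero>\<^bsub>Fr q\<^esub>" .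
    have "u \<in> ?A" using u(1,2) by blast
    then obtain a where a: "a \<in> carrier (Fr c)" "u = z a" unfolding z(2)[symmetric] by (elim imageE)
    have "h b = L a" using u(3) unfolding L_def a(2) Fr.M.diff_zero[OF hc[OF b]] .
    then show "h b \<in> L ` carrier (Fr c)" using a(1) by (rule image_eqI)
  qed
  then have "hi c t ` Ker (c + t) (p + q) D = Ker t q f"
    unfolding D_def kernel_join_hi[OF L h(1)] set_eq_iff mem_a_kernel mem_Collect_eq by blast
  then have right: "linear_syz R n t (hi c t ` Ker (c + t) (p + q) D)" using flin(2) by simp
  have "linear_syz R n (c + t) (Ker (c + t) (p + q) D)"
    by (rule Suc.IH[OF Ker_submodule[OF D] KV left right])
  then show ?case by (rule linear_syz_SucI[OF D DZ Dlin])
qed simp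

text \<open>A larger ambient free module changes neither the orders of vectors nor their relations.\<close>

lemma linear_syz_left:
  assumes "linear_syz R n p Z"
  shows "linear_syz R n (p + q) ((\<lambda>u. app p q u \<zero>\<^bsub>Fr q\<^esub>) ` Z)"
proof (cases n)
  case (Suc m)
  with assms obtain c d where d: "d \<in> Hom c p" "d ` carrier (Fr c) = Z" "linear_cover R c p d"
    "linear_syz R m c (Ker c p d)" by auto
  let ?d = "\<lambda>x. app p q (d x) \<zero>\<^bsub>Fr q\<^esub>"
  have d': "?d \<in> Hom c (p + q)" by (rule module_hom_comp[OF d(1) hom_app_left])
  have im: "?d ` carrier (Fr c) = (\<lambda>u. app p q u \<zero>\<^bsub>Fr q\<^esub>) ` Z" unfolding d(2)[symmetric] by (rule image_image[symmetric])
  have "linear_cover R c (p + q) ?d"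
  proof (rule linear_coverI)
    fix s x assume x: "x \<in> carrier (Fr c)" "?d x \<in> V (p + q) (Suc s)"
    have "d x \<in> V p (Suc s)" using lo_V[OF x(2)] unfolding lo_app_Fr[OF module_hom_closed[OF d(1) x(1)]] .
    from linear_coverD[OF d(3) x(1) this] obtain w where "w \<in> V c s" "d w = d x" .
    then show "\<exists>w\<in>V c s. ?d w = ?d x" by (intro bexI[of _ w]) simp
  qed
  moreover have "Ker c (p + q) ?d = Ker c p d"
    using app_left_eq_zero_iff[OF module_hom_closed[OF d(1)]] unfolding set_eq_iff mem_a_kernel by blast
  ultimately show ?thesis
    unfolding Suc using linear_syz_SucI[OF d' im] d(4) by simp
qed simp

text \<open>Linearity passes to quotients \<open>B/A\<close>. The syzygy module \<open>C\<close> of \<open>B/A\<close>, with respect to the generators \<open>w\<close> that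
  extend minimal generators \<open>z\<close> of \<open>A\<close> to minimal generators of \<open>B\<close>, is the projection of the kernel \<open>B1\<close> of the
  joined cover, and the kernel \<open>A1\<close> of this projection consists of the relations among \<open>z\<close>. So \<open>C\<close> is a quotient
  of the same kind, one syzygy further. Its elements lift to \<open>B1\<close> without loss of order, since \<open>A\<close> is linear.\<close>

lemma linear_syz_quotient:
  "submodule B R (Fr b) \<Longrightarrow> B \<subseteq> V b (Suc 0) \<Longrightarrow>
   z \<in> Hom c b \<Longrightarrow> z ` carrier (Fr c) = A \<Longrightarrow> Ker c b z \<subseteq> V c (Suc 0) \<Longrightarrow>
   w \<in> Hom c' b \<Longrightarrow> w ` carrier (Fr c') \<subseteq> B \<Longrightarrow>
   join (Fr b) c c' z w ` carrier (Fr (c + c')) = B \<Longrightarrow>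
   Ker (c + c') b (join (Fr b) c c' z w) \<subseteq> V (c + c') (Suc 0) \<Longrightarrow>
   linear_syz R (Suc n) b A \<Longrightarrow> linear_syz R (Suc n) b B \<Longrightarrow>
   linear_syz R n c' {x \<in> carrier (Fr c'). w x \<in> A}"
proof (induction n arbitrary: A B b c z c' w)
  case (Suc n)
  note B = Suc.prems(1) and BV = Suc.prems(2) and z = Suc.prems(3-5) and w = Suc.prems(6,7)
  define D where "D = join (Fr b) c c' z w"
  have D: "D \<in> Hom (c + c') b" unfolding D_def by (rule hom_join_Fr[OF z(1) w(1)])
  have DB: "D ` carrier (Fr (c + c')) = B" unfolding D_def by (rule Suc.prems(8))
  have KV: "Ker (c + c') b D \<subseteq> V (c + c') (Suc 0)" unfolding D_def by (rule Suc.prems(9))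
  note zlin = linear_syz_SucD[OF Suc.prems(10) z(1,2)]
  note Dlin = linear_syz_SucD[OF Suc.prems(11) D DB]
  define L where "L = (\<lambda>u. app c c' u \<zero>\<^bsub>Fr c'\<^esub>)"
  have L: "L \<in> Hom c (c + c')" unfolding L_def by (rule hom_app_left)
  have hiL: "hi c c' (L a) = \<zero>\<^bsub>Fr c'\<^esub>" for a unfolding L_def by (rule hi_app_Fr[OF Fr.M.zero_closed])
  define A1 where "A1 = L ` Ker c b z"
  define B1 where "B1 = Ker (c + c') b D"
  have B1: "submodule B1 R (Fr (c + c'))" unfolding B1_def by (rule Ker_submodule[OF D])
  have B1V: "B1 \<subseteq> V (c + c') (Suc 0)" unfolding B1_def by (rule KV)
  have A1: "submodule A1 R (Fr (c + c'))"
    unfolding A1_def by (rule module_hom_image_submodule[OF Fr Fr L Ker_submodule[OF z(1)]])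
  have Dapp: "D (app c c' a x) = z a \<oplus>\<^bsub>Fr b\<^esub> w x" if "a \<in> carrier (Fr c)" "x \<in> carrier (Fr c')" for a x
    unfolding D_def by (rule join_app_Fr[OF that])
  have zc: "z a \<in> carrier (Fr b)" if "a \<in> carrier (Fr c)" for a by (rule module_hom_closed[OF z(1) that])
  have DL: "D (L a) = z a" if a: "a \<in> carrier (Fr c)" for a
    unfolding L_def Dapp[OF a Fr.M.zero_closed] module_hom_zero[OF Fr Fr w(1)] by (rule Fr.M.r_zero[OF zc[OF a]])
  have A1B1: "A1 \<subseteq> B1"
  proof
    fix y assume "y \<in> A1"
    then obtain a where a: "a \<in> Ker c b z" "y = L a" unfolding A1_def by (elim imageE)
    note a' = a_kernelD[OF a(1)]
    show "y \<in> B1" unfolding B1_def a(2)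
      by (rule a_kernelI[OF module_hom_closed[OF L a'(1)]]) (simp only: DL[OF a'(1)] a'(2))
  qed
  have A1_iff: "y \<in> A1 \<longleftrightarrow> hi c c' y = \<zero>\<^bsub>Fr c'\<^esub>" if y: "y \<in> B1" for y
  proof
    assume "y \<in> A1"
    then obtain a where "y = L a" unfolding A1_def by (elim imageE)
    then show "hi c c' y = \<zero>\<^bsub>Fr c'\<^esub>" using hiL by simp
  next
    assume h0: "hi c c' y = \<zero>\<^bsub>Fr c'\<^esub>"
    note y' = a_kernelD[OF y[unfolded B1_def]]
    have yL: "y = L (lo c y)" unfolding L_def by (rule hi_zero_imp_app[OF y'(1) h0])
    have "z (lo c y) = \<zero>\<^bsub>Fr b\<^esub>" using DL[OF lo_Fr[OF y'(1)]] y'(2) yL by simp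
    then have "lo c y \<in> Ker c b z" by (rule a_kernelI[OF lo_Fr[OF y'(1)]])
    then show "y \<in> A1" unfolding A1_def by (rule image_eqI[where f = L, OF yL])
  qed
  have linA1: "linear_syz R (Suc n) (c + c') A1"
    unfolding A1_def L_def by (rule linear_syz_left[OF zlin(2)])
  have linB1: "linear_syz R (Suc n) (c + c') B1" unfolding B1_def by (rule Dlin(2))
  have "A1 \<subseteq> V (c + c') (Suc 0)" using A1B1 B1V by blast
  then obtain c1 z1 where z1: "z1 \<in> Hom c1 (c + c')" "z1 ` carrier (Fr c1) = A1" "Ker c1 (c + c') z1 \<subseteq> V c1 (Suc 0)"
    by (rule minimal_cover[OF A1])
  note z1lin = linear_syz_SucD[OF linA1 z1(1,2)]
  have z1B1: "z1 ` carrier (Fr c1) \<subseteq> B1" unfolding z1(2) by (rule A1B1)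
  have ex: "\<exists>y \<in> V c1 (Suc 0). z1 y = z1 x" if "x \<in> carrier (Fr c1)" "z1 x \<in> V (c + c') (Suc (Suc 0))" for x
    using linear_coverD[OF z1lin(1) that] by blast
  obtain c1' w1 where w1: "w1 \<in> Hom c1' (c + c')" "w1 ` carrier (Fr c1') \<subseteq> B1"
    "join (Fr (c + c')) c1 c1' z1 w1 ` carrier (Fr (c1 + c1')) = B1"
    "Ker (c1 + c1') (c + c') (join (Fr (c + c')) c1 c1' z1 w1) \<subseteq> V (c1 + c1') (Suc 0)"
    by (rule minimal_extension[OF z1(1) z1B1 z1(3) ex B1 B1V])
  have IH: "linear_syz R n c1' {x \<in> carrier (Fr c1'). w1 x \<in> A1}"
    by (rule Suc.IH[OF B1 B1V z1 w1 linA1 linB1])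
  define D1 where "D1 = join (Fr (c + c')) c1 c1' z1 w1"
  have D1: "D1 \<in> Hom (c1 + c1') (c + c')" unfolding D1_def by (rule hom_join_Fr[OF z1(1) w1(1)])
  have D1B1: "D1 ` carrier (Fr (c1 + c1')) = B1" unfolding D1_def by (rule w1(3))
  note D1lin = linear_syz_SucD(1)[OF linB1 D1 D1B1]
  let ?C = "{x \<in> carrier (Fr c'). w x \<in> A}"
  define g where "g = (\<lambda>x. hi c c' (w1 x))"
  have g: "g \<in> Hom c1' c'" unfolding g_def by (rule module_hom_comp[OF w1(1) hom_hi])
  have hiD1: "hi c c' (D1 v) = g (hi c1 c1' v)" if v: "v \<in> carrier (Fr (c1 + c1'))" for v
  proof -
    have 1: "z1 (lo c1 v) \<in> A1" unfolding z1(2)[symmetric] by (rule imageI[OF lo_Fr[OF v]])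
    then have "z1 (lo c1 v) \<in> B1" using A1B1 by blast
    then have 2: "hi c c' (z1 (lo c1 v)) = \<zero>\<^bsub>Fr c'\<^esub>" using A1_iff 1 by blast
    have "hi c c' (D1 v) = hi c c' (z1 (lo c1 v)) \<oplus>\<^bsub>Fr c'\<^esub> hi c c' (w1 (hi c1 c1' v))"
      unfolding D1_def join_def
      by (rule module_hom_add[OF hom_hi module_hom_closed[OF z1(1) lo_Fr[OF v]] module_hom_closed[OF w1(1) hi_Fr[OF v]]])
    also have "\<dots> = g (hi c1 c1' v)"
      unfolding 2 g_def[symmetric] unfolding g_def by (rule Fr.M.l_zero[OF module_hom_closed[OF g hi_Fr[OF v], unfolded g_def]])
    finally show ?thesis .
  qed
  have lift: "\<exists>v \<in> V (c + c') s. v \<in> B1 \<and> hi c c' v = x" if x: "x \<in> ?C" "x \<in> V c' s" for x s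
  proof -
    have xc: "x \<in> carrier (Fr c')" and wxA: "w x \<in> A" using x(1) by blast+
    have "w ` carrier (Fr c') \<subseteq> V b (Suc 0)" using w(2) BV by blast
    then have wxV: "w x \<in> V b (Suc s)" by (rule hom_V_Suc[OF w(1) _ x(2)])
    obtain a0 where a0: "a0 \<in> carrier (Fr c)" "w x = z a0" using wxA unfolding z(2)[symmetric] by (elim imageE)
    have "z a0 \<in> V b (Suc s)" using wxV unfolding a0(2) .
    from linear_coverD[OF zlin(1) a0(1) this] obtain a where a: "a \<in> V c s" "z a = z a0" .
    have ac: "a \<in> carrier (Fr c)" by (rule Fr_carrier_V[OF a(1)])
    have na: "\<ominus>\<^bsub>Fr c\<^esub> a \<in> V c s" by (rule Fr.submoduleE(3)[OF V_submodule a(1)])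
    have nac: "\<ominus>\<^bsub>Fr c\<^esub> a \<in> carrier (Fr c)" by (rule Fr.M.a_inv_closed[OF ac])
    have "D (app c c' (\<ominus>\<^bsub>Fr c\<^esub> a) x) = \<ominus>\<^bsub>Fr b\<^esub> z a \<oplus>\<^bsub>Fr b\<^esub> z a"
      unfolding Dapp[OF nac xc] module_hom_uminus[OF Fr Fr z(1) ac] a0(2) a(2) ..
    also have "\<dots> = \<zero>\<^bsub>Fr b\<^esub>" by (rule Fr.M.l_neg[OF zc[OF ac]])
    finally have "app c c' (\<ominus>\<^bsub>Fr c\<^esub> a) x \<in> B1"
      unfolding B1_def by (rule a_kernelI[OF app_Fr[OF nac xc]])
    then show ?thesis using app_V[OF na x(2)] hi_app_Fr[OF xc] by blast
  qed
  have hiB1: "hi c c' ` B1 = ?C"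
    unfolding B1_def D_def kernel_join_hi[OF z(1) w(1)] z(2) ..
  have gC: "g ` carrier (Fr c1') = ?C"
  proof (intro equalityI subsetI)
    fix x assume "x \<in> g ` carrier (Fr c1')"
    then obtain y where y: "y \<in> carrier (Fr c1')" "x = hi c c' (w1 y)" unfolding g_def by (elim imageE)
    have "w1 y \<in> B1" using w1(2) y(1) by blast
    then show "x \<in> ?C" unfolding hiB1[symmetric] y(2) by (rule imageI)
  next
    fix x assume x: "x \<in> ?C"
    then have "x \<in> carrier (Fr c')" by blast
    then have "x \<in> V c' 0" by simp
    from lift[OF x this] obtain v where v: "v \<in> B1" "hi c c' v = x" by blast
    from v(1) obtain u where u: "u \<in> carrier (Fr (c1 + c1'))" "v = D1 u" unfolding D1B1[symmetric] by (elim imageE)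
    have "x = g (hi c1 c1' u)" using v(2) hiD1[OF u(1)] unfolding u(2) by simp
    then show "x \<in> g ` carrier (Fr c1')" using hi_Fr[OF u(1)] by (rule image_eqI)
  qed
  have glin: "linear_cover R c1' c' g"
  proof (rule linear_coverI)
    fix s x assume x: "x \<in> carrier (Fr c1')" and gx: "g x \<in> V c' (Suc s)"
    have "g x \<in> ?C" unfolding gC[symmetric] using x by (rule imageI)
    from lift[OF this gx] obtain v where v: "v \<in> V (c + c') (Suc s)" "v \<in> B1" "hi c c' v = g x" by blast
    from v(2) obtain u0 where u0: "u0 \<in> carrier (Fr (c1 + c1'))" "v = D1 u0" unfolding D1B1[symmetric] by (elim imageE)
    have "D1 u0 \<in> V (c + c') (Suc s)" using v(1) unfolding u0(2) .
    from linear_coverD[OF D1lin u0(1) this] obtain u where u: "u \<in> V (c1 + c1') s" "D1 u = D1 u0" .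
    have "g (hi c1 c1' u) = g x" using hiD1[OF Fr_carrier_V[OF u(1)]] v(3) unfolding u(2) u0(2) by simp
    then show "\<exists>w\<in>V c1' s. g w = g x" using hi_V[OF u(1)] by blast
  qed
  have "Ker c1' c' g = {x \<in> carrier (Fr c1'). w1 x \<in> A1}"
  proof -
    have "w1 x \<in> A1 \<longleftrightarrow> g x = \<zero>\<^bsub>Fr c'\<^esub>" if "x \<in> carrier (Fr c1')" for x
      unfolding g_def using w1(2) that by (intro A1_iff) blast
    then show ?thesis unfolding set_eq_iff mem_a_kernel mem_Collect_eq by blast
  qed
  with IH have "linear_syz R n c1' (Ker c1' c' g)" by simp
  then show ?case by (rule linear_syz_SucI[OF g gC glin])
qed simp

end

section \<open>Koszul filtrations\<close>

context noeth_local
begin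

lemma linear_syz_zero: "linear_syz R n b {\<zero>\<^bsub>Fr b\<^esub>}"
proof (induction n arbitrary: b)
  case (Suc n)
  let ?z = "\<lambda>x :: nat \<Rightarrow> 'a. \<zero>\<^bsub>Fr b\<^esub>"
  have z: "?z \<in> Hom 0 b" by (rule module_hom_const_zero[OF Fr])
  have F0: "carrier (Fr 0) = {\<zero>\<^bsub>Fr 0\<^esub>}" by (auto simp: free_module_simps)
  have im: "?z ` carrier (Fr 0) = {\<zero>\<^bsub>Fr b\<^esub>}" unfolding F0 by simp
  have "linear_cover R 0 b ?z"
    by (rule linear_coverI) (rule bexI[OF _ V_zero], rule refl)
  moreover have "Ker 0 b ?z = {\<zero>\<^bsub>Fr 0\<^esub>}" unfolding set_eq_iff mem_a_kernel F0 by blast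
  ultimately show ?case using linear_syz_SucI[OF z im] Suc.IH[of 0] by simp
qed simp

lemma vec_V1: "I \<subseteq> max_ideal R \<Longrightarrow> vecs n I \<subseteq> V (n::nat) (Suc 0)"
  unfolding V_1 by (rule PiE_mono)

text \<open>Condition (F2) is linearity at the first step; for \<open>s = 0\<close> there is nothing to prove.\<close>

lemma linear_cover_of_ideal:
  assumes d: "d \<in> Hom c 1" "d ` carrier (Fr c) = vecs 1 I"
    and F2: "\<And>s. s \<ge> 1 \<Longrightarrow> I \<inter> mpow R (s + 1) = mpow R s \<cdot> I"
  shows "linear_cover R c 1 d"
proof (rule linear_coverI)
  fix s x assume x: "x \<in> carrier (Fr c)" and dx: "d x \<in> V 1 (Suc s)"
  have dI: "d x \<in> vecs 1 I" unfolding d(2)[symmetric] using x by (rule imageI)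
  show "\<exists>w\<in>V c s. d w = d x"
  proof (cases "s = 0")
    case True
    then show ?thesis using x by (intro bexI[of _ x]) simp_all
  next
    case False
    have W: "submodule (d ` V c s) R (Fr 1)" by (rule module_hom_image_submodule[OF Fr Fr d(1) V_submodule])
    have *: "single a \<in> d ` V c s" if "a \<in> mpow R s \<cdot> I" for a
      using that
    proof (induction rule: ideal_prod.induct)
      case (prod r i)
      have "single i \<in> d ` carrier (Fr c)" unfolding d(2) using prod(2) by simp
      then obtain y where y: "y \<in> carrier (Fr c)" "single i = d y" by (elim imageE)
      have "single (r \<otimes> i) = r \<odot>\<^bsub>Fr 1\<^esub> d y"
        unfolding y(2)[symmetric] by (auto simp: free_module_simps single_def intro!: restrict_ext)
      also have "\<dots> = d (r \<odot>\<^bsub>Fr c\<^esub> y)" by (rule module_hom_smult[OF d(1) mpow_carrier[OF prod(1)] y(1), symmetric])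
      finally have "single (r \<otimes> i) = d (r \<odot>\<^bsub>Fr c\<^esub> y)" .
      moreover have "r \<odot>\<^bsub>Fr c\<^esub> y \<in> V c s"
        using y(1) ideal.I_r_closed[OF mpow_ideal prod(1)] by (auto simp: free_module_simps PiE_iff)
      ultimately show ?case by (rule image_eqI)
    next
      case (sum r1 r2)
      have "single (r1 \<oplus> r2) = single r1 \<oplus>\<^bsub>Fr 1\<^esub> single r2"
        by (auto simp: free_module_simps single_def intro!: restrict_ext)
      then show ?case using Fr.submoduleE(5)[OF W sum.IH] by simp
    qed
    have "d x 0 \<in> I \<inter> mpow R (s + 1)" using dI dx by auto
    moreover have "s \<ge> 1" using False by simp
    ultimately have "d x 0 \<in> mpow R s \<cdot> I" using F2 by blast
    then have "single (d x 0) \<in> d ` V c s" by (rule *)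
    then have "d x \<in> d ` V c s" unfolding single_eta[OF dI] .
    then obtain w where "w \<in> V c s" "d x = d w" by (elim imageE)
    then show ?thesis by (intro bexI[of _ w]) simp_all
  qed
qed

text \<open>The quotient \<open>B/A\<close> is cyclic with annihilator \<open>A : x\<close>. Hence the syzygies of \<open>B\<close> are an extension of the colon
  ideal by the syzygies of \<open>A\<close>. The colon ideal is needed one step less deep than \<open>A\<close> itself.\<close>

lemma linear_syz_add_principal:
  assumes A: "ideal A R" "A \<subseteq> max_ideal R" and B: "ideal B R" "B = A <+>\<^bsub>R\<^esub> PIdl x" and x: "x \<in> max_ideal R"
    and C: "colon_ideal R A x \<subseteq> max_ideal R"
    and F2: "\<And>s. s \<ge> 1 \<Longrightarrow> B \<inter> mpow R (s + 1) = mpow R s \<cdot> B"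
    and linA: "linear_syz R (Suc n) 1 (vecs 1 A)"
    and linC: "linear_syz R n 1 (vecs 1 (colon_ideal R A x))"
  shows "linear_syz R (Suc n) 1 (vecs 1 B)"
proof -
  have xc: "x \<in> carrier R" using x ideal.Icarr[OF max_ideal_ideal] by blast
  obtain c z where z: "z \<in> Hom c 1" "z ` carrier (Fr c) = vecs 1 A" "Ker c 1 z \<subseteq> V c (Suc 0)"
    by (rule minimal_cover[OF vec_ideal_submodule[OF A(1)] vec_V1[OF A(2)]])
  note zlin = linear_syz_SucD[OF linA z(1,2)]
  define w where "w = (\<lambda>v. v (0::nat) \<odot>\<^bsub>Fr 1\<^esub> single x)"
  have w: "w \<in> Hom 1 1" unfolding w_def by (rule hom_single[OF Fr]) (use xc in \<open>simp only: free_module_simps single_mem\<close>)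
  have w_eq: "w v = single (v 0 \<otimes> x)" for v
    unfolding w_def by (auto simp: free_module_simps single_def intro!: restrict_ext)
  define D where "D = join (Fr 1) c 1 z w"
  have D: "D \<in> Hom (c + 1) 1" unfolding D_def by (rule hom_join_Fr[OF z(1) w])
  have Asub: "a \<in> B" if "a \<in> A" for a
  proof -
    have "a \<oplus> \<zero> \<otimes> x \<in> A <+>\<^bsub>R\<^esub> PIdl x" using that by (auto simp: set_add_def' cgenideal_def)
    then show ?thesis using B(2) that ideal.Icarr[OF A(1)] xc by simp
  qed
  have DB: "D ` carrier (Fr (c + 1)) = vecs 1 B"
    unfolding D_def
  proof (rule join_image[OF Fr z(1) w vec_ideal_submodule[OF B(1)]])
    show "z ` carrier (Fr c) \<subseteq> vecs 1 B" unfolding z(2) by (rule PiE_mono) (rule subsetI, rule Asub)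
    show "w ` carrier (Fr 1) \<subseteq> vecs 1 B"
    proof
      fix y assume "y \<in> w ` carrier (Fr 1)"
      then obtain v where v: "v \<in> carrier (Fr 1)" "y = w v" by (elim imageE)
      then have v0: "v 0 \<in> carrier R" by auto
      have "\<zero> \<oplus> v 0 \<otimes> x \<in> A <+>\<^bsub>R\<^esub> PIdl x"
        using v0 additive_subgroup.zero_closed[OF ideal.axioms(1)[OF A(1)]] by (auto simp: set_add_def' cgenideal_def)
      then have "v 0 \<otimes> x \<in> B" using B(2) v0 xc by simp
      then show "y \<in> vecs 1 B" unfolding v(2) w_eq single_mem .
    qed
    fix y :: "nat \<Rightarrow> 'a" assume y: "y \<in> vecs 1 B"
    then have "y 0 \<in> A <+>\<^bsub>R\<^esub> PIdl x" using B(2) by auto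
    then obtain a r where a: "a \<in> A" and r: "r \<in> carrier R" and y0: "y 0 = a \<oplus> r \<otimes> x"
      unfolding set_add_def' cgenideal_def by blast
    have ac: "a \<in> carrier R" using a ideal.Icarr[OF A(1)] by blast
    have wr: "w (single r) = single (r \<otimes> x)" unfolding w_eq by simp
    have "y \<ominus>\<^bsub>Fr 1\<^esub> w (single r) = single (y 0 \<ominus> r \<otimes> x)"
    proof -
      have "single (r \<otimes> x) \<in> vecs 1 (carrier R)" using r xc by (simp only: single_mem m_closed)
      from free_module_minus[OF vec_ideal_carrier[OF B(1) y] this] show ?thesis
        unfolding wr by (auto simp: single_def intro!: restrict_ext)
    qed
    also have "y 0 \<ominus> r \<otimes> x = a" unfolding y0 using ac r xc by (simp add: a_minus_def a_assoc r_neg)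
    finally have "y \<ominus>\<^bsub>Fr 1\<^esub> w (single r) \<in> z ` carrier (Fr c)" unfolding z(2) using a by (simp only: single_mem)
    moreover have "single r \<in> carrier (Fr 1)" using r by (simp only: single_mem free_module_simps)
    ultimately show "\<exists>x\<in>carrier (Fr 1). y \<ominus>\<^bsub>Fr 1\<^esub> w x \<in> z ` carrier (Fr c)" by (rule bexI)
  qed
  have hiK: "hi c 1 ` Ker (c + 1) 1 D = vecs 1 (colon_ideal R A x)"
  proof -
    have "v \<in> carrier (Fr 1) \<and> w v \<in> vecs 1 A \<longleftrightarrow> v \<in> vecs 1 (colon_ideal R A x)" for v
    proof -
      have "w v \<in> vecs 1 A \<longleftrightarrow> v 0 \<otimes> x \<in> A" unfolding w_eq single_mem ..
      then show ?thesis by (auto simp: colon_ideal_def PiE_iff)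
    qed
    then show ?thesis unfolding D_def kernel_join_hi[OF z(1) w] z(2) by blast
  qed
  have KV: "Ker (c + 1) 1 D \<subseteq> V (c + 1) (Suc 0)"
    unfolding D_def
  proof (rule minimal_kernel[OF z(1,3) _ w])
    show "\<exists>y\<in>V c (Suc 0). z y = z u" if "u \<in> carrier (Fr c)" "z u \<in> V 1 (Suc (Suc 0))" for u
      using linear_coverD[OF zlin(1) that] by blast
    show "w ` carrier (Fr 1) \<subseteq> V 1 (Suc 0)"
    proof
      fix y assume "y \<in> w ` carrier (Fr 1)"
      then obtain v where v: "v \<in> carrier (Fr 1)" "y = w v" by (elim imageE)
      then have "v 0 \<otimes> x \<in> max_ideal R" using x ideal.I_l_closed[OF max_ideal_ideal] by auto
      then show "y \<in> V 1 (Suc 0)" unfolding V_1 v(2) w_eq single_mem .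
    qed
    show "hi c 1 v \<in> V 1 (Suc 0)" if "v \<in> Ker (c + 1) 1 (join (Fr 1) c 1 z w)" for v
    proof -
      have "hi c 1 v \<in> hi c 1 ` Ker (c + 1) 1 D" unfolding D_def using that by (rule imageI)
      then show ?thesis unfolding hiK using vec_V1[OF C] by blast
    qed
  qed
  have "linear_syz R n (c + 1) (Ker (c + 1) 1 D)"
  proof (rule linear_syz_extension[OF Ker_submodule[OF D] KV])
    show "linear_syz R n c {u \<in> carrier (Fr c). app c 1 u \<zero>\<^bsub>Fr 1\<^esub> \<in> Ker (c + 1) 1 D}"
      unfolding D_def kernel_join_left[OF z(1) w] by (rule zlin(2))
    show "linear_syz R n 1 (hi c 1 ` Ker (c + 1) 1 D)" unfolding hiK by (rule linC)
  qed
  moreover have "linear_cover R (c + 1) 1 D" by (rule linear_cover_of_ideal[OF D DB]) (rule F2)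
  ultimately show ?thesis by (intro linear_syz_SucI[OF D DB])
qed

lemma koszul_filtrationD:
  assumes "koszul_filtration R \<F>"
  shows "\<And>I. I \<in> \<F> \<Longrightarrow> ideal I R" "{\<zero>} \<in> \<F>" "max_ideal R \<in> \<F>"
    "\<And>I s. I \<in> \<F> \<Longrightarrow> s \<ge> 1 \<Longrightarrow> I \<inter> mpow R (s + 1) = mpow R s \<cdot> I"
    "\<And>I. I \<in> \<F> \<Longrightarrow> I \<noteq> {\<zero>} \<Longrightarrow> \<exists>(n::nat) J x. J 0 = {\<zero>} \<and> J n = I \<and>
           (\<forall>j\<in>{1..n}. J (j - 1) \<subseteq> J j \<and> x j \<in> max_ideal R \<and> J j \<in> \<F> \<and>
              J j = J (j - 1) <+>\<^bsub>R\<^esub> PIdl (x j) \<and> colon_ideal R (J (j - 1)) (x j) \<in> \<F>)"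
proof -
  note * = assms[unfolded koszul_filtration_def]
  note c = conjunct1[OF *] conjunct1[OF conjunct2[OF *]] conjunct1[OF conjunct2[OF conjunct2[OF *]]]
    conjunct1[OF conjunct2[OF conjunct2[OF conjunct2[OF *]]]] conjunct2[OF conjunct2[OF conjunct2[OF conjunct2[OF *]]]]
  show "\<And>I. I \<in> \<F> \<Longrightarrow> ideal I R" by (rule bspec[OF c(1)])
  show "{\<zero>} \<in> \<F>" by (rule c(2))
  show "max_ideal R \<in> \<F>" by (rule c(3))
  show "\<And>I s. I \<in> \<F> \<Longrightarrow> s \<ge> 1 \<Longrightarrow> I \<inter> mpow R (s + 1) = mpow R s \<cdot> I"
    using c(4) by simp
  show "I \<noteq> {\<zero>} \<Longrightarrow> \<exists>(n::nat) J x. J 0 = {\<zero>} \<and> J n = I \<and>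
           (\<forall>j\<in>{1..n}. J (j - 1) \<subseteq> J j \<and> x j \<in> max_ideal R \<and> J j \<in> \<F> \<and>
              J j = J (j - 1) <+>\<^bsub>R\<^esub> PIdl (x j) \<and> colon_ideal R (J (j - 1)) (x j) \<in> \<F>)"
    if "I \<in> \<F>" for I
    by (rule mp[OF bspec[OF c(5) that]])
qed

text \<open>Condition (F3) as an induction rule.\<close>

lemma koszul_filtration_induct [consumes 2, case_names zero step]:
  assumes \<F>: "koszul_filtration R \<F>" and I: "I \<in> \<F>"
    and zero: "P {\<zero>}"
    and step: "\<And>A B x. A \<in> \<F> \<Longrightarrow> B \<in> \<F> \<Longrightarrow> B = A <+>\<^bsub>R\<^esub> PIdl x \<Longrightarrow> x \<in> max_ideal R \<Longrightarrow>
      colon_ideal R A x \<in> \<F> \<Longrightarrow> P A \<Longrightarrow> P B"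
  shows "P I"
proof (cases "I = {\<zero>}")
  case True then show ?thesis using zero by simp
next
  case False
  from koszul_filtrationD(5)[OF \<F> I False] obtain n J x where J: "J 0 = {\<zero>}" "J (n::nat) = I"
    "\<And>j. j \<in> {1..n} \<Longrightarrow> x j \<in> max_ideal R \<and> J j \<in> \<F> \<and> J j = J (j - 1) <+>\<^bsub>R\<^esub> PIdl (x j) \<and>
        colon_ideal R (J (j - 1)) (x j) \<in> \<F>" by blast
  have "j \<le> n \<Longrightarrow> J j \<in> \<F> \<and> P (J j)" for j
  proof (induction j)
    case 0 then show ?case using zero koszul_filtrationD(2)[OF \<F>] unfolding J(1) by blast
  next
    case (Suc j)
    have "x (Suc j) \<in> max_ideal R" "J (Suc j) \<in> \<F>" "J (Suc j) = J j <+>\<^bsub>R\<^esub> PIdl (x (Suc j))"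
      "colon_ideal R (J j) (x (Suc j)) \<in> \<F>"
      using J(3)[of "Suc j"] Suc.prems by auto
    moreover have "J j \<in> \<F>" "P (J j)" using Suc by auto
    ultimately show ?case using step[of "J j" "J (Suc j)" "x (Suc j)"] by blast
  qed
  then show ?thesis using J(2) by blast
qed

lemma koszul_filtration_subset_max_ideal:
  assumes "koszul_filtration R \<F>" "I \<in> \<F>"
  shows "I \<subseteq> max_ideal R"
  using assms
proof (induction rule: koszul_filtration_induct)
  case zero
  show ?case using additive_subgroup.zero_closed[OF ideal.axioms(1)[OF max_ideal_ideal]] by blast
next
  case (step A B x)
  show ?case
  proof
    fix a assume "a \<in> B"
    then obtain b r where b: "b \<in> A" "r \<in> carrier R" "a = b \<oplus> r \<otimes> x"
      unfolding step(3) set_add_def' cgenideal_def by blast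
    have "b \<in> max_ideal R" "r \<otimes> x \<in> max_ideal R"
      using b(1) step(6) ideal.I_l_closed[OF max_ideal_ideal step(4) b(2)] by blast+
    then show "a \<in> max_ideal R"
      unfolding b(3) by (rule additive_subgroup.a_closed[OF ideal.axioms(1)[OF max_ideal_ideal]])
  qed
qed

text \<open>Colon ideals are needed one step less deep, so the induction on \<open>n\<close> has to be outside the induction along the
  filtration.\<close>

theorem koszul_filtration_linear_syz:
  assumes \<F>: "koszul_filtration R \<F>"
  shows "I \<in> \<F> \<Longrightarrow> linear_syz R n 1 (vecs 1 I)"
proof (induction n arbitrary: I)
  case (Suc n)
  note F = koszul_filtrationD[OF \<F>] and sub = koszul_filtration_subset_max_ideal[OF \<F>] and IH = Suc.IH
  show ?case
    using \<F> Suc.prems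
  proof (induction rule: koszul_filtration_induct)
    case zero
    have "(vecs 1 {\<zero>}) = {\<zero>\<^bsub>Fr 1\<^esub>}" unfolding free_module_simps by (subst PiE_eq_singleton) simp
    then show ?case using linear_syz_zero[of "Suc n" 1] by (simp only:)
  next
    case (step A B x)
    show ?case
      by (rule linear_syz_add_principal[OF F(1)[OF step(1)] sub[OF step(1)] F(1)[OF step(2)] step(3,4)
            sub[OF step(5)] F(4)[OF step(2)] step(6) IH[OF step(5)]])
  qed
qed simp

text \<open>The module \<open>J\<^sup>b\<close> is an iterated extension of copies of \<open>J\<close>.\<close>

lemma linear_syz_power:
  assumes J: "ideal J R" "J \<subseteq> max_ideal R" and lin: "linear_syz R n 1 (vecs 1 J)"
  shows "linear_syz R n b (vecs b J)"
proof (induction b)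
  case 0
  have "(vecs 0 J) = {\<zero>\<^bsub>Fr 0\<^esub>}" by (auto simp: free_module_simps)
  then show ?case using linear_syz_zero[of n 0] by simp
next
  case (Suc b)
  have Z: "submodule (vecs (b + 1) J) R (Fr (b + 1))" by (rule vec_ideal_submodule[OF J(1)])
  have J0: "\<zero>\<^bsub>Fr 1\<^esub> \<in> vecs 1 J" "\<zero>\<^bsub>Fr b\<^esub> \<in> vecs b J"
    by (rule Fr.submodule_zero_mem[OF vec_ideal_submodule[OF J(1)]])+
  have "{u \<in> carrier (Fr b). app b 1 u \<zero>\<^bsub>Fr 1\<^esub> \<in> vecs (b + 1) J} = vecs b J"
  proof (intro equalityI subsetI)
    fix u assume "u \<in> {u \<in> carrier (Fr b). app b 1 u \<zero>\<^bsub>Fr 1\<^esub> \<in> vecs (b + 1) J}"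
    then have u: "u \<in> carrier (Fr b)" "app b 1 u \<zero>\<^bsub>Fr 1\<^esub> \<in> vecs (b + 1) J" by blast+
    from lo_mem[OF u(2)] show "u \<in> vecs b J" unfolding lo_app_Fr[OF u(1)] .
  next
    fix u assume u: "u \<in> vecs b J"
    then show "u \<in> {u \<in> carrier (Fr b). app b 1 u \<zero>\<^bsub>Fr 1\<^esub> \<in> vecs (b + 1) J}"
      using app_mem[OF u J0(1)] vec_ideal_carrier[OF J(1) u] by (simp only: free_module_simps(1) mem_Collect_eq simp_thms)
  qed
  moreover have "hi b 1 ` (vecs (b + 1) J) = vecs 1 J"
  proof (intro equalityI subsetI)
    fix v :: "nat \<Rightarrow> 'a" assume v: "v \<in> vecs 1 J"
    have "hi b 1 (app b 1 \<zero>\<^bsub>Fr b\<^esub> v) \<in> hi b 1 ` (vecs (b + 1) J)"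
      by (rule imageI[OF app_mem[OF J0(2) v]])
    then show "v \<in> hi b 1 ` (vecs (b + 1) J)" unfolding hi_app[OF v] .
  next
    fix v :: "nat \<Rightarrow> 'a" assume "v \<in> hi b 1 ` (vecs (b + 1) J)"
    then obtain y where "y \<in> vecs (b + 1) J" "v = hi b 1 y" by (elim imageE)
    then show "v \<in> vecs 1 J" using hi_mem by metis
  qed
  ultimately have "linear_syz R n (b + 1) (vecs (b + 1) J)"
    using Suc lin by (intro linear_syz_extension[OF Z vec_V1[OF J(2)]]) (simp_all only:)
  then show ?case by simp
qed

end

section \<open>Quotient rings\<close>

text \<open>The reduction \<open>R \<rightarrow> R/I\<close>, with the target known up to isomorphism only.\<close>

locale surj_local = R: noeth_local R + S: noeth_local S for R (structure) and S (structure) +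
  fixes h
  assumes ring_hom: "h \<in> ring_hom R S" and surj: "h ` carrier R = carrier S"
begin

sublocale h: ring_hom_ring R S h
  by (rule ring_hom_ringI2[OF R.ring_axioms S.ring_axioms ring_hom])

abbreviation I where "I \<equiv> a_kernel R S h"

lemma kernel_ideal: "ideal I R" by (rule h.kernel_is_ideal)

lemma zero_mem_max: "\<zero>\<^bsub>S\<^esub> \<in> max_ideal S"
  by (rule additive_subgroup.zero_closed[OF ideal.axioms(1)[OF S.max_ideal_ideal]])

lemma mem_max_if_image:
  assumes a: "a \<in> carrier R" "h a \<in> max_ideal S"
  shows "a \<in> max_ideal R"
proof (rule R.mem_max_ideal_if_not_unit[OF a(1)])
  show "a \<notin> Units R"
  proof
    assume u: "a \<in> Units R"
    have "h (inv a) \<otimes>\<^bsub>S\<^esub> h a = \<one>\<^bsub>S\<^esub>"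
      using h.hom_mult[OF R.Units_inv_closed[OF u] a(1)] R.Units_l_inv[OF u] by simp
    moreover have "h (inv a) \<otimes>\<^bsub>S\<^esub> h a \<in> max_ideal S"
      by (rule ideal.I_l_closed[OF S.max_ideal_ideal a(2) h.hom_closed[OF R.Units_inv_closed[OF u]]])
    ultimately show False using S.one_notin_max_ideal by simp
  qed
qed

lemma kernel_subset_max: "I \<subseteq> max_ideal R"
proof
  fix a assume a: "a \<in> I"
  show "a \<in> max_ideal R"
    by (rule mem_max_if_image[OF a_kernelD(1)[OF a]]) (simp only: a_kernelD(2)[OF a] zero_mem_max)
qed

text \<open>The kernel lies in the maximal ideal, so a unit of \<open>S\<close> has only units as preimages.\<close>

lemma max_ideal_image: "h ` max_ideal R = max_ideal S"
proof (intro equalityI subsetI)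
  fix y assume y: "y \<in> max_ideal S"
  then have "y \<in> h ` carrier R" unfolding surj using ideal.Icarr[OF S.max_ideal_ideal] by blast
  then obtain a where a: "a \<in> carrier R" "y = h a" by (elim imageE)
  then show "y \<in> h ` max_ideal R" using mem_max_if_image y by blast
next
  fix y assume "y \<in> h ` max_ideal R"
  then obtain a where a: "a \<in> max_ideal R" "y = h a" by (elim imageE)
  have ac: "a \<in> carrier R" using a(1) ideal.Icarr[OF R.max_ideal_ideal] by blast
  show "y \<in> max_ideal S"
  proof (rule S.mem_max_ideal_if_not_unit)
    show "y \<in> carrier S" unfolding a(2) by (rule h.hom_closed[OF ac])
    show "y \<notin> Units S"
    proof
      assume u: "y \<in> Units S"
      have "inv\<^bsub>S\<^esub> y \<in> h ` carrier R" unfolding surj by (rule S.Units_inv_closed[OF u])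
      then obtain b where b: "b \<in> carrier R" "inv\<^bsub>S\<^esub> y = h b" by (elim imageE)
      have "h (b \<otimes> a) = \<one>\<^bsub>S\<^esub>"
        unfolding h.hom_mult[OF b(1) ac] b(2)[symmetric] a(2)[symmetric] by (rule S.Units_l_inv[OF u])
      then have "h (\<one> \<ominus> b \<otimes> a) = \<zero>\<^bsub>S\<^esub>"
        using ac b(1) by (simp add: a_minus_def S.r_neg)
      then have "\<one> \<ominus> b \<otimes> a \<in> max_ideal R"
        by (rule subsetD[OF kernel_subset_max a_kernelI[OF R.minus_closed[OF R.one_closed R.m_closed[OF b(1) ac]]]])
      then have "(\<one> \<ominus> b \<otimes> a) \<oplus> b \<otimes> a \<in> max_ideal R"
        by (rule additive_subgroup.a_closed[OF ideal.axioms(1)[OF R.max_ideal_ideal]])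
          (rule ideal.I_l_closed[OF R.max_ideal_ideal a(1) b(1)])
      then have "\<one> \<in> max_ideal R"
        using R.diff_add_cancel[OF R.one_closed R.m_closed[OF b(1) ac]] by simp
      then show False using R.one_notin_max_ideal by simp
    qed
  qed
qed

lemma ideal_prod_image:
  assumes A: "A \<subseteq> carrier R" and B: "B \<subseteq> carrier R"
  shows "h ` (A \<cdot>\<^bsub>R\<^esub> B) = (h ` A) \<cdot>\<^bsub>S\<^esub> (h ` B)"
proof (intro equalityI subsetI)
  have cl: "x \<in> carrier R" if "x \<in> A \<cdot>\<^bsub>R\<^esub> B" for x
    using that by (induction rule: ideal_prod.induct) (use A B in blast)+
  fix y assume "y \<in> h ` (A \<cdot>\<^bsub>R\<^esub> B)"
  then obtain x where x: "x \<in> A \<cdot>\<^bsub>R\<^esub> B" "y = h x" by (elim imageE)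
  from x(1) have "h x \<in> (h ` A) \<cdot>\<^bsub>S\<^esub> (h ` B)"
  proof (induction rule: ideal_prod.induct)
    case (prod i j)
    then have "i \<in> carrier R" "j \<in> carrier R" using A B by blast+
    then show ?case using prod by (simp add: ideal_prod.prod)
  next
    case (sum s1 s2)
    then show ?case using cl by (simp add: ideal_prod.sum)
  qed
  then show "y \<in> (h ` A) \<cdot>\<^bsub>S\<^esub> (h ` B)" unfolding x(2) .
next
  have cl: "x \<in> carrier R" if "x \<in> A \<cdot>\<^bsub>R\<^esub> B" for x
    using that by (induction rule: ideal_prod.induct) (use A B in blast)+
  fix y assume "y \<in> (h ` A) \<cdot>\<^bsub>S\<^esub> (h ` B)"
  then show "y \<in> h ` (A \<cdot>\<^bsub>R\<^esub> B)"
  proof (induction rule: ideal_prod.induct)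
    case (prod i j)
    then obtain a b where ab: "a \<in> A" "b \<in> B" "i = h a" "j = h b" by (elim imageE)
    then have "i \<otimes>\<^bsub>S\<^esub> j = h (a \<otimes> b)" using A B h.hom_mult by (simp add: subset_iff)
    then show ?case using ideal_prod.prod[OF ab(1,2)] by (rule image_eqI)
  next
    case (sum s1 s2)
    from sum.IH obtain a b where ab: "a \<in> A \<cdot>\<^bsub>R\<^esub> B" "b \<in> A \<cdot>\<^bsub>R\<^esub> B" "s1 = h a" "s2 = h b" by (elim imageE)
    then have "s1 \<oplus>\<^bsub>S\<^esub> s2 = h (a \<oplus> b)" using cl by simp
    then show ?case using ideal_prod.sum[OF ab(1,2)] by (rule image_eqI)
  qed
qed

lemma mpow_image: "h ` mpow R s = mpow S s"
proof (induction s)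
  case 0 show ?case by (simp add: surj)
next
  case (Suc s)
  have "mpow R s \<subseteq> carrier R" using R.mpow_carrier by blast
  moreover have "max_ideal R \<subseteq> carrier R" using ideal.Icarr[OF R.max_ideal_ideal] by blast
  ultimately show ?case unfolding ideal_power_Suc by (simp only: ideal_prod_image Suc max_ideal_image)
qed

definition pv :: "nat \<Rightarrow> (nat \<Rightarrow> 'a) \<Rightarrow> (nat \<Rightarrow> 'c)" where
  "pv n v = (\<lambda>i\<in>{..<n}. h (v i))"

lemma pv_mem: "v \<in> vecs n J \<Longrightarrow> pv n v \<in> vecs n (h ` J)"
  by (auto simp: pv_def PiE_iff)

lemma pv_surj:
  assumes "y \<in> vecs n (h ` J)"
  obtains v where "v \<in> vecs n J" "pv n v = y"
proof -
  have "\<forall>i\<in>{..<n}. \<exists>a. a \<in> J \<and> y i = h a" using assms by (auto simp: PiE_iff)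
  then obtain f where f: "\<forall>i\<in>{..<n}. f i \<in> J \<and> y i = h (f i)" by (rule bchoice[elim_format]) blast
  show thesis
  proof (rule that)
    show "restrict f {..<n} \<in> vecs n J" using f by auto
    show "pv n (restrict f {..<n}) = y"
      by (rule vec_eqI[of _ n "h ` J" _ "h ` J"]) (use f assms in \<open>auto simp: pv_def\<close>)
  qed
qed

lemma pv_V: "v \<in> R.V n s \<Longrightarrow> pv n v \<in> S.V n s"
  using pv_mem[of v n "mpow R s"] by (simp only: mpow_image)

lemma pv_V_surj:
  assumes "y \<in> S.V n s"
  obtains v where "v \<in> R.V n s" "pv n v = y"
  using pv_surj[of y n "mpow R s"] assms unfolding mpow_image by blast

lemma pv_Fr: "v \<in> carrier (R.Fr n) \<Longrightarrow> pv n v \<in> carrier (S.Fr n)"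
  using pv_V[of v n 0] by simp

lemma pv_Fr_surj:
  assumes "y \<in> carrier (S.Fr n)"
  obtains v where "v \<in> carrier (R.Fr n)" "pv n v = y"
proof -
  have "y \<in> S.V n 0" using assms by simp
  then show thesis by (rule pv_V_surj) (rule that, simp_all)
qed

lemma pv_add:
  "u \<in> carrier (R.Fr n) \<Longrightarrow> v \<in> carrier (R.Fr n) \<Longrightarrow> pv n (u \<oplus>\<^bsub>R.Fr n\<^esub> v) = pv n u \<oplus>\<^bsub>S.Fr n\<^esub> pv n v"
  by (auto simp: pv_def free_module_simps PiE_iff intro!: restrict_ext)

lemma pv_smult:
  "a \<in> carrier R \<Longrightarrow> v \<in> carrier (R.Fr n) \<Longrightarrow> pv n (a \<odot>\<^bsub>R.Fr n\<^esub> v) = h a \<odot>\<^bsub>S.Fr n\<^esub> pv n v"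
  by (auto simp: pv_def free_module_simps PiE_iff intro!: restrict_ext)

lemma pv_eq_iff:
  assumes u: "u \<in> carrier (R.Fr n)" and v: "v \<in> carrier (R.Fr n)"
  shows "pv n u = pv n v \<longleftrightarrow> u \<ominus>\<^bsub>R.Fr n\<^esub> v \<in> vecs n I"
proof -
  have u': "u i \<in> carrier R" and v': "v i \<in> carrier R" if "i < n" for i using u v that by auto
  have "h (u i) = h (v i) \<longleftrightarrow> u i \<ominus> v i \<in> I" if i: "i < n" for i
  proof -
    have "h (u i \<ominus> v i) = h (u i) \<ominus>\<^bsub>S\<^esub> h (v i)" using u'[OF i] v'[OF i] by (simp add: a_minus_def)
    moreover have "u i \<ominus> v i \<in> carrier R" using u'[OF i] v'[OF i] by simp
    ultimately have "u i \<ominus> v i \<in> I \<longleftrightarrow> h (u i) \<ominus>\<^bsub>S\<^esub> h (v i) = \<zero>\<^bsub>S\<^esub>"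
      unfolding mem_a_kernel by simp
    also have "\<dots> \<longleftrightarrow> h (u i) = h (v i)"
      by (rule S.r_right_minus_eq[OF h.hom_closed[OF u'[OF i]] h.hom_closed[OF v'[OF i]]])
    finally show ?thesis by blast
  qed
  then show ?thesis
    using u v by (auto simp: pv_def R.free_module_minus restrict_def fun_eq_iff PiE_iff extensional_def)
qed

lemma pv_zero: "pv n \<zero>\<^bsub>R.Fr n\<^esub> = \<zero>\<^bsub>S.Fr n\<^esub>"
  by (auto simp: pv_def free_module_simps intro!: restrict_ext)

lemma pv_zero_iff:
  assumes u: "u \<in> carrier (R.Fr n)"
  shows "pv n u = \<zero>\<^bsub>S.Fr n\<^esub> \<longleftrightarrow> u \<in> vecs n I"
  unfolding pv_zero[symmetric] pv_eq_iff[OF u R.Fr.M.zero_closed] R.Fr.M.diff_zero[OF u] ..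

lemma induced_hom:
  assumes w: "w \<in> R.Hom c b"
  obtains w' where "w' \<in> S.Hom c b" "\<And>x. x \<in> carrier (R.Fr c) \<Longrightarrow> w' (pv c x) = pv b (w x)"
proof -
  define lft where "lft y = (SOME v. v \<in> carrier (R.Fr c) \<and> pv c v = y)" for y
  define w' where "w' y = pv b (w (lft y))" for y
  have l: "lft (pv c x) \<in> carrier (R.Fr c)" "pv c (lft (pv c x)) = pv c x" if "x \<in> carrier (R.Fr c)" for x
    using someI[of "\<lambda>v. v \<in> carrier (R.Fr c) \<and> pv c v = pv c x" x] that unfolding lft_def by blast+
  have wc: "w x \<in> carrier (R.Fr b)" if "x \<in> carrier (R.Fr c)" for x by (rule module_hom_closed[OF w that])
  have eq: "w' (pv c x) = pv b (w x)" if x: "x \<in> carrier (R.Fr c)" for x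
  proof -
    have "lft (pv c x) \<ominus>\<^bsub>R.Fr c\<^esub> x \<in> vecs c I" using l[OF x] pv_eq_iff[OF l(1)[OF x] x] by simp
    then have "w (lft (pv c x) \<ominus>\<^bsub>R.Fr c\<^esub> x) \<in> vecs b I" by (rule R.hom_vec_ideal[OF kernel_ideal w])
    then have "w (lft (pv c x)) \<ominus>\<^bsub>R.Fr b\<^esub> w x \<in> vecs b I"
      unfolding module_hom_minus[OF R.Fr R.Fr w l(1)[OF x] x] .
    then show ?thesis unfolding w'_def using pv_eq_iff[OF wc[OF l(1)[OF x]] wc[OF x]] by simp
  qed
  have "w' \<in> S.Hom c b"
  proof (rule module_homI)
    show "w' y \<in> carrier (S.Fr b)" if y: "y \<in> carrier (S.Fr c)" for y
    proof -
      obtain x where x: "x \<in> carrier (R.Fr c)" "pv c x = y" by (rule pv_Fr_surj[OF y])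
      show ?thesis unfolding x(2)[symmetric] eq[OF x(1)] by (rule pv_Fr[OF wc[OF x(1)]])
    qed
    show "w' (y \<oplus>\<^bsub>S.Fr c\<^esub> z) = w' y \<oplus>\<^bsub>S.Fr b\<^esub> w' z"
      if y: "y \<in> carrier (S.Fr c)" and z: "z \<in> carrier (S.Fr c)" for y z
    proof -
      obtain x where x: "x \<in> carrier (R.Fr c)" "pv c x = y" by (rule pv_Fr_surj[OF y])
      obtain u where u: "u \<in> carrier (R.Fr c)" "pv c u = z" by (rule pv_Fr_surj[OF z])
      show ?thesis
        unfolding x(2)[symmetric] u(2)[symmetric] pv_add[OF x(1) u(1), symmetric] eq[OF x(1)] eq[OF u(1)]
          eq[OF R.Fr.M.a_closed[OF x(1) u(1)]] module_hom_add[OF w x(1) u(1)]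
        by (rule pv_add[OF wc[OF x(1)] wc[OF u(1)]])
    qed
    show "w' (r \<odot>\<^bsub>S.Fr c\<^esub> y) = r \<odot>\<^bsub>S.Fr b\<^esub> w' y" if r: "r \<in> carrier S" and y: "y \<in> carrier (S.Fr c)" for r y
    proof -
      obtain x where x: "x \<in> carrier (R.Fr c)" "pv c x = y" by (rule pv_Fr_surj[OF y])
      obtain a where a: "a \<in> carrier R" "r = h a" using r unfolding surj[symmetric] by (elim imageE)
      show ?thesis
        unfolding x(2)[symmetric] a(2) pv_smult[OF a(1) x(1), symmetric] eq[OF x(1)]
          eq[OF R.Fr.smult_closed[OF a(1) x(1)]] module_hom_smult[OF w a(1) x(1)]
        by (rule pv_smult[OF a(1) wc[OF x(1)]])
    qed
  qed
  then show thesis by (rule that) (rule eq)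
qed

text \<open>Change of rings. The first syzygy module of \<open>R\<^sup>b/B\<close> over \<open>S\<close> is \<open>B/I\<^sup>b\<close>. Minimal generators of \<open>I\<^sup>b\<close> are extended
  by \<open>w\<close> to minimal generators of \<open>B\<close>. The reduction of \<open>w\<close> covers \<open>B/I\<^sup>b\<close> over \<open>S\<close>, and its kernel is the reduction of
  the syzygy module \<open>C\<close> of \<open>B/I\<^sup>b\<close> over \<open>R\<close>, which is linear as a quotient and contains
  the vectors with entries in \<open>I\<close>. So \<open>C\<close> can take the place of \<open>B\<close>.\<close>

lemma linear_syz_image:
  assumes linI: "\<And>n. linear_syz R n 1 (vecs 1 I)"
  shows "submodule B R (R.Fr b) \<Longrightarrow> (vecs b I) \<subseteq> B \<Longrightarrow> B \<subseteq> R.V b (Suc 0) \<Longrightarrow>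
    (\<And>n. linear_syz R n b B) \<Longrightarrow> linear_syz S n b (pv b ` B)"
proof (induction n arbitrary: b B)
  case (Suc n)
  note B = Suc.prems(1) and AB = Suc.prems(2) and BV = Suc.prems(3) and linB = Suc.prems(4)
  let ?A = "vecs b I"
  have linA: "linear_syz R k b ?A" for k
    by (rule R.linear_syz_power[OF kernel_ideal kernel_subset_max linI])
  have A: "submodule ?A R (R.Fr b)" by (rule R.vec_ideal_submodule[OF kernel_ideal])
  obtain c z where z: "z \<in> R.Hom c b" "z ` carrier (R.Fr c) = ?A" "R.Ker c b z \<subseteq> R.V c (Suc 0)"
    by (rule R.minimal_cover[OF A R.vec_V1[OF kernel_subset_max]])
  have zB: "z ` carrier (R.Fr c) \<subseteq> B" unfolding z(2) by (rule AB)
  note zlin = R.linear_syz_SucD(1)[OF linA z(1,2)]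
  have ex: "\<exists>y \<in> R.V c (Suc 0). z y = z x" if "x \<in> carrier (R.Fr c)" "z x \<in> R.V b (Suc (Suc 0))" for x
    using R.linear_coverD[OF zlin that] by blast
  obtain c' w where w: "w \<in> R.Hom c' b" "w ` carrier (R.Fr c') \<subseteq> B"
    "R.join (R.Fr b) c c' z w ` carrier (R.Fr (c + c')) = B"
    "R.Ker (c + c') b (R.join (R.Fr b) c c' z w) \<subseteq> R.V (c + c') (Suc 0)"
    by (rule R.minimal_extension[OF z(1) zB z(3) ex B BV])
  define C where "C = {x \<in> carrier (R.Fr c'). w x \<in> ?A}"
  have linC: "linear_syz R k c' C" for k
    unfolding C_def by (rule R.linear_syz_quotient[OF B BV z w linA linB])
  have C: "submodule C R (R.Fr c')" unfolding C_def by (rule module_hom_vimage_submodule[OF R.Fr R.Fr w(1) A])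
  have AC: "(vecs c' I) \<subseteq> C"
    unfolding C_def using R.hom_vec_ideal[OF kernel_ideal w(1)] R.vec_ideal_carrier[OF kernel_ideal]
    unfolding free_module_simps(1) by blast
  have "C = hi c c' ` R.Ker (c + c') b (R.join (R.Fr b) c c' z w)"
    unfolding C_def R.kernel_join_hi[OF z(1) w(1)] z(2) ..
  also have "\<dots> \<subseteq> R.V c' (Suc 0)" using w(4) R.hi_V by blast
  finally have CV: "C \<subseteq> R.V c' (Suc 0)" .
  have IH: "linear_syz S n c' (pv c' ` C)" by (rule Suc.IH[OF C AC CV linC])
  obtain w' where w': "w' \<in> S.Hom c' b" "\<And>x. x \<in> carrier (R.Fr c') \<Longrightarrow> w' (pv c' x) = pv b (w x)"
    by (rule induced_hom[OF w(1)]) (rule that)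
  have wc: "w x \<in> carrier (R.Fr b)" if "x \<in> carrier (R.Fr c')" for x by (rule module_hom_closed[OF w(1) that])
  have zA: "z a \<in> ?A" if "a \<in> carrier (R.Fr c)" for a unfolding z(2)[symmetric] by (rule imageI[OF that])
  have zc: "z a \<in> carrier (R.Fr b)" if "a \<in> carrier (R.Fr c)" for a by (rule module_hom_closed[OF z(1) that])
  define D where "D = R.join (R.Fr b) c c' z w"
  have D: "D \<in> R.Hom (c + c') b" unfolding D_def by (rule R.hom_join_Fr[OF z(1) w(1)])
  have DB: "D ` carrier (R.Fr (c + c')) = B" unfolding D_def by (rule w(3))
  note Dlin = R.linear_syz_SucD(1)[OF linB D DB]
  have pvD: "pv b (D v) = w' (pv c' (hi c c' v))" if v: "v \<in> carrier (R.Fr (c + c'))" for v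
  proof -
    note lv = R.lo_Fr[OF v] and hv = R.hi_Fr[OF v]
    have "pv b (D v) = pv b (z (lo c v)) \<oplus>\<^bsub>S.Fr b\<^esub> pv b (w (hi c c' v))"
      unfolding D_def R.join_def by (rule pv_add[OF zc[OF lv] wc[OF hv]])
    also have "pv b (z (lo c v)) = \<zero>\<^bsub>S.Fr b\<^esub>" using pv_zero_iff[OF zc[OF lv]] zA[OF lv] by simp
    also have "\<zero>\<^bsub>S.Fr b\<^esub> \<oplus>\<^bsub>S.Fr b\<^esub> pv b (w (hi c c' v)) = pv b (w (hi c c' v))"
      by (rule S.Fr.M.l_zero[OF pv_Fr[OF wc[OF hv]]])
    also have "\<dots> = w' (pv c' (hi c c' v))" by (rule w'(2)[OF hv, symmetric])
    finally show ?thesis .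
  qed
  have im: "w' ` carrier (S.Fr c') = pv b ` B"
  proof (intro equalityI subsetI)
    fix y assume "y \<in> w' ` carrier (S.Fr c')"
    then obtain u where u: "u \<in> carrier (S.Fr c')" "y = w' u" by (elim imageE)
    obtain x where x: "x \<in> carrier (R.Fr c')" "pv c' x = u" by (rule pv_Fr_surj[OF u(1)])
    have "w x \<in> B" using w(2) x(1) by blast
    then show "y \<in> pv b ` B" unfolding u(2) x(2)[symmetric] w'(2)[OF x(1)] by (rule imageI)
  next
    fix y assume "y \<in> pv b ` B"
    then obtain x where x: "x \<in> B" "y = pv b x" by (elim imageE)
    from x(1) obtain v where v: "v \<in> carrier (R.Fr (c + c'))" "x = D v" unfolding DB[symmetric] by (elim imageE)
    show "y \<in> w' ` carrier (S.Fr c')"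
      unfolding x(2) v(2) pvD[OF v(1)] by (rule imageI[OF pv_Fr[OF R.hi_Fr[OF v(1)]]])
  qed
  have "linear_cover S c' b w'"
  proof (rule S.linear_coverI)
    fix s u assume u: "u \<in> carrier (S.Fr c')" and wu: "w' u \<in> S.V b (Suc s)"
    obtain x where x: "x \<in> carrier (R.Fr c')" "pv c' x = u" by (rule pv_Fr_surj[OF u])
    obtain v where v: "v \<in> R.V b (Suc s)" "pv b v = w' u" by (rule pv_V_surj[OF wu])
    have vc: "v \<in> carrier (R.Fr b)" by (rule R.Fr_carrier_V[OF v(1)])
    have wx: "w x \<in> B" using w(2) x(1) by blast
    have "pv b v = pv b (w x)" unfolding v(2) x(2)[symmetric] by (rule w'(2)[OF x(1)])
    then have "v \<ominus>\<^bsub>R.Fr b\<^esub> w x \<in> B" using pv_eq_iff[OF vc wc[OF x(1)]] AB by blast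
    then have "(v \<ominus>\<^bsub>R.Fr b\<^esub> w x) \<oplus>\<^bsub>R.Fr b\<^esub> w x \<in> B" by (rule R.Fr.submoduleE(5)[OF B _ wx])
    then have "v \<in> B" unfolding R.Fr.M.diff_add_cancel[OF vc wc[OF x(1)]] .
    then obtain t0 where t0: "t0 \<in> carrier (R.Fr (c + c'))" "v = D t0" unfolding DB[symmetric] by (elim imageE)
    have "D t0 \<in> R.V b (Suc s)" using v(1) unfolding t0(2) .
    from R.linear_coverD[OF Dlin t0(1) this] obtain t where t: "t \<in> R.V (c + c') s" "D t = D t0" .
    have "w' (pv c' (hi c c' t)) = w' u"
      unfolding v(2)[symmetric] t0(2) t(2)[symmetric] by (rule pvD[OF R.Fr_carrier_V[OF t(1)], symmetric])
    moreover have "pv c' (hi c c' t) \<in> S.V c' s" by (rule pv_V[OF R.hi_V[OF t(1)]])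
    ultimately show "\<exists>y\<in>S.V c' s. w' y = w' u" by (rule bexI)
  qed
  moreover have "S.Ker c' b w' = pv c' ` C"
  proof (intro equalityI subsetI)
    fix u assume u: "u \<in> S.Ker c' b w'"
    note u' = a_kernelD[OF u]
    obtain x where x: "x \<in> carrier (R.Fr c')" "pv c' x = u" by (rule pv_Fr_surj[OF u'(1)])
    have "pv b (w x) = \<zero>\<^bsub>S.Fr b\<^esub>" using u'(2) w'(2)[OF x(1)] unfolding x(2) by simp
    then have "x \<in> C" unfolding C_def using pv_zero_iff[OF wc[OF x(1)]] x(1) by blast
    then show "u \<in> pv c' ` C" unfolding x(2)[symmetric] by (rule imageI)
  next
    fix u assume "u \<in> pv c' ` C"
    then obtain x where x: "x \<in> carrier (R.Fr c')" "w x \<in> ?A" "u = pv c' x" unfolding C_def by (elim imageE CollectE conjE)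
    have "pv b (w x) = \<zero>\<^bsub>S.Fr b\<^esub>" using pv_zero_iff[OF wc[OF x(1)]] x(2) by simp
    then show "u \<in> S.Ker c' b w'" unfolding x(3) w'(2)[OF x(1), symmetric] by (rule a_kernelI[OF pv_Fr[OF x(1)]])
  qed
  ultimately show ?case using S.linear_syz_SucI[OF w'(1) im] IH by simp
qed simp

end

context noeth_local
begin

text \<open>Ideals of \<open>R/I\<close> are images of their preimages: generators are obtained from generators of the preimage, and
  the preimage of a proper ideal contains no units.\<close>

lemma quotient_noeth_local:
  assumes I: "ideal I R" "I \<subseteq> max_ideal R"
  shows "noeth_local (R Quot I)"
proof -
  interpret I: ideal I R by (rule I(1))
  let ?S = "R Quot I" and ?h = "(+>) I"
  have S: "cring ?S" by (rule I.quotient_is_cring[OF is_cring])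
  interpret S: cring ?S by (rule S)
  interpret q: ring_hom_ring R ?S ?h by (rule I.rcos_ring_hom_ring)
  have surj: "carrier ?S = ?h ` carrier R" unfolding FactRing_def A_RCOSETS_def' by auto
  have ker: "a \<in> I" if "a \<in> carrier R" "?h a = \<zero>\<^bsub>?S\<^esub>" for a
    using that I.a_rcos_const I.rcos_const_imp_mem unfolding FactRing_def
    by (metis I.a_rcos_self ring_record_simps(11))
  have vim: "ideal {a \<in> carrier R. ?h a \<in> J} R" if "ideal J ?S" for J
    by (rule q.ideal_vimage[OF that])
  have img: "?h ` {a \<in> carrier R. ?h a \<in> J} = J" if "ideal J ?S" for J
  proof (intro equalityI subsetI)
    fix y assume y: "y \<in> J"
    then have "y \<in> ?h ` carrier R" unfolding surj[symmetric] by (rule ideal.Icarr[OF that])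
    then obtain a where "a \<in> carrier R" "y = ?h a" by (elim imageE)
    with y show "y \<in> ?h ` {a \<in> carrier R. ?h a \<in> J}" by blast
  qed blast
  have noeth: "noetherian_ring ?S"
  proof (rule S.noetherian_ringI)
    fix J assume J: "ideal J ?S"
    obtain A where A: "A \<subseteq> carrier R" "finite A" "{a \<in> carrier R. ?h a \<in> J} = Idl A"
      using finetely_gen[OF vim[OF J]] by blast
    have hA: "?h ` A \<subseteq> carrier ?S" using A(1) surj by blast
    have "J = Idl\<^bsub>?S\<^esub> (?h ` A)"
    proof
      have "A \<subseteq> {a \<in> carrier R. ?h a \<in> Idl\<^bsub>?S\<^esub> (?h ` A)}"
        using S.genideal_self[OF hA] A(1) by blast
      then have "Idl A \<subseteq> {a \<in> carrier R. ?h a \<in> Idl\<^bsub>?S\<^esub> (?h ` A)}"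
        by (rule genideal_minimal[OF vim[OF S.genideal_ideal[OF hA]]])
      then have "?h ` {a \<in> carrier R. ?h a \<in> J} \<subseteq> Idl\<^bsub>?S\<^esub> (?h ` A)" unfolding A(3) by blast
      then show "J \<subseteq> Idl\<^bsub>?S\<^esub> (?h ` A)" unfolding img[OF J] .
      have "A \<subseteq> {a \<in> carrier R. ?h a \<in> J}" unfolding A(3) by (rule genideal_self[OF A(1)])
      then have "?h ` A \<subseteq> J" by blast
      then show "Idl\<^bsub>?S\<^esub> (?h ` A) \<subseteq> J" by (rule S.genideal_minimal[OF J])
    qed
    then show "\<exists>A\<subseteq>carrier ?S. finite A \<and> J = Idl\<^bsub>?S\<^esub> A" using A(2) hA by blast
  qed
  let ?M = "?h ` max_ideal R"
  have M: "ideal ?M ?S" by (rule ring_ideal_imp_quot_ideal[OF I(1) max_ideal_ideal])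
  have one: "\<one>\<^bsub>?S\<^esub> \<notin> ?M"
  proof
    assume "\<one>\<^bsub>?S\<^esub> \<in> ?M"
    then obtain a where a: "a \<in> max_ideal R" "?h \<one> = ?h a" unfolding q.hom_one by (elim imageE)
    have ac: "a \<in> carrier R" using a(1) ideal.Icarr[OF max_ideal_ideal] by blast
    have "?h (\<one> \<ominus> a) = \<zero>\<^bsub>?S\<^esub>" using ac a(2) q.hom_closed[OF ac] by (simp add: a_minus_def S.r_neg del: q.hom_one)
    then have "\<one> \<ominus> a \<in> max_ideal R" using ker[of "\<one> \<ominus> a"] ac I(2) by auto
    then have "(\<one> \<ominus> a) \<oplus> a \<in> max_ideal R"
      by (rule additive_subgroup.a_closed[OF ideal.axioms(1)[OF max_ideal_ideal] _ a(1)])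
    then show False using diff_add_cancel[OF one_closed ac] one_notin_max_ideal by simp
  qed
  have sub: "J \<subseteq> ?M" if J: "ideal J ?S" "J \<noteq> carrier ?S" for J
  proof -
    have "\<one>\<^bsub>?S\<^esub> \<notin> J" using ideal.one_imp_carrier[OF J(1)] J(2) by blast
    have "a \<in> max_ideal R" if a: "a \<in> carrier R" "?h a \<in> J" for a
    proof (rule mem_max_ideal_if_not_unit[OF a(1)])
      show "a \<notin> Units R"
      proof
        assume u: "a \<in> Units R"
        have "?h (inv a) \<otimes>\<^bsub>?S\<^esub> ?h a \<in> J"
          by (rule ideal.I_l_closed[OF J(1) a(2) q.hom_closed[OF Units_inv_closed[OF u]]])
        then show False
          using q.hom_mult[OF Units_inv_closed[OF u] a(1)] Units_l_inv[OF u] \<open>\<one>\<^bsub>?S\<^esub> \<notin> J\<close> by simp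
      qed
    qed
    then have "?h ` {a \<in> carrier R. ?h a \<in> J} \<subseteq> ?M" by blast
    then show ?thesis unfolding img[OF J(1)] .
  qed
  have Mmax: "maximalideal ?M ?S"
  proof (rule maximalidealI[OF M])
    show "carrier ?S \<noteq> ?M" using one S.one_closed by metis
    show "J = ?M \<or> J = carrier ?S" if "ideal J ?S" "?M \<subseteq> J" "J \<subseteq> carrier ?S" for J
      using sub[OF that(1)] that(2) by blast
  qed
  have "\<exists>!\<mm>. maximalideal \<mm> ?S"
  proof (rule ex1I[of _ ?M], rule Mmax)
    fix J assume J: "maximalideal J ?S"
    have Ji: "ideal J ?S" by (rule maximalideal.axioms(1)[OF J])
    have "J \<subseteq> ?M" by (rule sub[OF Ji]) (use maximalideal.I_notcarr[OF J] in blast)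
    moreover have "?M \<subseteq> carrier ?S" using ideal.Icarr[OF M] by blast
    ultimately have "?M = J \<or> ?M = carrier ?S" by (rule maximalideal.I_maximal[OF J M])
    then show "J = ?M" using one S.one_closed by metis
  qed
  then show ?thesis using S noeth by (intro noeth_local.intro noeth_local_axioms.intro)
qed

lemma quotient_surj_local:
  assumes I: "ideal I R" "I \<subseteq> max_ideal R"
  shows "surj_local R (R Quot I) ((+>) I)" "a_kernel R (R Quot I) ((+>) I) = I"
proof -
  interpret I: ideal I R by (rule I(1))
  show "surj_local R (R Quot I) ((+>) I)"
    by (intro surj_local.intro noeth_local_axioms quotient_noeth_local[OF I] surj_local_axioms.intro I.rcos_ring_hom)
      (auto simp: FactRing_def A_RCOSETS_def')
  show "a_kernel R (R Quot I) ((+>) I) = I"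
  proof (intro equalityI subsetI)
    fix a assume "a \<in> a_kernel R (R Quot I) ((+>) I)"
    then have a: "a \<in> carrier R" "I +> a = I" by (simp_all add: mem_a_kernel FactRing_def)
    show "a \<in> I" using I.a_rcos_self[OF a(1)] unfolding a(2) .
  next
    fix a assume a: "a \<in> I"
    then show "a \<in> a_kernel R (R Quot I) ((+>) I)"
      using I.Icarr[OF a] I.a_rcos_const[OF a] by (simp add: mem_a_kernel FactRing_def)
  qed
qed

theorem koszul_filtration_quotient_linear_syz:
  assumes \<F>: "koszul_filtration R \<F>" and I: "I \<in> \<F>"
  shows "linear_syz (R Quot I) n 1 (vecs 1 (max_ideal (R Quot I)))"
proof -
  note F = koszul_filtrationD[OF \<F>]
  note Im = koszul_filtration_subset_max_ideal[OF \<F> I]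
  interpret q: surj_local R "R Quot I" "(+>) I" by (rule quotient_surj_local(1)[OF F(1)[OF I] Im])
  note ker = quotient_surj_local(2)[OF F(1)[OF I] Im]
  have "linear_syz (R Quot I) n 1 (q.pv 1 ` (vecs 1 (max_ideal R)))"
  proof (rule q.linear_syz_image)
    show "linear_syz R k 1 (vecs 1 q.I)" for k unfolding ker by (rule koszul_filtration_linear_syz[OF \<F> I])
    show "linear_syz R k 1 (vecs 1 (max_ideal R))" for k by (rule koszul_filtration_linear_syz[OF \<F> F(3)])
    show "(vecs 1 q.I) \<subseteq> vecs 1 (max_ideal R)" unfolding ker by (rule PiE_mono[OF Im])
  qed (rule vec_ideal_submodule[OF max_ideal_ideal], rule vec_V1[OF subset_refl])
  also have "q.pv 1 ` (vecs 1 (max_ideal R)) = vecs 1 (max_ideal (R Quot I))"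
  proof (intro equalityI subsetI)
    fix y assume "y \<in> q.pv 1 ` (vecs 1 (max_ideal R))"
    then show "y \<in> vecs 1 (max_ideal (R Quot I))" using q.pv_mem unfolding q.max_ideal_image[symmetric] by blast
  next
    fix y assume "y \<in> vecs 1 (max_ideal (R Quot I))"
    then obtain v where "v \<in> vecs 1 (max_ideal R)" "q.pv 1 v = y"
      unfolding q.max_ideal_image[symmetric] by (rule q.pv_surj)
    then show "y \<in> q.pv 1 ` (vecs 1 (max_ideal R))" by blast
  qed
  finally show ?thesis .
qed

end

section \<open>The linear part of a resolution\<close>

lemma (in group) trivial_group_self_quotient:
  assumes Z: "subgroup Z G"
  shows "trivial_group (G\<lparr>carrier := Z\<rparr> Mod Z)"
proof -
  let ?Z = "G\<lparr>carrier := Z\<rparr>"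
  have Zg: "group ?Z" by (rule subgroup_imp_group[OF Z])
  have "carrier ?Z \<lhd> ?Z" by (rule group.normal_self[OF Zg])
  then have n: "Z \<lhd> ?Z" by simp
  have "group (?Z Mod Z)" by (rule normal.factorgroup_is_group[OF n])
  moreover have "Z #>\<^bsub>?Z\<^esub> x = Z" if "x \<in> Z" for x
    using group.coset_join2[OF Zg, of x Z] that group.subgroup_self[OF Zg] by simp
  then have "carrier (?Z Mod Z) = {\<one>\<^bsub>?Z Mod Z\<^esub>}"
    using subgroup.one_closed[OF Z] unfolding FactGroup_def RCOSETS_def by auto
  ultimately show ?thesis unfolding trivial_group_def by blast
qed

text \<open>The filtration of a resolution can thus be described by the entries of vectors.\<close>

lemma (in cring) ideal_smult_free_module:
  assumes J: "ideal J R"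
  shows "ideal_smult J (free_module R n) = vecs n J"
proof -
  interpret Fr: module R "free_module R n" by (rule free_module_module)
  have JR: "a \<in> carrier R" if "a \<in> J" for a using ideal.Icarr[OF J that] .
  show ?thesis
  proof (intro equalityI subsetI)
    fix v assume v: "v \<in> ideal_smult J (free_module R n)"
    have "{a \<odot>\<^bsub>free_module R n\<^esub> x | a x. a \<in> J \<and> x \<in> carrier (free_module R n)} \<subseteq> vecs n J"
      using ideal.I_r_closed[OF J] by (auto simp: free_module_simps PiE_iff split: if_splits)
    from Fr.add.generate_subgroup_incl[OF this submodule.axioms(1)[OF vec_ideal_submodule[OF J]]]
    show "v \<in> vecs n J" using v unfolding ideal_smult_def by blast
  next
    fix v assume v: "v \<in> vecs n J"
    show "v \<in> ideal_smult J (free_module R n)"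
    proof (rule hom_mem_subgroup[OF free_module_module module_hom_id _ _ _ v])
      show "J \<subseteq> carrier R" using JR by blast
      show "subgroup (ideal_smult J (free_module R n)) (add_monoid (free_module R n))"
        unfolding ideal_smult_def by (rule Fr.add.generate_is_subgroup) (use JR in blast)
      show "a \<odot>\<^bsub>free_module R n\<^esub> x \<in> ideal_smult J (free_module R n)"
        if "a \<in> J" "x \<in> vecs n (carrier R)" for a x
        unfolding ideal_smult_def by (rule generate.incl) (use that in \<open>simp only: free_module_simps(1), blast\<close>)
    qed
  qed
qed

text \<open>The properties of a resolution that make its linear part acyclic in positive degrees.\<close>

locale linear_resolution = noeth_local R for R (structure) +
  fixes F :: "'a free_complex"
  assumes diff_hom: "\<And>i. cx_diff F i \<in> module_hom R (free_module R (cx_rank F (Suc i))) (free_module R (cx_rank F i))"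
    and exact: "\<And>i. a_kernel (free_module R (cx_rank F (Suc i))) (free_module R (cx_rank F i)) (cx_diff F i)
      = cx_diff F (Suc i) ` carrier (free_module R (cx_rank F (Suc (Suc i))))"
    and minimal: "\<And>i. cx_diff F i ` carrier (free_module R (cx_rank F (Suc i))) \<subseteq> vecs (cx_rank F i) (mpow R (Suc 0))"
    and linear: "\<And>i. linear_cover R (cx_rank F (Suc i)) (cx_rank F i) (cx_diff F i)"
begin

abbreviation "rk \<equiv> cx_rank F"
abbreviation "d \<equiv> cx_diff F"
abbreviation "fl n i \<equiv> V (rk i) (n - i)"
abbreviation "co n i x \<equiv> fl (Suc n) i +>\<^bsub>Fr (rk i)\<^esub> x"

lemma filt_eq: "filt R F n i = fl n i"
  unfolding filt_def cx_module_def by (rule ideal_smult_free_module[OF mpow_ideal])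

lemma fl_Suc: "x \<in> fl (Suc n) i \<Longrightarrow> x \<in> fl n i"
proof (cases "i \<le> n")
  case True
  show "x \<in> fl (Suc n) i \<Longrightarrow> x \<in> fl n i" unfolding Suc_diff_le[OF True] by (rule V_Suc_subset)
qed simp

lemma fl_Fr: "x \<in> fl n i \<Longrightarrow> x \<in> carrier (Fr (rk i))"
  by (rule Fr_carrier_V)

lemma diff_fl: "x \<in> fl n (Suc i) \<Longrightarrow> d i x \<in> fl n i"
proof (cases "n \<le> i")
  case True
  assume "x \<in> fl n (Suc i)"
  then have "d i x \<in> carrier (Fr (rk i))" by (rule module_hom_closed[OF diff_hom fl_Fr])
  then show ?thesis using True by simp
next
  case False
  assume x: "x \<in> fl n (Suc i)"
  have "Suc (n - Suc i) = n - i" using False by simp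
  then show ?thesis using hom_V_Suc[OF diff_hom minimal x] by simp
qed

lemma diff_diff: "x \<in> carrier (Fr (rk (Suc (Suc i)))) \<Longrightarrow> d i (d (Suc i) x) = \<zero>\<^bsub>Fr (rk i)\<^esub>"
  by (rule a_kernelD(2)[of _ "Fr (rk (Suc i))"]) (unfold exact, rule imageI)

lemma fl_subgroup: "subgroup (fl n i) (add_monoid (Fr (rk i)))"
  by (rule submodule.axioms(1)[OF V_submodule])

lemma gr_piece_eq: "gr_piece R F n i = (Fr (rk i))\<lparr>carrier := fl n i\<rparr> A_Mod fl (Suc n) i"
  unfolding gr_piece_def filt_eq cx_module_def ..

lemma fl_abelian_subgroup: "abelian_subgroup (fl (Suc n) i) ((Fr (rk i))\<lparr>carrier := fl n i\<rparr>)"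
proof (rule abelian_subgroupI3)
  let ?G = "(Fr (rk i))\<lparr>carrier := fl n i\<rparr>"
  have am: "add_monoid ?G = (add_monoid (Fr (rk i)))\<lparr>carrier := fl n i\<rparr>" by simp
  show "additive_subgroup (fl (Suc n) i) ?G"
    unfolding additive_subgroup_def am
    by (rule Fr.add.subgroup_incl[OF fl_subgroup fl_subgroup]) (use fl_Suc in blast)
  have "module R ?G" by (rule submodule.submodule_is_module[OF V_submodule Fr])
  then show "abelian_group ?G" by (rule module.axioms(2))
qed

lemma gr_piece_group: "group (gr_piece R F n i)"
  unfolding gr_piece_eq by (rule abelian_subgroup.a_factorgroup_is_group[OF fl_abelian_subgroup])

lemma gr_piece_carrier: "carrier (gr_piece R F n i) = co n i ` fl n i"
  unfolding gr_piece_eq A_FactGroup_def' by (auto simp: A_RCOSETS_def' a_r_coset_def r_coset_def)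

lemma gr_piece_one: "\<one>\<^bsub>gr_piece R F n i\<^esub> = fl (Suc n) i"
  unfolding gr_piece_eq A_FactGroup_def' by simp

lemma gr_piece_mult:
  assumes "x \<in> fl n i" "y \<in> fl n i"
  shows "co n i x \<otimes>\<^bsub>gr_piece R F n i\<^esub> co n i y = co n i (x \<oplus>\<^bsub>Fr (rk i)\<^esub> y)"
proof -
  have "fl (Suc n) i +>\<^bsub>(Fr (rk i))\<lparr>carrier := fl n i\<rparr>\<^esub> z = co n i z" for z by (simp add: a_r_coset_def r_coset_def)
  then show ?thesis
    using abelian_subgroup.a_rcos_sum[OF fl_abelian_subgroup, of x i n y] assms
    unfolding gr_piece_eq add_A_FactGroup by simp
qed

lemma V_abelian_subgroup: "abelian_subgroup (V n s) (Fr n)"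
  by (rule abelian_subgroupI3[OF _ Fr.M.abelian_group_axioms])
    (unfold additive_subgroup_def, rule submodule.axioms(1)[OF V_submodule])

lemma co_eqI:
  assumes "x \<in> carrier (Fr (rk i))" "y \<in> carrier (Fr (rk i))" "x \<ominus>\<^bsub>Fr (rk i)\<^esub> y \<in> fl (Suc n) i"
  shows "co n i x = co n i y"
proof -
  have "x \<in> co n i y"
    using abelian_subgroup.a_rcos_module[OF V_abelian_subgroup assms(2,1)] assms(3) unfolding a_minus_def by simp
  from abelian_subgroup.a_repr_independence'[OF V_abelian_subgroup this assms(2)] show ?thesis by simp
qed

lemma co_mem_imp:
  assumes "x \<in> carrier (Fr (rk i))" "y \<in> co n i x"
  shows "y \<in> carrier (Fr (rk i))" "y \<ominus>\<^bsub>Fr (rk i)\<^esub> x \<in> fl (Suc n) i"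
proof -
  show y: "y \<in> carrier (Fr (rk i))"
    using assms fl_Fr by (auto simp: a_r_coset_def' simp del: free_module_simps(1))
  show "y \<ominus>\<^bsub>Fr (rk i)\<^esub> x \<in> fl (Suc n) i"
    using abelian_subgroup.a_rcos_module[OF V_abelian_subgroup assms(1) y] assms(2) unfolding a_minus_def by simp
qed

lemma co_self: "x \<in> carrier (Fr (rk i)) \<Longrightarrow> x \<in> co n i x"
  by (rule abelian_subgroup.a_rcos_self[OF V_abelian_subgroup])

lemma co_one: "co n i \<zero>\<^bsub>Fr (rk i)\<^esub> = \<one>\<^bsub>gr_piece R F n i\<^esub>"
  unfolding gr_piece_one by (rule abelian_subgroup.a_rcos_const[OF V_abelian_subgroup V_zero])

text \<open>The induced differential is \<open>d\<close> on representatives. The coset depends on the representative only up to elements of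
  the next filtration step, which \<open>d\<close> respects.\<close>

lemma lin_diff_co:
  assumes x: "x \<in> fl n (Suc i)" and \<xi>: "\<xi> n = co n (Suc i) x"
  shows "lin_diff R F i \<xi> n = co n i (d i x)"
proof -
  have xc: "x \<in> carrier (Fr (rk (Suc i)))" by (rule fl_Fr[OF x])
  have "co n i (d i y) = co n i (d i x)" if y: "y \<in> co n (Suc i) x" for y
  proof -
    note y' = co_mem_imp[OF xc y]
    have "d i y \<ominus>\<^bsub>Fr (rk i)\<^esub> d i x \<in> fl (Suc n) i"
      using diff_fl[OF y'(2)] unfolding module_hom_minus[OF Fr Fr diff_hom y'(1) xc] .
    then show ?thesis by (rule co_eqI[OF module_hom_closed[OF diff_hom y'(1)] module_hom_closed[OF diff_hom xc]])
  qed
  moreover have "x \<in> co n (Suc i) x" by (rule co_self[OF xc])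
  ultimately have "(\<Union>y\<in>co n (Suc i) x. co n i (d i y)) = co n i (d i x)" by blast
  then show ?thesis unfolding lin_diff_def filt_eq cx_module_def \<xi> .
qed

lemma lin_part_group: "group (lin_part R F i)"
  unfolding lin_part_def by (rule sum_group) (rule gr_piece_group)

lemma lin_part_carrier:
  "\<xi> \<in> carrier (lin_part R F i) \<longleftrightarrow>
     (\<forall>n. \<xi> n \<in> carrier (gr_piece R F n i)) \<and> finite {n. \<xi> n \<noteq> \<one>\<^bsub>gr_piece R F n i\<^esub>}"
  unfolding lin_part_def by (subst carrier_sum_group) (auto simp: gr_piece_group)

lemma lin_part_rep:
  assumes "\<xi> \<in> carrier (lin_part R F i)"
  obtains x where "x \<in> fl n i" "\<xi> n = co n i x"
proof -
  have "\<xi> n \<in> co n i ` fl n i" using assms unfolding lin_part_carrier gr_piece_carrier by blast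
  then show thesis by (elim imageE) (rule that)
qed

lemma lin_diff_closed:
  assumes \<xi>: "\<xi> \<in> carrier (lin_part R F (Suc i))"
  shows "lin_diff R F i \<xi> \<in> carrier (lin_part R F i)"
  unfolding lin_part_carrier
proof (intro conjI allI)
  fix n
  obtain x where x: "x \<in> fl n (Suc i)" "\<xi> n = co n (Suc i) x" by (rule lin_part_rep[OF \<xi>])
  show "lin_diff R F i \<xi> n \<in> carrier (gr_piece R F n i)"
    unfolding lin_diff_co[of x i n \<xi>, OF x] gr_piece_carrier by (rule imageI[OF diff_fl[OF x(1)]])
next
  have "lin_diff R F i \<xi> n = \<one>\<^bsub>gr_piece R F n i\<^esub>" if "\<xi> n = \<one>\<^bsub>gr_piece R F n (Suc i)\<^esub>" for n
  proof -
    have "lin_diff R F i \<xi> n = co n i (d i \<zero>\<^bsub>Fr (rk (Suc i))\<^esub>)"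
      by (rule lin_diff_co[OF V_zero]) (simp only: that co_one)
    then show ?thesis unfolding module_hom_zero[OF Fr Fr diff_hom] co_one .
  qed
  then have "{n. lin_diff R F i \<xi> n \<noteq> \<one>\<^bsub>gr_piece R F n i\<^esub>} \<subseteq> {n. \<xi> n \<noteq> \<one>\<^bsub>gr_piece R F n (Suc i)\<^esub>}" by blast
  then show "finite {n. lin_diff R F i \<xi> n \<noteq> \<one>\<^bsub>gr_piece R F n i\<^esub>}"
    by (rule finite_subset) (use \<xi> in \<open>simp add: lin_part_carrier\<close>)
qed

lemma lin_part_mult: "(\<xi> \<otimes>\<^bsub>lin_part R F i\<^esub> \<eta>) n = \<xi> n \<otimes>\<^bsub>gr_piece R F n i\<^esub> \<eta> n"
  unfolding lin_part_def by simp

lemma lin_part_one: "\<one>\<^bsub>lin_part R F i\<^esub> = (\<lambda>n. \<one>\<^bsub>gr_piece R F n i\<^esub>)"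
  unfolding lin_part_def by (simp add: fun_eq_iff)

lemma lin_diff_hom: "lin_diff R F i \<in> hom (lin_part R F (Suc i)) (lin_part R F i)"
proof (rule homI)
  fix \<xi> \<eta> assume \<xi>: "\<xi> \<in> carrier (lin_part R F (Suc i))" and \<eta>: "\<eta> \<in> carrier (lin_part R F (Suc i))"
  show "lin_diff R F i (\<xi> \<otimes>\<^bsub>lin_part R F (Suc i)\<^esub> \<eta>) = lin_diff R F i \<xi> \<otimes>\<^bsub>lin_part R F i\<^esub> lin_diff R F i \<eta>"
  proof
    fix n
    obtain x where x: "x \<in> fl n (Suc i)" "\<xi> n = co n (Suc i) x" by (rule lin_part_rep[OF \<xi>])
    obtain y where y: "y \<in> fl n (Suc i)" "\<eta> n = co n (Suc i) y" by (rule lin_part_rep[OF \<eta>])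
    have s: "x \<oplus>\<^bsub>Fr (rk (Suc i))\<^esub> y \<in> fl n (Suc i)" by (rule Fr.submoduleE(5)[OF V_submodule x(1) y(1)])
    have "lin_diff R F i (\<xi> \<otimes>\<^bsub>lin_part R F (Suc i)\<^esub> \<eta>) n = co n i (d i (x \<oplus>\<^bsub>Fr (rk (Suc i))\<^esub> y))"
      by (rule lin_diff_co[OF s]) (simp only: lin_part_mult x(2) y(2) gr_piece_mult[OF x(1) y(1)])
    also have "\<dots> = co n i (d i x \<oplus>\<^bsub>Fr (rk i)\<^esub> d i y)"
      unfolding module_hom_add[OF diff_hom fl_Fr[OF x(1)] fl_Fr[OF y(1)]] ..
    also have "\<dots> = lin_diff R F i \<xi> n \<otimes>\<^bsub>gr_piece R F n i\<^esub> lin_diff R F i \<eta> n"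
      unfolding lin_diff_co[of x i n \<xi>, OF x] lin_diff_co[of y i n \<eta>, OF y] by (rule gr_piece_mult[OF diff_fl[OF x(1)] diff_fl[OF y(1)], symmetric])
    finally show "lin_diff R F i (\<xi> \<otimes>\<^bsub>lin_part R F (Suc i)\<^esub> \<eta>) n
        = (lin_diff R F i \<xi> \<otimes>\<^bsub>lin_part R F i\<^esub> lin_diff R F i \<eta>) n" unfolding lin_part_mult .
  qed
qed (rule lin_diff_closed)

lemma co_eq_one_imp:
  assumes "x \<in> carrier (Fr (rk i))" "co n i x = \<one>\<^bsub>gr_piece R F n i\<^esub>"
  shows "x \<in> fl (Suc n) i"
  using co_self[OF assms(1), of n] unfolding assms(2) gr_piece_one .

text \<open>Suppose \<open>x\<close> has order \<open>k\<close> and \<open>d x\<close> has order \<open>k + 2\<close>. By linearity \<open>d x = d w\<close> with \<open>w\<close> of order \<open>k + 1\<close>, and \<open>w\<close>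
  vanishes in the graded piece of \<open>x\<close>. The cycle \<open>x - w\<close> is a boundary \<open>d u\<close> of order \<open>k\<close>, and by linearity one step up
  it equals \<open>d z\<close> with \<open>z\<close> of order \<open>k - 1\<close>. For \<open>n \<le> i\<close> the graded piece in degree \<open>i + 1\<close> is zero.\<close>

lemma boundary_lift:
  assumes x: "x \<in> fl n (Suc i)" and dx: "d i x \<in> fl (Suc n) i"
  shows "\<exists>z \<in> fl n (Suc (Suc i)). co n (Suc i) (d (Suc i) z) = co n (Suc i) x"
proof (cases "n \<le> i")
  case True
  have "fl (Suc n) (Suc i) = vecs (rk (Suc i)) (carrier R)" using True by simp
  moreover have dz: "d (Suc i) \<zero>\<^bsub>Fr (rk (Suc (Suc i)))\<^esub> \<in> carrier (Fr (rk (Suc i)))"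
    by (rule module_hom_closed[OF diff_hom Fr.M.zero_closed])
  ultimately have "d (Suc i) \<zero>\<^bsub>Fr (rk (Suc (Suc i)))\<^esub> \<ominus>\<^bsub>Fr (rk (Suc i))\<^esub> x \<in> fl (Suc n) (Suc i)"
    using Fr.M.minus_closed[OF dz fl_Fr[OF x]] by simp
  note co_eqI[OF dz fl_Fr[OF x] this]
  then show ?thesis by (rule_tac bexI[OF _ V_zero])
next
  case False
  define k where "k = n - Suc i"
  have k: "Suc n - i = Suc (Suc k)" "Suc n - Suc i = Suc k" "n - Suc (Suc i) = k - 1" unfolding k_def using False by auto
  have xc: "x \<in> carrier (Fr (rk (Suc i)))" by (rule fl_Fr[OF x])
  have "d i x \<in> V (rk i) (Suc (Suc k))" using dx unfolding k .
  from linear_coverD[OF linear xc this] obtain w where w: "w \<in> V (rk (Suc i)) (Suc k)" "d i w = d i x" .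
  have wc: "w \<in> carrier (Fr (rk (Suc i)))" by (rule Fr_carrier_V[OF w(1)])
  let ?y = "x \<ominus>\<^bsub>Fr (rk (Suc i))\<^esub> w"
  have yc: "?y \<in> carrier (Fr (rk (Suc i)))" by (rule Fr.M.minus_closed[OF xc wc])
  have "d i ?y = \<zero>\<^bsub>Fr (rk i)\<^esub>"
    unfolding module_hom_minus[OF Fr Fr diff_hom xc wc] w(2)
    by (rule Fr_minus_self) (use module_hom_closed[OF diff_hom xc] in simp)
  then have "?y \<in> d (Suc i) ` carrier (Fr (rk (Suc (Suc i))))"
    unfolding exact[symmetric] by (rule a_kernelI[OF yc])
  then obtain u where u: "u \<in> carrier (Fr (rk (Suc (Suc i))))" "?y = d (Suc i) u" by (elim imageE)
  have "x \<in> V (rk (Suc i)) k" using x unfolding k_def .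
  then have yV: "?y \<in> V (rk (Suc i)) k" by (rule Fr.submodule_minus_mem[OF V_submodule _ V_Suc_subset[OF w(1)]])
  have "\<exists>z \<in> V (rk (Suc (Suc i))) (k - 1). d (Suc i) z = ?y"
  proof (cases k)
    case 0
    then show ?thesis using u by (intro bexI[of _ u]) simp_all
  next
    case (Suc m)
    have "d (Suc i) u \<in> V (rk (Suc i)) (Suc m)" using yV unfolding u(2) Suc .
    from linear_coverD[OF linear u(1) this] obtain z where "z \<in> V (rk (Suc (Suc i))) m" "d (Suc i) z = d (Suc i) u" .
    then show ?thesis unfolding u(2) Suc by (intro bexI[of _ z]) simp_all
  qed
  then obtain z where z: "z \<in> V (rk (Suc (Suc i))) (k - 1)" "d (Suc i) z = ?y" by blast
  have "x \<ominus>\<^bsub>Fr (rk (Suc i))\<^esub> ?y = w"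
  proof -
    have "(\<zero>\<^bsub>Fr (rk (Suc i))\<^esub> \<oplus>\<^bsub>Fr (rk (Suc i))\<^esub> x) \<ominus>\<^bsub>Fr (rk (Suc i))\<^esub> ?y = \<zero>\<^bsub>Fr (rk (Suc i))\<^esub> \<oplus>\<^bsub>Fr (rk (Suc i))\<^esub> w"
      by (rule Fr.M.add_diff_diff[OF Fr.M.zero_closed xc wc])
    then show ?thesis unfolding Fr.M.l_zero[OF xc] Fr.M.l_zero[OF wc] .
  qed
  then have "x \<ominus>\<^bsub>Fr (rk (Suc i))\<^esub> d (Suc i) z \<in> fl (Suc n) (Suc i)" unfolding z(2) k using w(1) by simp
  moreover have "d (Suc i) z \<in> carrier (Fr (rk (Suc i)))" unfolding z(2) by (rule yc)
  ultimately have "co n (Suc i) x = co n (Suc i) (d (Suc i) z)" by (intro co_eqI[OF xc])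
  moreover have "z \<in> fl n (Suc (Suc i))" using z(1) unfolding k .
  ultimately show ?thesis by (intro bexI[of _ z]) simp
qed

lemma lin_cycles_eq_boundaries: "lin_cycles R F (Suc i) = lin_boundaries R F (Suc i)"
proof (intro equalityI subsetI)
  fix \<xi> assume "\<xi> \<in> lin_cycles R F (Suc i)"
  then have \<xi>: "\<xi> \<in> carrier (lin_part R F (Suc i))" and \<xi>0: "lin_diff R F i \<xi> = \<one>\<^bsub>lin_part R F i\<^esub>"
    unfolding lin_cycles_def kernel_def by auto
  \<comment> \<open>zero components get the representative zero, so that the lift has finite support\<close>
  have "\<exists>z \<in> fl n (Suc (Suc i)). co n (Suc i) (d (Suc i) z) = \<xi> n \<and>
      (\<xi> n = \<one>\<^bsub>gr_piece R F n (Suc i)\<^esub> \<longrightarrow> z = \<zero>\<^bsub>Fr (rk (Suc (Suc i)))\<^esub>)" for n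
  proof (cases "\<xi> n = \<one>\<^bsub>gr_piece R F n (Suc i)\<^esub>")
    case True
    have "co n (Suc i) (d (Suc i) \<zero>\<^bsub>Fr (rk (Suc (Suc i)))\<^esub>) = \<xi> n"
      unfolding True module_hom_zero[OF Fr Fr diff_hom] co_one ..
    then show ?thesis by (intro bexI[OF _ V_zero]) simp
  next
    case False
    obtain x where x: "x \<in> fl n (Suc i)" "\<xi> n = co n (Suc i) x" by (rule lin_part_rep[OF \<xi>])
    have "co n i (d i x) = \<one>\<^bsub>gr_piece R F n i\<^esub>"
      unfolding lin_diff_co[of x i n \<xi>, OF x, symmetric] \<xi>0 lin_part_one ..
    then have "d i x \<in> fl (Suc n) i" by (rule co_eq_one_imp[OF module_hom_closed[OF diff_hom fl_Fr[OF x(1)]]])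
    from boundary_lift[OF x(1) this] show ?thesis using False unfolding x(2) by blast
  qed
  then obtain z where z: "\<And>n. z n \<in> fl n (Suc (Suc i))" "\<And>n. co n (Suc i) (d (Suc i) (z n)) = \<xi> n"
    "\<And>n. \<xi> n = \<one>\<^bsub>gr_piece R F n (Suc i)\<^esub> \<Longrightarrow> z n = \<zero>\<^bsub>Fr (rk (Suc (Suc i)))\<^esub>" by metis
  define \<zeta> where "\<zeta> n = co n (Suc (Suc i)) (z n)" for n
  have "\<zeta> \<in> carrier (lin_part R F (Suc (Suc i)))"
    unfolding lin_part_carrier
  proof (intro conjI allI)
    show "\<zeta> n \<in> carrier (gr_piece R F n (Suc (Suc i)))" for n
      unfolding gr_piece_carrier \<zeta>_def by (rule imageI[OF z(1)])
    have "\<zeta> n = \<one>\<^bsub>gr_piece R F n (Suc (Suc i))\<^esub>" if "\<xi> n = \<one>\<^bsub>gr_piece R F n (Suc i)\<^esub>" for n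
      unfolding \<zeta>_def z(3)[OF that] by (rule co_one)
    then have "{n. \<zeta> n \<noteq> \<one>\<^bsub>gr_piece R F n (Suc (Suc i))\<^esub>} \<subseteq> {n. \<xi> n \<noteq> \<one>\<^bsub>gr_piece R F n (Suc i)\<^esub>}" by blast
    then show "finite {n. \<zeta> n \<noteq> \<one>\<^bsub>gr_piece R F n (Suc (Suc i))\<^esub>}"
      by (rule finite_subset) (use \<xi> in \<open>simp add: lin_part_carrier\<close>)
  qed
  moreover have "\<xi> = lin_diff R F (Suc i) \<zeta>"
  proof
    fix n
    show "\<xi> n = lin_diff R F (Suc i) \<zeta> n"
      unfolding lin_diff_co[of "z n" "Suc i" n \<zeta>, OF z(1) \<zeta>_def] by (rule z(2)[symmetric])
  qed
  ultimately show "\<xi> \<in> lin_boundaries R F (Suc i)" unfolding lin_boundaries_def by (intro image_eqI)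
next
  fix \<xi> assume "\<xi> \<in> lin_boundaries R F (Suc i)"
  then obtain \<zeta> where \<zeta>: "\<zeta> \<in> carrier (lin_part R F (Suc (Suc i)))" "\<xi> = lin_diff R F (Suc i) \<zeta>"
    unfolding lin_boundaries_def by (elim imageE)
  have "lin_diff R F i \<xi> = \<one>\<^bsub>lin_part R F i\<^esub>"
  proof
    fix n
    obtain z where z: "z \<in> fl n (Suc (Suc i))" "\<zeta> n = co n (Suc (Suc i)) z" by (rule lin_part_rep[OF \<zeta>(1)])
    have "\<xi> n = co n (Suc i) (d (Suc i) z)" unfolding \<zeta>(2) by (rule lin_diff_co[of z "Suc i" n \<zeta>, OF z])
    from lin_diff_co[of "d (Suc i) z" i n \<xi>, OF diff_fl[OF z(1)] this] have "lin_diff R F i \<xi> n = co n i (d i (d (Suc i) z))" .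
    also have "\<dots> = \<one>\<^bsub>gr_piece R F n i\<^esub>" unfolding diff_diff[OF fl_Fr[OF z(1)]] by (rule co_one)
    finally show "lin_diff R F i \<xi> n = \<one>\<^bsub>lin_part R F i\<^esub> n" unfolding lin_part_one .
  qed
  then show "\<xi> \<in> lin_cycles R F (Suc i)"
    using lin_diff_closed[OF \<zeta>(1)] unfolding lin_cycles_def kernel_def \<zeta>(2) by simp
qed

lemma lin_homology_trivial: "trivial_group (lin_homology R F (Suc i))"
proof -
  interpret G: group "lin_part R F (Suc i)" by (rule lin_part_group)
  have gh: "group_hom (lin_part R F (Suc i)) (lin_part R F i) (lin_diff R F i)"
    by (intro group_hom.intro lin_part_group group_hom_axioms.intro lin_diff_hom)
  have "subgroup (lin_cycles R F (Suc i)) (lin_part R F (Suc i))"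
    unfolding lin_cycles_def using group_hom.subgroup_kernel[OF gh] by simp
  from G.trivial_group_self_quotient[OF this] show ?thesis
    unfolding lin_homology_def lin_cycles_eq_boundaries .
qed

lemma Sup_nontrivial: "Sup {enat i | i. \<not> trivial_group (lin_homology R F i)} = 0"
proof (rule antisym[OF Sup_least])
  fix e assume "e \<in> {enat i | i. \<not> trivial_group (lin_homology R F i)}"
  then obtain i where "e = enat i" "\<not> trivial_group (lin_homology R F i)" by blast
  then show "e \<le> 0" using lin_homology_trivial by (cases i) (auto simp: zero_enat_def)
qed simp

end

section \<open>Koszul modules and Koszul rings\<close>

context noeth_local
begin

lemma quot_module_simps [simp]:
  "carrier (quot_module R I) = carrier (R Quot I)"
  "\<zero>\<^bsub>quot_module R I\<^esub> = \<zero>\<^bsub>R Quot I\<^esub>"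
  "x \<oplus>\<^bsub>quot_module R I\<^esub> y = x \<oplus>\<^bsub>R Quot I\<^esub> y"
  "r \<odot>\<^bsub>quot_module R I\<^esub> x = (I +> r) \<otimes>\<^bsub>R Quot I\<^esub> x"
  by (simp_all add: quot_module_def)

lemma quot_module_module:
  assumes I: "ideal I R"
  shows "module R (quot_module R I)"
proof -
  interpret I: ideal I R by (rule I)
  interpret S: cring "R Quot I" by (rule I.quotient_is_cring[OF is_cring])
  have hc: "I +> a \<in> carrier (R Quot I)" if "a \<in> carrier R" for a
    using ring_hom_closed[OF I.rcos_ring_hom that] .
  have "abelian_group (quot_module R I)"
  proof (rule abelian_groupI)
    show "\<exists>y\<in>carrier (quot_module R I). y \<oplus>\<^bsub>quot_module R I\<^esub> x = \<zero>\<^bsub>quot_module R I\<^esub>"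
      if "x \<in> carrier (quot_module R I)" for x
      using that S.l_neg[of x] by (intro bexI[of _ "\<ominus>\<^bsub>R Quot I\<^esub> x"]) simp_all
  qed (simp_all add: S.a_ac)
  then show ?thesis
    using hc ring_hom_add[OF I.rcos_ring_hom] ring_hom_mult[OF I.rcos_ring_hom] ring_hom_one[OF I.rcos_ring_hom]
    by (intro moduleI is_cring) (simp_all add: S.l_distr S.r_distr S.m_assoc)
qed

lemma quot_module_fin_gen:
  assumes I: "ideal I R"
  shows "fin_gen_module R (quot_module R I)"
proof -
  interpret I: ideal I R by (rule I)
  interpret S: cring "R Quot I" by (rule I.quotient_is_cring[OF is_cring])
  interpret M: module R "quot_module R I" by (rule quot_module_module[OF I])
  have hc: "I +> a \<in> carrier (R Quot I)" if "a \<in> carrier R" for a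
    using ring_hom_closed[OF I.rcos_ring_hom that] .
  let ?S = "{a \<odot>\<^bsub>quot_module R I\<^esub> x | a x. a \<in> carrier R \<and> x \<in> {\<one>\<^bsub>R Quot I\<^esub>}}"
  have "?S = carrier (quot_module R I)"
  proof (intro equalityI subsetI)
    fix y assume "y \<in> ?S"
    then show "y \<in> carrier (quot_module R I)" using hc by auto
  next
    fix y assume "y \<in> carrier (quot_module R I)"
    then obtain a where a: "a \<in> carrier R" "y = I +> a" unfolding quot_module_simps FactRing_def A_RCOSETS_def' by auto
    then have "y = a \<odot>\<^bsub>quot_module R I\<^esub> \<one>\<^bsub>R Quot I\<^esub>" using hc by simp
    then show "y \<in> ?S" using a(1) by blast
  qed
  moreover have "generate (add_monoid (quot_module R I)) (carrier (quot_module R I)) = carrier (quot_module R I)"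
    using M.add.generate_incl[of "carrier (quot_module R I)"] generate.incl[of _ "carrier (quot_module R I)" "add_monoid (quot_module R I)"]
    by auto
  ultimately show ?thesis
    unfolding fin_gen_module_def using M.module_axioms by (intro conjI exI[of _ "{\<one>\<^bsub>R Quot I\<^esub>}"]) simp_all
qed

lemma quot_module_cover:
  assumes I: "ideal I R"
  obtains \<epsilon> where "\<epsilon> \<in> module_hom R (Fr 1) (quot_module R I)"
    "\<epsilon> ` carrier (Fr 1) = carrier (quot_module R I)" "a_kernel (Fr 1) (quot_module R I) \<epsilon> = vecs 1 I"
proof -
  interpret I: ideal I R by (rule I)
  interpret S: cring "R Quot I" by (rule I.quotient_is_cring[OF is_cring])
  let ?\<epsilon> = "\<lambda>v. v (0::nat) \<odot>\<^bsub>quot_module R I\<^esub> \<one>\<^bsub>R Quot I\<^esub>"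
  have hom: "?\<epsilon> \<in> module_hom R (Fr 1) (quot_module R I)"
    by (rule hom_single[OF quot_module_module[OF I]]) simp
  have eq: "?\<epsilon> v = I +> v 0" if "v \<in> carrier (Fr 1)" for v
  proof -
    have "v 0 \<in> carrier R" using that by auto
    then show ?thesis using ring_hom_closed[OF I.rcos_ring_hom] by simp
  qed
  have "?\<epsilon> ` carrier (Fr 1) = carrier (quot_module R I)"
  proof (intro equalityI subsetI)
    fix y assume "y \<in> ?\<epsilon> ` carrier (Fr 1)"
    then show "y \<in> carrier (quot_module R I)" using module_hom_closed[OF hom] by blast
  next
    fix y assume "y \<in> carrier (quot_module R I)"
    then obtain a where a: "a \<in> carrier R" "y = I +> a" unfolding quot_module_simps FactRing_def A_RCOSETS_def' by auto
    have s: "single a \<in> carrier (Fr 1)" using a(1) by (simp only: single_mem free_module_simps)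
    have "y = ?\<epsilon> (single a)" unfolding eq[OF s] unfolding a(2) single_nth ..
    then show "y \<in> ?\<epsilon> ` carrier (Fr 1)" using s by (rule image_eqI)
  qed
  moreover have "a_kernel (Fr 1) (quot_module R I) ?\<epsilon> = vecs 1 I"
  proof -
    have "I +> a = \<zero>\<^bsub>R Quot I\<^esub> \<longleftrightarrow> a \<in> I" if "a \<in> carrier R" for a
    proof -
      have "I +> a = \<zero>\<^bsub>R Quot I\<^esub> \<longleftrightarrow> I +> a = I" by (simp add: FactRing_def)
      also have "\<dots> \<longleftrightarrow> a \<in> I" using I.a_rcos_self[OF that] I.a_rcos_const[of a] by auto
      finally show ?thesis .
    qed
    note zero_iff = this
    have *: "v \<in> a_kernel (Fr 1) (quot_module R I) ?\<epsilon> \<longleftrightarrow> v \<in> carrier (Fr 1) \<and> v 0 \<in> I" for v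
    proof (cases "v \<in> carrier (Fr 1)")
      case True
      have "v 0 \<in> carrier R" using True by auto
      from zero_iff[OF this] show ?thesis
        using True unfolding mem_a_kernel eq[OF True] unfolding quot_module_simps by blast
    qed (simp add: mem_a_kernel)
    have "v \<in> carrier (Fr 1) \<and> v 0 \<in> I \<longleftrightarrow> v \<in> vecs 1 I" for v
      using vec_ideal_carrier[OF I, of v 1] by (auto simp: PiE_iff)
    then show ?thesis using * by blast
  qed
  ultimately show thesis using hom by (intro that)
qed

text \<open>Minimal covers are iterated by dependent choice. The state is a rank together with a submodule of the free module
  of that rank, whose minimal cover comes next.\<close>

lemma minimal_free_resolution_exists:
  assumes I: "ideal I R" "I \<subseteq> max_ideal R"
  shows "\<exists>F \<epsilon>. minimal_free_resolution R (quot_module R I) F \<epsilon>"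
proof -
  obtain \<epsilon> where \<epsilon>: "\<epsilon> \<in> module_hom R (Fr 1) (quot_module R I)"
    "\<epsilon> ` carrier (Fr 1) = carrier (quot_module R I)" "a_kernel (Fr 1) (quot_module R I) \<epsilon> = vecs 1 I"
    by (rule quot_module_cover[OF I(1)])
  define P where "P n p \<longleftrightarrow> (n = 0 \<longrightarrow> p = (1, vecs 1 I)) \<and> submodule (snd p) R (Fr (fst p)) \<and> snd p \<subseteq> V (fst p) (Suc 0)"
    for n :: nat and p
  define Q where "Q p q \<longleftrightarrow> (\<exists>\<delta> \<in> Hom (fst q) (fst p). \<delta> ` carrier (Fr (fst q)) = snd p \<and> Ker (fst q) (fst p) \<delta> = snd q)" for p q
  have "\<exists>f. \<forall>n. P n (f n) \<and> Q (f n) (f (Suc n))"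
  proof (rule dependent_nat_choice)
    show "\<exists>p. P 0 p"
      unfolding P_def using vec_ideal_submodule[OF I(1)] vec_V1[OF I(2)] by (intro exI[of _ "(1, vecs 1 I)"]) simp
  next
    fix p n assume p: "P n p"
    obtain c \<delta> where \<delta>: "\<delta> \<in> Hom c (fst p)" "\<delta> ` carrier (Fr c) = snd p" "Ker c (fst p) \<delta> \<subseteq> V c (Suc 0)"
      by (rule minimal_cover[of "snd p" "fst p"]) (use p in \<open>simp_all add: P_def\<close>)
    have "P (Suc n) (c, Ker c (fst p) \<delta>)" unfolding P_def using Ker_submodule[OF \<delta>(1)] \<delta>(3) by simp
    moreover have "Q p (c, Ker c (fst p) \<delta>)" unfolding Q_def using \<delta>(1,2) by (intro bexI[of _ \<delta>]) simp_all
    ultimately show "\<exists>q. P (Suc n) q \<and> Q p q" by blast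
  qed
  then obtain f where f: "\<And>n. P n (f n)" "\<And>n. Q (f n) (f (Suc n))" by blast
  define r where "r n = fst (f n)" for n
  define Z where "Z n = snd (f n)" for n
  have f0: "f 0 = (1, vecs 1 I)" using f(1)[of 0] by (simp add: P_def)
  have rZ: "r 0 = 1" "Z 0 = vecs 1 I" by (simp_all add: r_def Z_def f0)
  have ZV: "Z n \<subseteq> V (r n) (Suc 0)" for n using f(1)[of n] unfolding P_def r_def Z_def by blast
  have "\<forall>n. \<exists>\<delta>. \<delta> \<in> Hom (r (Suc n)) (r n) \<and> \<delta> ` carrier (Fr (r (Suc n))) = Z n \<and> Ker (r (Suc n)) (r n) \<delta> = Z (Suc n)"
    using f(2) unfolding Q_def r_def Z_def by blast
  then obtain \<delta> where \<delta>: "\<And>n. \<delta> n \<in> Hom (r (Suc n)) (r n)" "\<And>n. \<delta> n ` carrier (Fr (r (Suc n))) = Z n"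
    "\<And>n. Ker (r (Suc n)) (r n) (\<delta> n) = Z (Suc n)" by metis
  define F where "F = \<lparr>cx_rank = r, cx_diff = \<delta>\<rparr>"
  have F: "cx_module R F i = Fr (r i)" "cx_diff F i = \<delta> i" for i by (simp_all add: F_def cx_module_def)
  have mF: "ideal_smult (max_ideal R) (Fr n) = V n (Suc 0)" for n
    unfolding V_1 by (rule ideal_smult_free_module[OF max_ideal_ideal])
  have "minimal_free_resolution R (quot_module R I) F \<epsilon>"
    unfolding minimal_free_resolution_def F mF One_nat_def \<delta>(2,3) rZ
    using \<epsilon> \<delta>(1) ZV by (simp only: One_nat_def) blast
  then show ?thesis by blast
qed

text \<open>A minimal free resolution of \<open>R/I\<close> is compared with the cover \<open>R \<rightarrow> R/I\<close>, whose kernel \<open>I\<close> is known to be linear. From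
  there on, linearity is passed along the resolution.\<close>

lemma linear_resolution_of_minimal:
  assumes I: "ideal I R" and lin: "\<And>n. linear_syz R n 1 (vecs 1 I)"
    and F: "minimal_free_resolution R (quot_module R I) F \<epsilon>"
  shows "linear_resolution R F"
proof -
  let ?M = "quot_module R I"
  let ?r = "cx_rank F" and ?d = "cx_diff F"
  have mF: "ideal_smult (max_ideal R) (Fr n) = V n (Suc 0)" for n
    unfolding V_1 by (rule ideal_smult_free_module[OF max_ideal_ideal])
  note F' = F[unfolded minimal_free_resolution_def cx_module_def mF]
  have d: "?d i \<in> Hom (?r (Suc i)) (?r i)" for i using F' by blast
  have eps: "\<epsilon> \<in> module_hom R (Fr (?r 0)) ?M" "\<epsilon> ` carrier (Fr (?r 0)) = carrier ?M"
    "a_kernel (Fr (?r 0)) ?M \<epsilon> = ?d 0 ` carrier (Fr (?r (Suc 0)))"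
    using F' by (simp_all only: One_nat_def)
  have ex: "Ker (?r (Suc i)) (?r i) (?d i) = ?d (Suc i) ` carrier (Fr (?r (Suc (Suc i))))" for i
    using F' by blast
  have min: "?d i ` carrier (Fr (?r (Suc i))) \<subseteq> V (?r i) (Suc 0)" for i
    using F' by blast
  obtain \<epsilon>1 where \<epsilon>1: "\<epsilon>1 \<in> module_hom R (Fr 1) ?M" "\<epsilon>1 ` carrier (Fr 1) = carrier ?M"
    "a_kernel (Fr 1) ?M \<epsilon>1 = vecs 1 I"
    by (rule quot_module_cover[OF I])
  have "homotopy_retract R 1 (vecs 1 I) (?r 0) (?d 0 ` carrier (Fr (?r (Suc 0))))"
    using retract_of_covers[OF quot_module_module[OF I] \<epsilon>1(1,2) eps(1,2)] unfolding \<epsilon>1(3) eps(3) .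
  then have lin0: "linear_syz R n (?r 0) (?d 0 ` carrier (Fr (?r (Suc 0))))" for n
    by (rule linear_syz_retract[OF lin _ Fr_image_submodule[OF d Fr]])
  have linear: "\<forall>n. linear_syz R n (?r i) (?d i ` carrier (Fr (?r (Suc i))))" for i
  proof (induction i)
    case (Suc i)
    have "linear_syz R n (?r (Suc i)) (Ker (?r (Suc i)) (?r i) (?d i))" for n
      by (rule linear_syz_SucD(2)[OF _ d refl]) (use Suc in blast)
    then show ?case unfolding ex by blast
  qed (use lin0 in blast)
  have "linear_cover R (?r (Suc i)) (?r i) (?d i)" for i
    by (rule linear_syz_SucD(1)[OF _ d refl, of 0]) (use linear in blast)
  then show ?thesis
    by (intro linear_resolution.intro noeth_local_axioms linear_resolution_axioms.intro d ex min)
qed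

theorem koszul_module_quotient:
  assumes I: "ideal I R" "I \<subseteq> max_ideal R" and lin: "\<And>n. linear_syz R n 1 (vecs 1 I)"
  shows "koszul_module R (quot_module R I)"
proof -
  define F where "F = (SOME F. \<exists>\<epsilon>. minimal_free_resolution R (quot_module R I) F \<epsilon>)"
  have "\<exists>\<epsilon>. minimal_free_resolution R (quot_module R I) F \<epsilon>"
    unfolding F_def by (rule someI_ex[OF minimal_free_resolution_exists[OF I]])
  then obtain \<epsilon> where F: "minimal_free_resolution R (quot_module R I) F \<epsilon>" by blast
  interpret linear_resolution R F by (rule linear_resolution_of_minimal[OF I(1) lin F])
  show ?thesis
    unfolding koszul_module_def linearity_defect_def F_def[symmetric] Let_def Sup_nontrivial
    using quot_module_fin_gen[OF I(1)] by simp
qed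

end

theorem theorem4p3:
  fixes R :: "('a, 'b) ring_scheme" and \<F> :: "'a set set"
  assumes "noetherian_local_ring R"
    and "koszul_filtration R \<F>"
  shows "(\<forall>I\<in>\<F>. koszul_module R (quot_module R I)) \<and>
         koszul_ring R \<and>
         (\<forall>I\<in>\<F>. koszul_ring (R Quot I))"
proof -
  interpret noeth_local R using assms(1) by (simp add: noetherian_local_ring_iff)
  note F = koszul_filtrationD[OF assms(2)]
  have modules: "koszul_module R (quot_module R I)" if "I \<in> \<F>" for I
    by (rule koszul_module_quotient[OF F(1)[OF that] koszul_filtration_subset_max_ideal[OF assms(2) that]
          koszul_filtration_linear_syz[OF assms(2) that]])
  moreover have "koszul_ring R"
    unfolding koszul_ring_def using assms(1) modules[OF F(3)] by blast
  moreover have "koszul_ring (R Quot I)" if I: "I \<in> \<F>" for I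
  proof -
    interpret S: noeth_local "R Quot I"
      by (rule quotient_noeth_local[OF F(1)[OF I] koszul_filtration_subset_max_ideal[OF assms(2) I]])
    have "koszul_module (R Quot I) (quot_module (R Quot I) (max_ideal (R Quot I)))"
      by (rule S.koszul_module_quotient[OF S.max_ideal_ideal subset_refl
            koszul_filtration_quotient_linear_syz[OF assms(2) I]])
    then show ?thesis
      unfolding koszul_ring_def noetherian_local_ring_iff using S.noeth_local_axioms by blast
  qed
  ultimately show ?thesis by blast
qed

end
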